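(* Fix integers $n\ge 2$ and $k \geq 1$. For $i = 1,2,\ldots$ let $X_i$ be an ISGN in $\mathbb{R}^n$, and suppose that $X_i$ converges weakly to the multiplicity $k$ $E_1$-axis (i.e. $\mu_{X_i}\to k\,\mathcal{H}^1$ restricted to the $E_1$-axis, weakly as Radon measures on $\mathbb{R}^n$). Fix a bounded open interval $I \subset \mathbb{R}$. Fix $0 < r < R$ and $\theta > 0$. Then there is an $N = N(n,k,(X_i), I, R, r, \theta)$ such that for all $i \geq N$: (1) $X_i \cap T_{I,R} \subset T_{I,r}$. (2) At any regular point of $X_i \cap T_{I,R}$, any tangent vector to $X_i$ there makes an angle at most $\theta$ with the $E_1$-axis. (3) At any singular point $x$ of $X_i$ in $T_{I,R}$, the sum of the multiplicities of the geodesic segments/rays entering $x$ from the left and the sum of the multiplicities of those leaving $x$ from the right (in the $E_1$ direction) are equal. (4) For any $t \in I$, $|X_i \cap T_{t,R}| \leq k$, and $\sum_{x \in X_i \cap T_{t,R}} \Theta_{X_i}(x) = k$.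
   Context: $E_1,\dots,E_n$ is the standard orthonormal basis of $\mathbb{R}^n$. For $A \subset \mathbb{R}$ and $r>0$, the tube is $T_{A,r} = A \times B_r(0) \subset \mathbb{R}\times\mathbb{R}^{n-1}=\mathbb{R}^n$, where $B_r(0)$ is the open ball in $\mathbb{R}^{n-1}$; $T_{t,r} := T_{\{t\},r}$. The angle of a vector with the $E_1$-axis is the unoriented angle between lines, in $[0,\pi/2]$. A geodesic network in $\mathbb{R}^n$ is a closed subset $X \subset \mathbb{R}^n$ which is locally a finite embedded graph, each of whose edges is a geodesic of $\mathbb{R}^n$ (a straight segment, ray, or complete line). $X_{\mathrm{reg}} \subset X$ is the set of points around which $X$ is locally a straight segment, and $X_{\mathrm{sing}} = X \setminus X_{\mathrm{reg}}$ is the set of singular points. A geodesic network with multiplicity also carries a locally constant function $\Theta=\Theta_X : X_{\mathrm{reg}} \to (0,\infty)$; it is integral if $\Theta$ takes only positive integer values on $X_{\mathrm{reg}}$. $\Theta$ is extended to all of $\mathbb{R}^n$ by $\Theta(x) = \frac12\sum_j \Theta_j$ at $x \in X_{\mathrm{sing}}$, where $\Theta_1,\dots,\Theta_m$ are the multiplicities of the geodesics touching $x$, and by $\Theta = 0$ off $X$. The associated measure is $\mu_X = \Theta\, d\mathcal{H}^1$ (a Radon measure with support $X$). $X$ is stationary if at each $x \in X_{\mathrm{sing}}$, with $s_1,\dots,s_m$ the unit vectors at $x$ pointing along the geodesics leaving $x$ and $\Theta_1,\dots,\Theta_m$ their multiplicities, $\sum_{i} \Theta_i s_i = 0$. ISGN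 means integral stationary geodesic network: a geodesic network with multiplicity that is both integral and stationary. *)

theory Defs
  imports "HOL-Analysis.Analysis"
begin

section \<open>One-dimensional Hausdorff measure\<close>

text \<open>
  The side condition \<open>bounded\<close> is needed because the library's \<^const>\<open>diameter\<close> is
  unspecified on unbounded sets. For dimension 1 the usual normalising constant is 1,
  so that segments get their length.
\<close>

definition hausdorff1_pre :: "real \<Rightarrow> 'a::euclidean_space set \<Rightarrow> ennreal" where
  "hausdorff1_pre \<delta> A =
     (INF C \<in> {C :: nat \<Rightarrow> 'a set. A \<subseteq> (\<Union>j. C j) \<and> (\<forall>j. bounded (C j) \<and> diameter (C j) \<le> \<delta>)}.
        (\<Sum>j. ennreal (diameter (C j))))"

definition hausdorff1_outer :: "'a::euclidean_space set \<Rightarrow> ennreal" where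
  "hausdorff1_outer A = (SUP \<delta> \<in> {0<..}. hausdorff1_pre \<delta> A)"

definition hausdorff1 :: "'a::euclidean_space measure" where
  "hausdorff1 = measure_of UNIV (sets borel) hausdorff1_outer"


section \<open>Geodesic networks\<close>

text \<open>
  A finite embedded graph with straight edges is given by its finite set of edges, each a pair
  of distinct end points; different edges meet at most in common end points. Every vertex is an
  end point of an edge, so a network has no isolated points (they would not lie in the support
  of its measure).
\<close>

definition finite_straight_graph :: "('a::euclidean_space \<times> 'a) set \<Rightarrow> bool" where
  "finite_straight_graph E \<longleftrightarrow>
     finite E \<and> (\<forall>(a, b) \<in> E. a \<noteq> b) \<and>
     (\<forall>(a, b) \<in> E. \<forall>(c, d) \<in> E. (a, b) \<noteq> (c, d) \<longrightarrow>
        closed_segment a b \<inter> closed_segment c d \<subseteq> {a, b} \<inter> {c, d})"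

definition geodesic_network :: "'a::euclidean_space set \<Rightarrow> bool" where
  "geodesic_network X \<longleftrightarrow>
     closed X \<and>
     (\<forall>x \<in> X. \<exists>U E. open U \<and> x \<in> U \<and> finite_straight_graph E \<and>
        X \<inter> U = (\<Union>(a, b) \<in> E. closed_segment a b) \<inter> U)"

text \<open>\<open>X\<close> is, near \<open>x\<close>, a straight segment through \<open>x\<close> in the direction \<open>v\<close>.\<close>

definition tangent_vector :: "'a::euclidean_space set \<Rightarrow> 'a \<Rightarrow> 'a \<Rightarrow> bool" where
  "tangent_vector X x v \<longleftrightarrow>
     v \<noteq> 0 \<and> (\<exists>\<epsilon>>0. X \<inter> ball x \<epsilon> = {x + t *\<^sub>R v | t. True} \<inter> ball x \<epsilon>)"

definition regular_points :: "'a::euclidean_space set \<Rightarrow> 'a set" where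
  "regular_points X = {x \<in> X. \<exists>v. tangent_vector X x v}"

definition singular_points :: "'a::euclidean_space set \<Rightarrow> 'a set" where
  "singular_points X = X - regular_points X"

text \<open>Unit vectors at \<open>x\<close> pointing along the geodesics of \<open>X\<close> that leave \<open>x\<close>.\<close>

definition directions :: "'a::euclidean_space set \<Rightarrow> 'a \<Rightarrow> 'a set" where
  "directions X x = {s. norm s = 1 \<and> (\<forall>\<^sub>F t in at_right 0. x + t *\<^sub>R s \<in> X)}"


section \<open>Multiplicities\<close>

text \<open>
  A multiplicity is a total function of which only the values on \<^term>\<open>regular_points X\<close> matter.
\<close>

definition multiplicity_on :: "'a::euclidean_space set \<Rightarrow> ('a \<Rightarrow> real) \<Rightarrow> bool" where
  "multiplicity_on X \<Theta> \<longleftrightarrow>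
     (\<forall>x \<in> regular_points X. \<Theta> x > 0 \<and>
        (\<exists>U. open U \<and> x \<in> U \<and> (\<forall>y \<in> U \<inter> regular_points X. \<Theta> y = \<Theta> x)))"

definition integral_multiplicity :: "'a::euclidean_space set \<Rightarrow> ('a \<Rightarrow> real) \<Rightarrow> bool" where
  "integral_multiplicity X \<Theta> \<longleftrightarrow>
     (\<forall>x \<in> regular_points X. \<exists>m::nat. m \<ge> 1 \<and> \<Theta> x = real m)"

text \<open>
  Multiplicity of the geodesic leaving \<open>x\<close> in the direction \<open>s\<close>: the constant value of \<open>\<Theta>\<close> at the
  points of that geodesic near \<open>x\<close>, which are regular.
\<close>

definition edge_mult :: "('a::euclidean_space \<Rightarrow> real) \<Rightarrow> 'a \<Rightarrow> 'a \<Rightarrow> real" where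
  "edge_mult \<Theta> x s = (THE c. \<forall>\<^sub>F t in at_right 0. \<Theta> (x + t *\<^sub>R s) = c)"

definition mult_ext :: "'a::euclidean_space set \<Rightarrow> ('a \<Rightarrow> real) \<Rightarrow> 'a \<Rightarrow> real" where
  "mult_ext X \<Theta> x =
     (if x \<in> regular_points X then \<Theta> x
      else if x \<in> singular_points X then (1/2) * (\<Sum>s \<in> directions X x. edge_mult \<Theta> x s)
      else 0)"

definition network_measure :: "'a::euclidean_space set \<Rightarrow> ('a \<Rightarrow> real) \<Rightarrow> 'a measure" where
  "network_measure X \<Theta> = density hausdorff1 (\<lambda>x. ennreal (mult_ext X \<Theta> x))"

definition stationary :: "'a::euclidean_space set \<Rightarrow> ('a \<Rightarrow> real) \<Rightarrow> bool" where
  "stationary X \<Theta> \<longleftrightarrow>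
     (\<forall>x \<in> singular_points X. (\<Sum>s \<in> directions X x. edge_mult \<Theta> x s *\<^sub>R s) = 0)"

definition ISGN :: "'a::euclidean_space set \<Rightarrow> ('a \<Rightarrow> real) \<Rightarrow> bool" where
  "ISGN X \<Theta> \<longleftrightarrow>
     geodesic_network X \<and> multiplicity_on X \<Theta> \<and> integral_multiplicity X \<Theta> \<and> stationary X \<Theta>"


section \<open>Weak convergence of Radon measures\<close>

definition radon_weak_conv ::
    "(nat \<Rightarrow> 'a::euclidean_space measure) \<Rightarrow> 'a measure \<Rightarrow> bool" where
  "radon_weak_conv \<mu> \<nu> \<longleftrightarrow>
     (\<forall>\<phi> :: 'a \<Rightarrow> real. continuous_on UNIV \<phi> \<and> compact (closure {x. \<phi> x \<noteq> 0}) \<longrightarrow>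
        (\<lambda>i. \<integral>x. \<phi> x \<partial>\<mu> i) \<longlonglongrightarrow> (\<integral>x. \<phi> x \<partial>\<nu>))"


section \<open>The splitting of \<open>\<real>\<^sup>n\<close> into the first axis and its complement\<close>

text \<open>
  Euclidean \<open>n\<close>-space is \<^typ>\<open>real \<times> (real ^ 'm)\<close> with \<open>n = CARD('m) + 1\<close>; since \<open>'m\<close> is nonempty,
  these are exactly the dimensions \<open>n \<ge> 2\<close>. The product norm is the Euclidean one.
\<close>

definition E1 :: "real \<times> (real ^ 'm)" where
  "E1 = (1, 0)"

definition E1_axis :: "(real \<times> (real ^ 'm)) set" where
  "E1_axis = span {E1}"

definition axis_measure :: "nat \<Rightarrow> (real \<times> (real ^ 'm)) measure" where
  "axis_measure k = density hausdorff1 (\<lambda>x. of_nat k * indicator E1_axis x)"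

definition tube :: "real set \<Rightarrow> real \<Rightarrow> (real \<times> (real ^ 'm)) set" where
  "tube A r = A \<times> ball 0 r"

text \<open>Unoriented angle, in \<open>[0, \<pi>/2]\<close>, between the line spanned by \<open>v \<noteq> 0\<close> and the axis.\<close>

definition axis_angle :: "real \<times> (real ^ 'm) \<Rightarrow> real" where
  "axis_angle v = arccos (\<bar>v \<bullet> E1\<bar> / norm v)"

definition left_mult :: "(real \<times> (real ^ 'm)) set \<Rightarrow> (real \<times> (real ^ 'm) \<Rightarrow> real) \<Rightarrow> real \<times> (real ^ 'm) \<Rightarrow> real"
  where "left_mult X \<Theta> x = (\<Sum>s \<in> {s \<in> directions X x. s \<bullet> E1 < 0}. edge_mult \<Theta> x s)"

definition right_mult :: "(real \<times> (real ^ 'm)) set \<Rightarrow> (real \<times> (real ^ 'm) \<Rightarrow> real) \<Rightarrow> real \<times> (real ^ 'm) \<Rightarrow> real"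
  where "right_mult X \<Theta> x = (\<Sum>s \<in> {s \<in> directions X x. s \<bullet> E1 > 0}. edge_mult \<Theta> x s)"

end

theory Submission
  imports Defs
begin

text \<open>
  Stationarity makes the first variation of \<open>X\<close> a summation by parts over its vertices, valid for
  arbitrary test functions \<open>f\<close>: the sum over oriented edges \<open>(p, q)\<close> of multiplicity times
  \<open>(f q - f p)\<close> times the unit vector from \<open>p\<close> to \<open>q\<close> vanishes.

  Every point of \<open>X\<close> carries mass at least \<open>\<rho>\<close> in the ball of radius \<open>\<rho>\<close> around it, so weak convergence
  confines \<open>X\<^sub>i\<close> to a thin tube of radius \<open>\<rho>\<close>. For a coordinate \<open>y\<close> orthogonal to the axis, the test
  function \<open>\<phi> t * y\<close> shows that the integral of the squared \<open>y\<close>-slope is \<open>O(\<rho>)\<close>. Replacing \<open>y\<close> by a step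
  function that jumps at the \<open>y\<close>-level of a given point \<open>z\<close>, the multiplicity-weighted \<open>y\<close>-slopes of the
  edges at \<open>z\<close> are bounded by the integral of the absolute \<open>y\<close>-slope, hence are small by
  Cauchy--Schwarz; as multiplicities are at least 1, all edges are nearly parallel to the axis.
  Balance in the \<open>E1\<close> direction and integrality then give equal left and right multiplicities, and a
  step function of \<open>t\<close> compares the multiplicity of a slice with the mass of the tube, which tends
  to \<open>k\<close> per unit length.
\<close>

section \<open>One-dimensional Hausdorff measure\<close>

text \<open>Weak convergence says nothing about tangents, and a bound on the mean square slope
  controls them only on average. The passage to single points works because the vertices of the
  graph are at choice: any finite set of points of \<open>X\<close> may be added to them, so a test
  function may jump exactly at the point under study, and the jump singles out the edges leaving it.
  A network may be unbounded with infinitely many singular points, so graphs are finite and relative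
  to a compact window, outside of which test functions vanish. Convergence enters only through three
  integrals: a bump away from the axis, a mass bound \<open>C\<close>, and the mass of the tube over
  \<open>{a..b}\<close>. \<open>C\<close> depends only on the limit and the window, so the other
  constants can be fixed in turn: the slope bound \<open>c\<close>, close to 1 in terms of
  \<open>C\<close>, \<open>k\<close> and \<open>\<theta>\<close>, next the tube radius
  \<open>\<rho>\<close> in terms of \<open>c\<close> and \<open>C\<close>, last the edge length
  \<open>l\<close>. With \<open>c\<close> close enough to 1, integers that ought to agree differ by
  less than 1.\<close>

lemma hausdorff1_pre_le:
  assumes "A \<subseteq> (\<Union>j. C j)" "\<And>j. bounded (C j)" "\<And>j. diameter (C j) \<le> \<delta>"
  shows "hausdorff1_pre \<delta> A \<le> (\<Sum>j. ennreal (diameter (C j)))"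
  unfolding hausdorff1_pre_def using assms by (intro INF_lower) auto

lemma hausdorff1_pre_mono: "A \<subseteq> B \<Longrightarrow> hausdorff1_pre \<delta> A \<le> hausdorff1_pre \<delta> B"
  unfolding hausdorff1_pre_def by (intro INF_superset_mono) auto

lemma hausdorff1_pre_antimono: "\<delta> \<le> \<delta>' \<Longrightarrow> hausdorff1_pre \<delta>' A \<le> hausdorff1_pre \<delta> A"
  unfolding hausdorff1_pre_def by (intro INF_superset_mono) (auto intro: order_trans)

lemma hausdorff1_pre_countably_subadditive:
  fixes A :: "nat \<Rightarrow> 'a::euclidean_space set"
  shows "hausdorff1_pre \<delta> (\<Union>i. A i) \<le> (\<Sum>i. hausdorff1_pre \<delta> (A i))"
proof (rule ennreal_le_epsilon)
  fix e :: real
  assume fin: "(\<Sum>i. hausdorff1_pre \<delta> (A i)) < top" and e: "0 < e"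
  have "\<exists>C. (A i \<subseteq> (\<Union>j. C j) \<and> (\<forall>j. bounded (C j) \<and> diameter (C j) \<le> \<delta>)) \<and>
      (\<Sum>j. ennreal (diameter (C j))) < hausdorff1_pre \<delta> (A i) + ennreal (e * (1/2)^Suc i)" for i
  proof -
    have "hausdorff1_pre \<delta> (A i) \<noteq> \<infinity>"
      using fin ennreal_suminf_lessD[of "\<lambda>i. hausdorff1_pre \<delta> (A i)" top i] by auto
    then obtain C where "C \<in> {C. A i \<subseteq> (\<Union>j. C j) \<and> (\<forall>j. bounded (C j) \<and> diameter (C j) \<le> \<delta>)}"
      "(\<Sum>j. ennreal (diameter (C j))) < hausdorff1_pre \<delta> (A i) + ennreal (e * (1/2)^Suc i)"
      using INF_approx_ennreal[OF _ hausdorff1_pre_def[of \<delta> "A i"], of "e * (1/2)^Suc i"] e by auto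
    then show ?thesis by blast
  qed
  then obtain C where C: "\<And>i. A i \<subseteq> (\<Union>j. C i j)"
      "\<And>i j. bounded (C i j)" "\<And>i j. diameter (C i j) \<le> \<delta>"
      "\<And>i. (\<Sum>j. ennreal (diameter (C i j))) < hausdorff1_pre \<delta> (A i) + ennreal (e * (1/2)^Suc i)"
    by metis
  define D where "D n = case_prod C (prod_decode n)" for n
  have "(\<Union>i. A i) \<subseteq> (\<Union>n. D n)"
  proof
    fix x assume "x \<in> (\<Union>i. A i)"
    then obtain i j where "x \<in> C i j" using C(1) by blast
    then have "x \<in> D (prod_encode (i, j))" by (simp add: D_def)
    then show "x \<in> (\<Union>n. D n)" by blast
  qed
  moreover have "bounded (D n)" "diameter (D n) \<le> \<delta>" for n
    using C(2,3) by (simp_all add: D_def split: prod.split)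
  ultimately have "hausdorff1_pre \<delta> (\<Union>i. A i) \<le> (\<Sum>n. ennreal (diameter (D n)))"
    by (rule hausdorff1_pre_le)
  also have "\<dots> = (\<Sum>n. (\<lambda>ij. ennreal (diameter (case_prod C ij))) (prod_decode n))"
    by (simp add: D_def)
  also have "\<dots> = (\<Sum>i. \<Sum>j. ennreal (diameter (C i j)))"
    by (rule suminf_ennreal_2dimen) simp
  also have "\<dots> \<le> (\<Sum>i. hausdorff1_pre \<delta> (A i) + ennreal (e * (1/2)^Suc i))"
    using C(4) by (intro suminf_le) (auto intro: less_imp_le)
  also have "\<dots> = (\<Sum>i. hausdorff1_pre \<delta> (A i)) + (\<Sum>i. ennreal (e * (1/2)^Suc i))"
    by (intro suminf_add[symmetric]) auto
  also have "(\<Sum>i. ennreal (e * (1/2)^Suc i)) = ennreal e"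
  proof -
    have "(\<lambda>i. e * (1/2)^Suc i) sums (e * 1)"
      by (intro sums_mult power_half_series)
    then show ?thesis using e by (intro sums_unique[symmetric]) (simp add: sums_ennreal)
  qed
  finally show "hausdorff1_pre \<delta> (\<Union>i. A i) \<le> (\<Sum>i. hausdorff1_pre \<delta> (A i)) + ennreal e" .
qed

section \<open>The outer measure and its additivity on Borel sets\<close>

lemma hausdorff1_pre_le_outer: "0 < \<delta> \<Longrightarrow> hausdorff1_pre \<delta> A \<le> hausdorff1_outer A"
  unfolding hausdorff1_outer_def by (intro SUP_upper) auto

lemma hausdorff1_outer_mono: "A \<subseteq> B \<Longrightarrow> hausdorff1_outer A \<le> hausdorff1_outer B"
  unfolding hausdorff1_outer_def by (intro SUP_mono) (auto intro: hausdorff1_pre_mono)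

lemma hausdorff1_outer_empty [simp]: "hausdorff1_outer {} = 0"
proof -
  have "hausdorff1_pre \<delta> {} = 0" if "\<delta> > 0" for \<delta> :: real
    using hausdorff1_pre_le[of "{}" "\<lambda>_. {}" \<delta>] that by auto
  then show ?thesis unfolding hausdorff1_outer_def by (auto simp: SUP_eq_iff)
qed

lemma hausdorff1_outer_countably_subadditive:
  "hausdorff1_outer (\<Union>i. A i) \<le> (\<Sum>i. hausdorff1_outer (A i))"
  unfolding hausdorff1_outer_def[of "\<Union>i. A i"]
proof (rule SUP_least)
  fix \<delta> :: real assume "\<delta> \<in> {0<..}"
  then have "(\<Sum>i. hausdorff1_pre \<delta> (A i)) \<le> (\<Sum>i. hausdorff1_outer (A i))"
    by (intro suminf_le) (auto intro: hausdorff1_pre_le_outer)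
  with hausdorff1_pre_countably_subadditive
  show "hausdorff1_pre \<delta> (\<Union>i. A i) \<le> (\<Sum>i. hausdorff1_outer (A i))"
    by (rule order_trans)
qed

lemma hausdorff1_outer_Un: "hausdorff1_outer (A \<union> B) \<le> hausdorff1_outer A + hausdorff1_outer B"
proof -
  have "A \<union> B = (\<Union>i. binaryset A B i)" by (simp add: UN_binaryset_eq)
  then have "hausdorff1_outer (A \<union> B) \<le> (\<Sum>i. hausdorff1_outer (binaryset A B i))"
    using hausdorff1_outer_countably_subadditive by metis
  also have "\<dots> = hausdorff1_outer A + hausdorff1_outer B"
    by (rule suminf_binaryset_eq) simp
  finally show ?thesis .
qed

text \<open>A set of diameter below \<open>d\<close> cannot meet both \<open>A\<close> and
  \<open>B\<close>, so a fine cover of the union splits into a cover of \<open>A\<close> and a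
  disjoint subfamily covering \<open>B\<close>.\<close>

lemma hausdorff1_outer_metric:
  assumes d: "0 < d" "\<And>x y. x \<in> A \<Longrightarrow> y \<in> B \<Longrightarrow> d \<le> dist x y"
  shows "hausdorff1_outer A + hausdorff1_outer B \<le> hausdorff1_outer (A \<union> B)"
proof -
  have small: "hausdorff1_pre \<delta> A + hausdorff1_pre \<delta> B \<le> hausdorff1_pre \<delta> (A \<union> B)"
    if \<delta>: "0 < \<delta>" "\<delta> < d" for \<delta>
    unfolding hausdorff1_pre_def[of \<delta> "A \<union> B"]
  proof (rule INF_greatest, safe)
    fix C :: "nat \<Rightarrow> 'a set"
    assume C: "A \<union> B \<subseteq> \<Union> (range C)" "\<forall>j. bounded (C j) \<and> diameter (C j) \<le> \<delta>"
    \<comment> \<open>Sets that miss \<open>A\<close> are replaced by the empty set, of diameter 0,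
      so that the family stays indexed by \<open>nat\<close>.\<close>
    define CA where "CA j = (if C j \<inter> A \<noteq> {} then C j else {})" for j
    define CB where "CB j = (if C j \<inter> B \<noteq> {} then C j else {})" for j
    have "hausdorff1_pre \<delta> A \<le> (\<Sum>j. ennreal (diameter (CA j)))"
      using C \<delta> by (intro hausdorff1_pre_le) (fastforce simp: CA_def)+
    moreover have "hausdorff1_pre \<delta> B \<le> (\<Sum>j. ennreal (diameter (CB j)))"
      using C \<delta> by (intro hausdorff1_pre_le) (fastforce simp: CB_def)+
    moreover have "(\<Sum>j. ennreal (diameter (CA j))) + (\<Sum>j. ennreal (diameter (CB j)))
        = (\<Sum>j. ennreal (diameter (CA j)) + ennreal (diameter (CB j)))"
      by (intro suminf_add) auto
    moreover have "\<dots> \<le> (\<Sum>j. ennreal (diameter (C j)))"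
    proof (intro suminf_le)
      fix j
      have "C j \<inter> A = {} \<or> C j \<inter> B = {}"
      proof (rule ccontr)
        assume "\<not> ?thesis"
        then obtain x y where "x \<in> C j" "x \<in> A" "y \<in> C j" "y \<in> B" by blast
        moreover from this have "dist x y \<le> diameter (C j)"
          using C(2) by (intro diameter_bounded_bound) auto
        ultimately show False using d(2)[of x y] C(2) \<delta>(2)
          by (meson less_le_not_le order_trans)
      qed
      then show "ennreal (diameter (CA j)) + ennreal (diameter (CB j)) \<le> ennreal (diameter (C j))"
        by (auto simp: CA_def CB_def)
    qed auto
    ultimately show "hausdorff1_pre \<delta> A + hausdorff1_pre \<delta> B \<le> (\<Sum>j. ennreal (diameter (C j)))"
      by (metis (no_types, lifting) add_mono order_trans)
  qed
  have "hausdorff1_pre \<delta> A + hausdorff1_pre \<delta>' B \<le> hausdorff1_outer (A \<union> B)"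
    if "0 < \<delta>" "0 < \<delta>'" for \<delta> \<delta>'
  proof -
    \<comment> \<open>The pre-measures grow as the scale shrinks, so both may be compared at a
      common scale below \<open>d\<close>.\<close>
    define \<epsilon> where "\<epsilon> = min (min \<delta> \<delta>') (d/2)"
    have \<epsilon>: "0 < \<epsilon>" "\<epsilon> < d" "\<epsilon> \<le> \<delta>" "\<epsilon> \<le> \<delta>'" using that d(1) by (auto simp: \<epsilon>_def)
    have "hausdorff1_pre \<delta> A + hausdorff1_pre \<delta>' B \<le> hausdorff1_pre \<epsilon> A + hausdorff1_pre \<epsilon> B"
      using \<epsilon> by (intro add_mono hausdorff1_pre_antimono)
    also have "\<dots> \<le> hausdorff1_pre \<epsilon> (A \<union> B)" using \<epsilon> by (intro small)
    also have "\<dots> \<le> hausdorff1_outer (A \<union> B)" using \<epsilon> by (intro hausdorff1_pre_le_outer)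
    finally show ?thesis .
  qed
  note * = this
  have "hausdorff1_outer A + hausdorff1_outer B
      = (SUP \<delta>\<in>{0<..}. SUP \<delta>'\<in>{0<..}. hausdorff1_pre \<delta> A + hausdorff1_pre \<delta>' B)"
    unfolding hausdorff1_outer_def
    by (subst ennreal_SUP_add_left[symmetric]) (auto simp: ennreal_SUP_add_right)
  also have "\<dots> \<le> hausdorff1_outer (A \<union> B)"
    using * by (intro SUP_least) auto
  finally show ?thesis .
qed

text \<open>
  The shells \<open>B n\<close> around the closed set are alternately separated, so their outer measures
  are summable; hence the mass of \<open>A - F\<close> near \<open>F\<close> is negligible.
\<close>

lemma hausdorff1_outer_caratheodory_closed:
  fixes F :: "'a::euclidean_space set"
  assumes F: "closed F"
  shows "hausdorff1_outer (A \<inter> F) + hausdorff1_outer (A - F) \<le> hausdorff1_outer A"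
proof (cases "F = {} \<or> hausdorff1_outer A = top")
  case True
  then show ?thesis by auto
next
  case False
  then have Fne: "F \<noteq> {}" and fin: "hausdorff1_outer A < top" by (auto simp: top.not_eq_extremum)
  define f where "f x = infdist x F" for x
  define S where "S n = {x \<in> A - F. f x \<ge> 1 / real (Suc n)}" for n
  define B where "B n = {x \<in> A - F. 1 / real (Suc (Suc n)) \<le> f x \<and> f x < 1 / real (Suc n)}" for n
  have f_lip: "f x \<le> f y + dist x y" for x y
    unfolding f_def by (rule infdist_triangle)
  have f0: "f x = 0" if "x \<in> F" for x using that by (simp add: f_def)
  have fpos: "f x > 0" if "x \<notin> F" for x
    using that F Fne by (simp add: f_def infdist_pos_not_in_closed)
  \<comment> \<open>\<open>c\<close> serves as the parity: between two shells of the same parity a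
    whole shell is skipped, which keeps them apart.\<close>
  have alt: "(\<Sum>j<N. hausdorff1_outer (B (2 * j + c))) \<le> hausdorff1_outer (\<Union>j<N. B (2 * j + c))" for N c
  proof (induction N)
    case (Suc N)
    let ?d = "1 / real (2 * N + c) - 1 / real (2 * N + c + 1)"
    have "hausdorff1_outer (\<Union>j<N. B (2 * j + c)) + hausdorff1_outer (B (2 * N + c))
       \<le> hausdorff1_outer ((\<Union>j<N. B (2 * j + c)) \<union> B (2 * N + c))"
    \<comment> \<open>For \<open>N = 0\<close> there is no earlier shell. Otherwise
      \<open>?d\<close> is the width of the skipped shell, from the upper level of the new shell to
      the lower level of its predecessor.\<close>
    proof (cases "N = 0")
      case False
      show ?thesis
      proof (rule hausdorff1_outer_metric[where d = ?d])
        have "1 / real (2 * N + c + 1) < 1 / real (2 * N + c)"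
          using False by (intro divide_strict_left_mono) auto
        then show "?d > 0" by simp
        fix x y assume "x \<in> (\<Union>j<N. B (2 * j + c))" "y \<in> B (2 * N + c)"
        then obtain j where j: "j < N" "f x \<ge> 1 / real (Suc (Suc (2 * j + c)))"
          and y: "f y < 1 / real (Suc (2 * N + c))" by (auto simp: B_def)
        have "1 / real (2 * N + c) \<le> 1 / real (Suc (Suc (2 * j + c)))"
          using j(1) by (intro divide_left_mono) auto
        then have "1 / real (2 * N + c) \<le> f x" using j by simp
        with y f_lip[of x y] show "?d \<le> dist x y" by simp
      qed
    qed simp
    moreover have "(\<Union>j<Suc N. B (2 * j + c)) = (\<Union>j<N. B (2 * j + c)) \<union> B (2 * N + c)"
      by (auto simp: less_Suc_eq)
    ultimately show ?case using Suc
      by (auto intro: order_trans[OF add_right_mono])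
  qed simp
  have alt_le: "(\<Sum>j<N. hausdorff1_outer (B (2 * j + c))) \<le> hausdorff1_outer A" for N c
    by (rule order_trans[OF alt hausdorff1_outer_mono]) (auto simp: B_def)
  have sumB: "(\<Sum>n<N. hausdorff1_outer (B n)) \<le> 2 * hausdorff1_outer A" for N
  proof -
    have "(\<Sum>n<N. hausdorff1_outer (B n)) \<le> (\<Sum>n<2*N. hausdorff1_outer (B n))"
      by (intro sum_mono2) auto
    also have "\<dots> = (\<Sum>j<N. hausdorff1_outer (B (2 * j + 0))) + (\<Sum>j<N. hausdorff1_outer (B (2 * j + 1)))"
      by (induction N) (auto simp: ac_simps)
    also have "\<dots> \<le> hausdorff1_outer A + hausdorff1_outer A"
      by (intro add_mono alt_le)
    finally show ?thesis by (simp add: mult_2)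
  qed
  define b where "b n = enn2real (hausdorff1_outer (B n))" for n
  have Bfin: "hausdorff1_outer (B n) < top" for n
    using hausdorff1_outer_mono[of "B n" A] fin by (auto simp: B_def intro: le_less_trans)
  have bB: "ennreal (b n) = hausdorff1_outer (B n)" for n using Bfin by (simp add: b_def)
  have b0: "b n \<ge> 0" for n by (simp add: b_def)
  have "summable b"
  proof (rule summableI_nonneg_bounded[where x = "2 * enn2real (hausdorff1_outer A)"])
    fix n
    have "ennreal (sum b {..<n}) \<le> 2 * hausdorff1_outer A"
      using sumB[of n] by (simp add: sum_ennreal[symmetric] b0 bB)
    also have "\<dots> = ennreal (2 * enn2real (hausdorff1_outer A))"
      using fin by (simp add: ennreal_mult)
    finally show "sum b {..<n} \<le> 2 * enn2real (hausdorff1_outer A)"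
      by (subst (asm) ennreal_le_iff) auto
  qed (rule b0)
  have A_sub: "A - F \<subseteq> S n \<union> (\<Union>i. B (i + n))" for n
  proof
    fix x assume x: "x \<in> A - F"
    show "x \<in> S n \<union> (\<Union>i. B (i + n))"
    proof (cases "f x \<ge> 1 / real (Suc n)")
      case False
      obtain m0 where m0: "1 / real (Suc m0) < f x"
        using fpos[of x] x nat_approx_posE by blast
      define m where "m = (LEAST m. 1 / real (Suc m) \<le> f x)"
      have m: "1 / real (Suc m) \<le> f x"
        unfolding m_def by (rule LeastI[of _ m0]) (use m0 in simp)
      have "m > n"
      proof (rule ccontr)
        assume "\<not> n < m"
        then have "1 / real (Suc n) \<le> 1 / real (Suc m)" by (simp add: frac_le)
        then show False using m False by simp
      qed
      have "\<not> 1 / real (Suc (m - 1)) \<le> f x"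
        using not_less_Least[of "m - 1" "\<lambda>m. 1 / real (Suc m) \<le> f x"] \<open>m > n\<close> by (simp add: m_def)
      then have "x \<in> B (m - 1)" using x m \<open>m > n\<close> by (simp add: B_def)
      moreover have "m - 1 = (m - 1 - n) + n" using \<open>m > n\<close> by simp
      ultimately show ?thesis by (metis UN_I UnI2 UNIV_I)
    qed (use x in \<open>simp add: S_def\<close>)
  qed
  show ?thesis
  proof (rule ennreal_le_epsilon)
    fix e :: real assume e: "0 < e"
    obtain n where n: "norm (\<Sum>i. b (i + n)) < e"
      using suminf_exist_split[OF e \<open>summable b\<close>] by blast
    have "hausdorff1_outer (A - F) \<le> hausdorff1_outer (S n) + (\<Sum>i. hausdorff1_outer (B (i + n)))"
      by (rule order_trans[OF hausdorff1_outer_mono[OF A_sub] order_trans[OF hausdorff1_outer_Un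
            add_left_mono[OF hausdorff1_outer_countably_subadditive]]])
    also have "(\<Sum>i. hausdorff1_outer (B (i + n))) = ennreal (\<Sum>i. b (i + n))"
      unfolding bB[symmetric] using \<open>summable b\<close> b0 by (intro suminf_ennreal2) auto
    also have "\<dots> \<le> ennreal e" using n by (intro ennreal_leI) auto
    finally have "hausdorff1_outer (A - F) \<le> hausdorff1_outer (S n) + ennreal e"
      by (meson add_left_mono order_trans dual_order.refl)
    then have "hausdorff1_outer (A \<inter> F) + hausdorff1_outer (A - F)
        \<le> (hausdorff1_outer (A \<inter> F) + hausdorff1_outer (S n)) + ennreal e"
      by (metis add.assoc add_left_mono)
    also have "hausdorff1_outer (A \<inter> F) + hausdorff1_outer (S n) \<le> hausdorff1_outer ((A \<inter> F) \<union> S n)"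
    proof (rule hausdorff1_outer_metric)
      fix x y assume "x \<in> A \<inter> F" "y \<in> S n"
      then show "1 / real (Suc n) \<le> dist x y"
        using f_lip[of y x] f0[of x] by (auto simp: S_def dist_commute)
    qed simp
    also have "\<dots> \<le> hausdorff1_outer A"
      by (rule hausdorff1_outer_mono) (auto simp: S_def)
    finally show "hausdorff1_outer (A \<inter> F) + hausdorff1_outer (A - F) \<le> hausdorff1_outer A + ennreal e"
      by (simp add: add_right_mono)
  qed
qed

text \<open>\<open>measure_of\<close> yields the zero measure unless its set function is a measure
  on the given sets, so this is what makes \<open>hausdorff1\<close> the intended object. The
  Caratheodory-measurable sets form a sigma-algebra that contains the closed sets, hence all Borel
  sets.\<close>

lemma hausdorff1_measure_space:
  "measure_space UNIV (sets borel) (hausdorff1_outer :: 'a::euclidean_space set \<Rightarrow> ennreal)"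
proof -
  let ?f = "hausdorff1_outer :: 'a set \<Rightarrow> ennreal"
  interpret P: sigma_algebra UNIV "Pow UNIV :: 'a set set" by (rule sigma_algebra_Pow)
  have "outer_measure_space (Pow UNIV) ?f"
    unfolding outer_measure_space_def positive_def increasing_def countably_subadditive_def
    using hausdorff1_outer_mono hausdorff1_outer_countably_subadditive by auto
  then have ms: "measure_space UNIV (lambda_system UNIV (Pow UNIV) ?f) ?f"
    by (rule P.caratheodory_lemma)
  have "F \<in> lambda_system UNIV (Pow UNIV) ?f" if "closed F" for F
  proof -
    have "?f (F \<inter> A) + ?f ((UNIV - F) \<inter> A) = ?f A" for A
    proof (rule antisym)
      show "?f (F \<inter> A) + ?f ((UNIV - F) \<inter> A) \<le> ?f A"
        using hausdorff1_outer_caratheodory_closed[OF that, of A]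
        by (simp add: Int_commute Diff_eq)
      have "?f A = ?f ((F \<inter> A) \<union> ((UNIV - F) \<inter> A))" by (rule arg_cong[where f = ?f]) auto
      then show "?f A \<le> ?f (F \<inter> A) + ?f ((UNIV - F) \<inter> A)"
        using hausdorff1_outer_Un by metis
    qed
    then show ?thesis by (simp add: lambda_system_def)
  qed
  moreover have "sigma_algebra UNIV (lambda_system UNIV (Pow UNIV) ?f)"
    using ms by (simp add: measure_space_def)
  ultimately have "sigma_sets UNIV (Collect closed) \<subseteq> lambda_system UNIV (Pow UNIV) ?f"
    by (intro sigma_algebra.sigma_sets_subset) auto
  moreover have "sigma_sets UNIV (Collect closed) = sets (borel :: 'a measure)"
    by (simp add: borel_eq_closed)
  ultimately have sub: "sets borel \<subseteq> lambda_system UNIV (Pow UNIV) ?f" by simp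
  show ?thesis
    unfolding measure_space_def
  proof (intro conjI)
    show "sigma_algebra UNIV (sets (borel :: 'a measure))"
      by (metis sets.sigma_algebra_axioms space_borel)
    show "positive (sets borel) ?f" by (simp add: positive_def)
    show "countably_additive (sets borel) ?f"
      unfolding countably_additive_def
    proof (intro allI impI)
      fix A :: "nat \<Rightarrow> 'a set"
      assume A: "range A \<subseteq> sets borel" "disjoint_family A" "\<Union> (range A) \<in> sets borel"
      have "range A \<subseteq> lambda_system UNIV (Pow UNIV) ?f" "\<Union> (range A) \<in> lambda_system UNIV (Pow UNIV) ?f"
        using A(1,3) sub by auto
      then show "(\<Sum>i. ?f (A i)) = ?f (\<Union> (range A))"
        using ms A(2) unfolding measure_space_def countably_additive_def by simp
    qed
  qed
qed

section \<open>Length of segments and restriction of the measure to a line\<close>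

lemma sets_hausdorff1 [simp, measurable_cong]: "sets hausdorff1 = sets borel"
  unfolding hausdorff1_def using sets.sigma_sets_eq[of borel] by simp

lemma space_hausdorff1 [simp]: "space hausdorff1 = UNIV"
  unfolding hausdorff1_def by (simp add: space_measure_of_conv)

lemma emeasure_hausdorff1:
  "A \<in> sets borel \<Longrightarrow> emeasure hausdorff1 A = hausdorff1_outer A"
  using hausdorff1_measure_space
  by (intro emeasure_measure_of[OF hausdorff1_def]) (auto simp: measure_space_def sets_hausdorff1)

text \<open>A map that does not increase distances sends each covering set into an interval as long
  as its diameter; these intervals cover \<open>{c<..<d}\<close>, and Lebesgue measure is
  subadditive. Covers of scale 1 suffice for a lower bound. The lemma serves both for the projection
  to a line and for the distance to a point.\<close>

lemma hausdorff1_outer_ge_length: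
  fixes f :: "'a::euclidean_space \<Rightarrow> real"
  assumes lip: "\<And>x y. \<bar>f x - f y\<bar> \<le> dist x y" and im: "{c<..<d} \<subseteq> f ` A"
  shows "ennreal (d - c) \<le> hausdorff1_outer A"
proof -
  have "ennreal (d - c) \<le> hausdorff1_pre 1 A"
    unfolding hausdorff1_pre_def
  proof (rule INF_greatest, safe)
    fix C :: "nat \<Rightarrow> 'a set"
    assume C: "A \<subseteq> \<Union> (range C)" "\<forall>j. bounded (C j) \<and> diameter (C j) \<le> 1"
    \<comment> \<open>The empty set is treated apart, since \<open>Inf {}\<close> has no meaningful
      value on the reals.\<close>
    define J where "J j = (if C j = {} then {} else {Inf (f ` C j) .. Inf (f ` C j) + diameter (C j)})" for j
    have img: "f ` C j \<subseteq> J j" for j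
    proof (cases "C j = {}")
      case False
      have d: "\<bar>f x - f y\<bar> \<le> diameter (C j)" if "x \<in> C j" "y \<in> C j" for x y
        using lip[of x y] diameter_bounded_bound[of "C j" x y] C(2) that by force
      obtain x0 where x0: "x0 \<in> C j" using False by blast
      have bdd: "bdd_below (f ` C j)"
        by (rule bdd_belowI[where m = "f x0 - diameter (C j)"]) (use d[OF x0] in \<open>force simp: abs_le_iff\<close>)
      have "Inf (f ` C j) \<le> f x" "f x - diameter (C j) \<le> Inf (f ` C j)" if "x \<in> C j" for x
      proof -
        show "Inf (f ` C j) \<le> f x" using that bdd by (intro cInf_lower) auto
        show "f x - diameter (C j) \<le> Inf (f ` C j)"
          using False d[OF that] by (intro cInf_greatest) (force simp: abs_le_iff)+
      qed
      then show ?thesis using False by (force simp: J_def)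
    qed simp
    have "{c<..<d} \<subseteq> (\<Union>j. J j)"
    proof
      fix t assume "t \<in> {c<..<d}"
      then obtain x where "x \<in> A" "t = f x" using im by blast
      moreover from this obtain j where "x \<in> C j" using C(1) by blast
      ultimately show "t \<in> (\<Union>j. J j)" using img[of j] by blast
    qed
    then have "emeasure lborel {c<..<d} \<le> emeasure lborel (\<Union>j. J j)"
      by (intro emeasure_mono) (auto simp: J_def)
    also have "\<dots> \<le> (\<Sum>j. emeasure lborel (J j))"
      by (intro emeasure_subadditive_countably) (auto simp: J_def)
    also have "\<dots> \<le> (\<Sum>j. ennreal (diameter (C j)))"
      by (intro suminf_le) (auto simp: J_def diameter_ge_0 C(2))
    finally show "ennreal (d - c) \<le> (\<Sum>j. ennreal (diameter (C j)))"
      by (cases "c \<le> d") (auto simp: ennreal_neg)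
  qed
  also have "\<dots> \<le> hausdorff1_outer A" by (intro hausdorff1_pre_le_outer) simp
  finally show ?thesis .
qed

text \<open>Cut the segment into \<open>n\<close> pieces of length
  \<open>h = l / n \<le> \<delta>\<close>; the remaining members of the cover are empty.\<close>

lemma hausdorff1_outer_segment_le:
  fixes p s :: "'a::euclidean_space"
  assumes s: "norm s = 1" and l: "0 \<le> l"
  shows "hausdorff1_outer ((\<lambda>t. p + t *\<^sub>R s) ` {0..l}) \<le> ennreal l"
  unfolding hausdorff1_outer_def
proof (rule SUP_least)
  fix \<delta> :: real assume "\<delta> \<in> {0<..}"
  then have \<delta>: "\<delta> > 0" by simp
  obtain n :: nat where n: "l / \<delta> < real n" using reals_Archimedean2 by blast
  have n0: "n > 0" using n l \<delta> by (cases n) (auto simp: divide_less_0_iff dest: less_le_trans)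
  define h where "h = l / n"
  have h: "0 \<le> h" "h \<le> \<delta>" "real n * h = l" using n n0 l \<delta> by (auto simp: h_def field_simps)
  define C where "C j = (if j < n then (\<lambda>t. p + t *\<^sub>R s) ` {real j * h .. real (Suc j) * h} else {})" for j
  have diam: "diameter (C j) \<le> (if j < n then h else 0)" for j
  proof (cases "j < n")
    case True
    have "diameter (C j) \<le> h"
    proof (rule diameter_le)
      show "C j \<noteq> {} \<or> 0 \<le> h" using h by simp
      fix x y assume "x \<in> C j" "y \<in> C j"
      then obtain t u where "t \<in> {real j * h .. real (Suc j) * h}" "u \<in> {real j * h .. real (Suc j) * h}"
        and xy: "x = p + t *\<^sub>R s" "y = p + u *\<^sub>R s" using True by (auto simp: C_def)
      then have "\<bar>t - u\<bar> \<le> h" by (auto simp: algebra_simps abs_le_iff)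
      moreover have "x - y = (t - u) *\<^sub>R s" by (simp add: xy algebra_simps)
      ultimately show "norm (x - y) \<le> h" using s by simp
    qed
    then show ?thesis using True by simp
  qed (simp add: C_def)
  have bnd: "bounded (C j)" for j
  proof -
    have "compact ((\<lambda>t. p + t *\<^sub>R s) ` {real j * h .. real (Suc j) * h})"
      by (intro compact_continuous_image continuous_intros) auto
    then show ?thesis by (auto simp: C_def compact_imp_bounded)
  qed
  have cov: "(\<lambda>t. p + t *\<^sub>R s) ` {0..l} \<subseteq> (\<Union>j. C j)"
  proof safe
    fix t assume t: "t \<in> {0..l}"
    show "p + t *\<^sub>R s \<in> \<Union> (range C)"
    \<comment> \<open>The right end point belongs to the last piece, not to the one that the floor
      would give, and for \<open>h = 0\<close> the quotient \<open>t / h\<close> is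
      meaningless.\<close>
    proof (cases "t = l \<or> h = 0")
      case True
      have "t \<in> {real (n - 1) * h .. real (Suc (n - 1)) * h}"
        using True t h n0 l by (auto simp: of_nat_diff algebra_simps)
      then have "p + t *\<^sub>R s \<in> C (n - 1)" using n0 by (auto simp: C_def)
      then show ?thesis by blast
    next
      case False
      then have h0: "h > 0" and tl: "t < l" "t \<ge> 0" using h t by auto
      define j where "j = nat \<lfloor>t / h\<rfloor>"
      have jr: "real j = of_int \<lfloor>t / h\<rfloor>" using tl h0 by (simp add: j_def)
      have 1: "real j \<le> t / h" "t / h < real j + 1" unfolding jr by linarith+
      have "t / h < n" using tl h0 h(3) by (simp add: field_simps)
      then have "j < n" using 1 by linarith
      moreover have "t \<in> {real j * h .. real (Suc j) * h}"
        using 1 h0 by (auto simp: field_simps)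
      ultimately have "p + t *\<^sub>R s \<in> C j" by (auto simp: C_def)
      then show ?thesis by blast
    qed
  qed
  have "hausdorff1_pre \<delta> ((\<lambda>t. p + t *\<^sub>R s) ` {0..l}) \<le> (\<Sum>j. ennreal (diameter (C j)))"
  proof (rule hausdorff1_pre_le[OF cov bnd])
    fix j show "diameter (C j) \<le> \<delta>" using diam[of j] h \<delta> by (auto split: if_splits)
  qed
  also have "\<dots> = (\<Sum>j<n. ennreal (diameter (C j)))"
    by (rule suminf_finite) (auto simp: C_def)
  also have "\<dots> \<le> (\<Sum>j<n. ennreal h)"
  proof (intro sum_mono ennreal_leI)
    fix j assume "j \<in> {..<n}"
    then show "diameter (C j) \<le> h" using diam[of j] by simp
  qed
  also have "\<dots> = ennreal l" using h by (simp add: ennreal_of_nat_eq_real_of_nat ennreal_mult[symmetric])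
  finally show "hausdorff1_pre \<delta> ((\<lambda>t. p + t *\<^sub>R s) ` {0..l}) \<le> ennreal l" .
qed

lemma hausdorff1_finite_null:
  assumes "finite S"
  shows "S \<in> null_sets hausdorff1"
proof -
  have "{x} \<in> null_sets hausdorff1" for x :: 'a
  proof -
    obtain s :: 'a where "s \<in> Basis" by (meson SOME_Basis)
    then have "hausdorff1_outer ((\<lambda>t. x + t *\<^sub>R s) ` {0..0}) \<le> ennreal 0"
      by (intro hausdorff1_outer_segment_le) auto
    then show ?thesis by (auto simp: emeasure_hausdorff1)
  qed
  with assms show ?thesis
  proof (induction S)
    case (insert x S)
    then have "{x} \<union> S \<in> null_sets hausdorff1" by (intro null_sets.Un) auto
    then show ?case by simp
  qed auto
qed

definition line :: "'a::real_vector \<Rightarrow> 'a \<Rightarrow> 'a set" where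
  "line p s = range (\<lambda>t. p + t *\<^sub>R s)"

text \<open>The line is the fixed-point set of the orthogonal projection onto it, a form in which
  its closedness is evident.\<close>

lemma line_eq:
  fixes p s :: "'a::real_inner"
  assumes "norm s = 1"
  shows "line p s = {x. x = p + ((x - p) \<bullet> s) *\<^sub>R s}"
  using assms by (auto simp: line_def norm_eq_1 inner_commute)

lemma closed_line:
  fixes p s :: "'a::real_inner"
  assumes "norm s = 1"
  shows "closed (line p s)"
  unfolding line_eq[OF assms] by (intro closed_Collect_eq continuous_intros)

text \<open>Projection to the arclength parameter turns the restricted measure into a Borel measure
  on the reals that gives every interval its length, that is, into Lebesgue measure. Transporting
  back loses nothing, because projecting and reinserting fixes every point of the line. All
  integrals over networks are reduced to Lebesgue integrals through this.\<close>

lemma hausdorff1_line: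
  fixes p s :: "'a::euclidean_space"
  assumes s: "norm s = 1"
  shows "density hausdorff1 (indicator (line p s)) = distr lborel borel (\<lambda>t. p + t *\<^sub>R s)"
proof -
  let ?L = "line p s" and ?g = "\<lambda>t. p + t *\<^sub>R s" and ?\<pi> = "\<lambda>x. (x - p) \<bullet> s"
  let ?D = "density hausdorff1 (indicator ?L) :: 'a measure"
  have L [measurable]: "?L \<in> sets borel" using closed_line[OF s] by auto
  have ss: "s \<bullet> s = 1" using s by (simp add: norm_eq_1)
  have \<pi>g: "?\<pi> (?g t) = t" for t using ss by simp
  have g\<pi>: "?g (?\<pi> x) = x" if "x \<in> ?L" for x using that line_eq[OF s] by auto
  have [measurable]: "?\<pi> \<in> borel_measurable borel" "?g \<in> borel_measurable borel" by measurable
  have "lborel = distr ?D borel ?\<pi>"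
  proof (rule lborel_eqI)
    fix c d :: real assume cd': "\<And>b. b \<in> Basis \<Longrightarrow> c \<bullet> b \<le> d \<bullet> b"
    then have cd: "c \<le> d" by simp
    have pre: "?\<pi> -` {c<..<d} \<inter> ?L = ?g ` {c<..<d}"
    proof (intro set_eqI iffI)
      fix x assume "x \<in> ?\<pi> -` {c<..<d} \<inter> ?L"
      then show "x \<in> ?g ` {c<..<d}" using g\<pi>[of x] by (intro image_eqI[where x = "?\<pi> x"]) auto
    next
      fix x assume "x \<in> ?g ` {c<..<d}"
      then obtain t where "t \<in> {c<..<d}" "x = ?g t" by blast
      then show "x \<in> ?\<pi> -` {c<..<d} \<inter> ?L" using ss by (auto simp: line_def)
    qed
    have "emeasure (distr ?D borel ?\<pi>) (box c d) = emeasure ?D (?\<pi> -` {c<..<d})"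
      by (subst emeasure_distr) (auto simp: box_real)
    also have "\<dots> = emeasure hausdorff1 (?\<pi> -` {c<..<d} \<inter> ?L)"
    proof -
      have m: "?\<pi> -` {c<..<d} \<in> sets borel"
        using measurable_sets[of ?\<pi> borel borel "{c<..<d}"] by simp
      have "emeasure ?D (?\<pi> -` {c<..<d}) = (\<integral>\<^sup>+x. indicator ?L x * indicator (?\<pi> -` {c<..<d}) x \<partial>hausdorff1)"
        using m by (subst emeasure_density) auto
      also have "\<dots> = (\<integral>\<^sup>+x. indicator (?\<pi> -` {c<..<d} \<inter> ?L) x \<partial>hausdorff1)"
        by (intro nn_integral_cong) (auto split: split_indicator)
      also have "\<dots> = emeasure hausdorff1 (?\<pi> -` {c<..<d} \<inter> ?L)"
        using m by (intro nn_integral_indicator) auto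
      finally show ?thesis .
    qed
    also have "\<dots> = hausdorff1_outer (?g ` {c<..<d})"
    proof -
      have "?\<pi> -` {c<..<d} \<in> sets borel"
        using measurable_sets[of ?\<pi> borel borel "{c<..<d}"] by simp
      then have "?\<pi> -` {c<..<d} \<inter> ?L \<in> sets borel" using L by (rule sets.Int)
      from emeasure_hausdorff1[OF this] show ?thesis by (simp only: pre)
    qed
    also have "\<dots> = ennreal (d - c)"
    proof (rule antisym)
      have "?g ` {c<..<d} \<subseteq> (\<lambda>t. (p + c *\<^sub>R s) + t *\<^sub>R s) ` {0..d - c}"
      proof safe
        fix t assume "t \<in> {c<..<d}"
        then show "p + t *\<^sub>R s \<in> (\<lambda>t. (p + c *\<^sub>R s) + t *\<^sub>R s) ` {0..d - c}"
          by (intro image_eqI[where x = "t - c"]) (auto simp: algebra_simps)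
      qed
      then show "hausdorff1_outer (?g ` {c<..<d}) \<le> ennreal (d - c)"
        using hausdorff1_outer_segment_le[OF s, of "d - c" "p + c *\<^sub>R s"] cd hausdorff1_outer_mono
        by (meson diff_ge_0_iff_ge order_trans)
      show "ennreal (d - c) \<le> hausdorff1_outer (?g ` {c<..<d})"
      proof (rule hausdorff1_outer_ge_length[where f = ?\<pi>])
        fix x y
        have "\<bar>?\<pi> x - ?\<pi> y\<bar> = \<bar>(x - y) \<bullet> s\<bar>" by (simp add: inner_diff_left)
        also have "\<dots> \<le> norm (x - y) * norm s" by (rule Cauchy_Schwarz_ineq2)
        finally show "\<bar>?\<pi> x - ?\<pi> y\<bar> \<le> dist x y" using s by (simp add: dist_norm)
      qed (use \<pi>g in \<open>force simp: image_iff\<close>)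
    qed
    finally show "emeasure (distr ?D borel ?\<pi>) (box c d) = ennreal (\<Prod>b\<in>Basis. (d - c) \<bullet> b)"
      by simp
  qed simp
  then have "distr lborel borel ?g = distr (distr ?D borel ?\<pi>) borel ?g" by simp
  also have "\<dots> = distr ?D borel (\<lambda>x. ?g (?\<pi> x))"
    by (subst distr_distr) (auto simp: o_def)
  also have "\<dots> = distr ?D borel (\<lambda>x. x)"
  proof (rule distr_cong_AE)
    have "AE x in hausdorff1. 0 < (indicator ?L x :: ennreal) \<longrightarrow> ?g (?\<pi> x) = x"
      using g\<pi> by (intro AE_I2) (auto split: split_indicator)
    then show "AE x in ?D. ?g (?\<pi> x) = x" by (subst AE_density) auto
  qed auto
  also have "\<dots> = ?D" by (rule distr_id2) simp
  finally show ?thesis by simp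
qed

section \<open>Local structure of geodesic networks\<close>

lemma open_segment_arclength:
  fixes p q :: "'a::real_normed_vector"
  assumes "p \<noteq> q"
  shows "open_segment p q = (\<lambda>t. p + t *\<^sub>R sgn (q - p)) ` {0<..<norm (q - p)}"
proof -
  define l where "l = norm (q - p)"
  have l: "l > 0" using assms by (simp add: l_def)
  have qp: "q - p = l *\<^sub>R sgn (q - p)" using l by (simp add: sgn_div_norm l_def)
  have *: "(1 - u) *\<^sub>R p + u *\<^sub>R q = p + (u * l) *\<^sub>R sgn (q - p)" for u
  proof -
    have "(1 - u) *\<^sub>R p + u *\<^sub>R q = p + u *\<^sub>R (q - p)" by (simp add: algebra_simps)
    then show ?thesis using qp by (metis scaleR_scaleR)
  qed
  have "open_segment p q = (\<lambda>u. p + (u * l) *\<^sub>R sgn (q - p)) ` {0<..<1}"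
    using assms by (simp add: open_segment_image_interval *)
  also have "\<dots> = (\<lambda>t. p + t *\<^sub>R sgn (q - p)) ` ((\<lambda>u. u * l) ` {0<..<1})"
    by (simp add: image_image)
  also have "(\<lambda>u. u * l) ` {0<..<1} = {0<..<l}"
  proof (intro set_eqI iffI)
    fix t assume "t \<in> {0<..<l}"
    then show "t \<in> (\<lambda>u. u * l) ` {0<..<1}" using l by (intro image_eqI[where x = "t / l"]) auto
  qed (use l in auto)
  finally show ?thesis by (simp add: l_def)
qed

lemma closed_segment_Int_ball:
  fixes x c :: "'a::real_normed_vector"
  assumes "c \<noteq> x" "\<epsilon> \<le> dist x c"
  shows "closed_segment x c \<inter> ball x \<epsilon> = {x + t *\<^sub>R sgn (c - x) | t. 0 \<le> t \<and> t < \<epsilon>}"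
proof (intro set_eqI iffI)
  define l where "l = norm (c - x)"
  have l: "l > 0" "\<epsilon> \<le> l" using assms by (simp_all add: l_def dist_norm norm_minus_commute)
  have cx: "c - x = l *\<^sub>R sgn (c - x)" using l by (simp add: sgn_div_norm l_def)
  have ns: "norm (sgn (c - x)) = 1" using assms by (simp add: norm_sgn)
  have *: "(1 - u) *\<^sub>R x + u *\<^sub>R c = x + (u * l) *\<^sub>R sgn (c - x)" for u
  proof -
    have "(1 - u) *\<^sub>R x + u *\<^sub>R c = x + u *\<^sub>R (c - x)" by (simp add: algebra_simps)
    then show ?thesis using cx by (metis scaleR_scaleR)
  qed
  fix y
  {
    assume "y \<in> closed_segment x c \<inter> ball x \<epsilon>"
    then obtain u where u: "0 \<le> u" "u \<le> 1" "y = x + (u * l) *\<^sub>R sgn (c - x)" and "dist x y < \<epsilon>"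
      by (auto simp: closed_segment_def *)
    moreover from this have "u * l < \<epsilon>" using l(1) ns by (simp add: dist_norm)
    ultimately show "y \<in> {x + t *\<^sub>R sgn (c - x) | t. 0 \<le> t \<and> t < \<epsilon>}" using l(1)
      by (auto intro!: exI[where x = "u * l"])
  next
    assume "y \<in> {x + t *\<^sub>R sgn (c - x) | t. 0 \<le> t \<and> t < \<epsilon>}"
    then obtain t where t: "0 \<le> t" "t < \<epsilon>" "y = x + t *\<^sub>R sgn (c - x)" by blast
    then have "y = (1 - t / l) *\<^sub>R x + (t / l) *\<^sub>R c" "0 \<le> t / l" "t / l \<le> 1"
      using l * by auto
    moreover have "y \<in> ball x \<epsilon>" using t ns by (simp add: dist_norm)
    ultimately show "y \<in> closed_segment x c \<inter> ball x \<epsilon>" by (auto simp: closed_segment_def)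
  }
qed

text \<open>The conical structure of a network near a point. Beyond closedness, it is the only
  consequence of the graph charts that is used later.\<close>

definition star_radius :: "'a::euclidean_space set \<Rightarrow> 'a \<Rightarrow> real \<Rightarrow> bool" where
  "star_radius X x \<epsilon> \<longleftrightarrow> 0 < \<epsilon> \<and>
     X \<inter> ball x \<epsilon> = {x + t *\<^sub>R s | s t. s \<in> directions X x \<and> 0 \<le> t \<and> t < \<epsilon>}"

text \<open>Any description of \<open>X\<close> near \<open>x\<close> as a union of radial segments
  determines the directions, because polar coordinates are unique away from the centre.\<close>

lemma directions_eqI:
  assumes eps: "0 < \<epsilon>" and S: "\<And>s. s \<in> S \<Longrightarrow> norm s = 1"
    and X: "X \<inter> ball x \<epsilon> = {x + t *\<^sub>R s | s t. s \<in> S \<and> 0 \<le> t \<and> t < \<epsilon>}"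
  shows "directions X x = S"
proof (intro set_eqI iffI)
  fix s assume s: "s \<in> S"
  have "x + t *\<^sub>R s \<in> X" if "0 < t" "t < \<epsilon>" for t
  proof -
    have "x + t *\<^sub>R s \<in> X \<inter> ball x \<epsilon>" unfolding X using that s by force
    then show ?thesis by simp
  qed
  then have "\<forall>\<^sub>F t in at_right 0. x + t *\<^sub>R s \<in> X"
    using eps unfolding eventually_at_right_field by blast
  then show "s \<in> directions X x" using S[OF s] by (simp add: directions_def)
next
  fix s assume "s \<in> directions X x"
  then have ns: "norm s = 1" and "\<forall>\<^sub>F t in at_right 0. x + t *\<^sub>R s \<in> X" by (auto simp: directions_def)
  then obtain b where b: "b > 0" "\<And>t. 0 < t \<Longrightarrow> t < b \<Longrightarrow> x + t *\<^sub>R s \<in> X"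
    unfolding eventually_at_right_field by auto
  define t where "t = min b \<epsilon> / 2"
  have t: "0 < t" "t < b" "t < \<epsilon>" using b eps by (auto simp: t_def)
  then have "x + t *\<^sub>R s \<in> X \<inter> ball x \<epsilon>" using b(2)[of t] ns by (simp add: dist_norm)
  then obtain s' t' where s': "s' \<in> S" "0 \<le> t'" "x + t *\<^sub>R s = x + t' *\<^sub>R s'" unfolding X by blast
  then have "norm (t *\<^sub>R s) = norm (t' *\<^sub>R s')" by simp
  then have "t = t'" using ns S[OF s'(1)] s'(2) t by simp
  then show "s \<in> S" using s' t by auto
qed

text \<open>A ball that avoids all other end points and all edges missing \<open>x\<close> meets the
  graph only in edges through \<open>x\<close>, and each of these splits at \<open>x\<close> into at
  most two radial segments. There is at least one, since edges have distinct end points.\<close>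

lemma network_star:
  assumes net: "geodesic_network X" and x: "x \<in> X"
  shows "finite (directions X x)" "directions X x \<noteq> {}" "\<exists>\<epsilon>. star_radius X x \<epsilon>"
proof -
  obtain U E where U: "open U" "x \<in> U" and E: "finite_straight_graph E"
    and XU: "X \<inter> U = (\<Union>(a, b) \<in> E. closed_segment a b) \<inter> U"
    using net x unfolding geodesic_network_def by blast
  have finE: "finite E" and neE: "\<And>a b. (a, b) \<in> E \<Longrightarrow> a \<noteq> b"
    using E by (auto simp: finite_straight_graph_def)
  define Ex where "Ex = {e \<in> E. x \<in> closed_segment (fst e) (snd e)}"
  define P where "P = (fst ` E \<union> snd ` E) - {x}"
  define Far where "Far = (\<Union>e \<in> E - Ex. closed_segment (fst e) (snd e))"
  define C where "C = (fst ` Ex \<union> snd ` Ex) - {x}"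
  define S where "S = (\<lambda>c. sgn (c - x)) ` C"
  have "open (U - (P \<union> Far))"
    unfolding P_def Far_def using U finE
    by (intro open_Diff closed_Un closed_UN finite_imp_closed) auto
  moreover have "x \<in> U - (P \<union> Far)" using U by (auto simp: P_def Far_def Ex_def)
  ultimately obtain \<epsilon> where \<epsilon>: "\<epsilon> > 0" "ball x \<epsilon> \<subseteq> U - (P \<union> Far)"
    using open_contains_ball by blast
  have CP: "C \<subseteq> P" by (auto simp: C_def P_def Ex_def)
  have farC: "\<epsilon> \<le> dist x c" if "c \<in> C" for c
  proof (rule ccontr)
    assume "\<not> \<epsilon> \<le> dist x c"
    then have "c \<in> ball x \<epsilon>" by simp
    then show False using \<epsilon>(2) CP that by blast
  qed
  have "\<exists>e. e \<in> Ex"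
    using x U XU by (force simp: Ex_def)
  then have Cne: "C \<noteq> {}" using neE by (force simp: C_def Ex_def)
  have seg: "y \<in> (\<Union>e\<in>Ex. closed_segment (fst e) (snd e)) \<longleftrightarrow> y \<in> (\<Union>c\<in>C. closed_segment x c)" for y
  proof
    assume "y \<in> (\<Union>e\<in>Ex. closed_segment (fst e) (snd e))"
    then obtain a b where ab: "(a, b) \<in> Ex" "y \<in> closed_segment a b" by force
    then have "y \<in> closed_segment a x \<union> closed_segment x b"
      using Un_closed_segment[of x a b] by (simp add: Ex_def)
    then have "y \<in> closed_segment x a \<or> y \<in> closed_segment x b"
      by (simp add: closed_segment_commute)
    \<comment> \<open>If \<open>x\<close> is itself an end point, one half degenerates to
      \<open>{x}\<close>, which lies in every segment starting at \<open>x\<close>.\<close>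
    moreover obtain c where "c \<in> C" using Cne by blast
    ultimately show "y \<in> (\<Union>c\<in>C. closed_segment x c)"
      using ab(1) by (cases "a = x"; cases "b = x") (force simp: C_def)+
  next
    assume "y \<in> (\<Union>c\<in>C. closed_segment x c)"
    then obtain c where c: "c \<in> C" "y \<in> closed_segment x c" by blast
    then obtain e where e: "e \<in> Ex" "c = fst e \<or> c = snd e" by (auto simp: C_def)
    then have "c \<in> closed_segment (fst e) (snd e)" "x \<in> closed_segment (fst e) (snd e)"
      by (auto simp: Ex_def)
    then have "closed_segment x c \<subseteq> closed_segment (fst e) (snd e)"
      by (simp add: subset_closed_segment)
    then show "y \<in> (\<Union>e\<in>Ex. closed_segment (fst e) (snd e))" using c e by blast
  qed
  have "X \<inter> ball x \<epsilon> = (\<Union>e\<in>Ex. closed_segment (fst e) (snd e)) \<inter> ball x \<epsilon>"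
  proof -
    have "X \<inter> ball x \<epsilon> = (X \<inter> U) \<inter> ball x \<epsilon>" using \<epsilon> by blast
    also have "\<dots> = (\<Union>e\<in>E. closed_segment (fst e) (snd e)) \<inter> ball x \<epsilon>"
      unfolding XU using \<epsilon> by (auto simp: case_prod_beta)
    also have "\<dots> = (\<Union>e\<in>Ex. closed_segment (fst e) (snd e)) \<inter> ball x \<epsilon>"
      using \<epsilon>(2) by (auto simp: Far_def Ex_def)
    finally show ?thesis .
  qed
  also have "\<dots> = (\<Union>c\<in>C. closed_segment x c \<inter> ball x \<epsilon>)"
    using seg by blast
  also have "\<dots> = (\<Union>c\<in>C. {x + t *\<^sub>R sgn (c - x) | t. 0 \<le> t \<and> t < \<epsilon>})"
    using farC by (intro SUP_cong refl closed_segment_Int_ball) (auto simp: C_def)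
  also have "\<dots> = {x + t *\<^sub>R s | s t. s \<in> S \<and> 0 \<le> t \<and> t < \<epsilon>}"
    by (auto simp: S_def)
  finally have X: "X \<inter> ball x \<epsilon> = {x + t *\<^sub>R s | s t. s \<in> S \<and> 0 \<le> t \<and> t < \<epsilon>}" .
  have "directions X x = S"
    by (rule directions_eqI[OF \<epsilon>(1) _ X]) (auto simp: S_def C_def norm_sgn split: if_splits)
  then show "finite (directions X x)" "directions X x \<noteq> {}" "\<exists>\<epsilon>. star_radius X x \<epsilon>"
    using X \<epsilon>(1) finE Cne by (auto simp: S_def C_def Ex_def star_radius_def)
qed

lemma directions_norm: "s \<in> directions X x \<Longrightarrow> norm s = 1"
  by (simp add: directions_def)

lemma star_radius_mono:
  assumes "star_radius X x \<epsilon>" "0 < \<epsilon>'" "\<epsilon>' \<le> \<epsilon>"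
  shows "star_radius X x \<epsilon>'"
proof -
  have "X \<inter> ball x \<epsilon>' = (X \<inter> ball x \<epsilon>) \<inter> ball x \<epsilon>'" using assms by auto
  also have "\<dots> = {x + t *\<^sub>R s | s t. s \<in> directions X x \<and> 0 \<le> t \<and> t < \<epsilon>} \<inter> ball x \<epsilon>'"
    using assms by (simp add: star_radius_def)
  also have "\<dots> = {x + t *\<^sub>R s | s t. s \<in> directions X x \<and> 0 \<le> t \<and> t < \<epsilon>'}"
    using assms by (force simp: dist_norm directions_norm)
  finally show ?thesis using assms by (simp add: star_radius_def)
qed

lemma star_radius_mem:
  assumes "star_radius X x \<epsilon>" "s \<in> directions X x" "0 \<le> t" "t < \<epsilon>"
  shows "x + t *\<^sub>R s \<in> X"
proof -
  have "x + t *\<^sub>R s \<in> X \<inter> ball x \<epsilon>" using assms unfolding star_radius_def by blast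
  then show ?thesis by simp
qed

lemma star_radius_cases:
  assumes "star_radius X x \<epsilon>" "z \<in> X" "dist x z < \<epsilon>"
  obtains s t where "s \<in> directions X x" "0 \<le> t" "t < \<epsilon>" "z = x + t *\<^sub>R s"
  using assms unfolding star_radius_def by fastforce

lemma closed_ray:
  fixes x s :: "'a::real_inner"
  assumes "norm s = 1"
  shows "closed {x + u *\<^sub>R s | u. 0 \<le> u}"
proof -
  have "{x + u *\<^sub>R s | u. 0 \<le> u} = line x s \<inter> {z. 0 \<le> (z - x) \<bullet> s}"
    using assms by (auto simp: line_def norm_eq_1)
  then show ?thesis using closed_line[OF assms]
    by (auto intro!: closed_Int closed_Collect_le continuous_intros)
qed

text \<open>The finitely many other rays form a closed set that misses the point, so near the point
  only the one ray remains.\<close>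

lemma star_tangent_vector:
  assumes star: "star_radius X x \<epsilon>" and fin: "finite (directions X x)"
    and s: "s \<in> directions X x" and t: "0 < t" "t < \<epsilon>"
  shows "tangent_vector X (x + t *\<^sub>R s) s"
proof -
  define Z where "Z = (\<Union>s'\<in>directions X x - {s}. {x + u *\<^sub>R s' | u. 0 \<le> u})"
  define y where "y = x + t *\<^sub>R s"
  have ns: "norm s = 1" using s by (rule directions_norm)
  have "closed Z"
    unfolding Z_def using fin
  proof (intro closed_UN ballI)
    fix s' assume "s' \<in> directions X x - {s}"
    then show "closed {x + u *\<^sub>R s' | u. 0 \<le> u}" by (intro closed_ray) (auto simp: directions_norm)
  qed auto
  moreover have "y \<notin> Z"
  proof
    assume "y \<in> Z"
    then obtain s' u where s': "s' \<in> directions X x" "s' \<noteq> s" "0 \<le> u" "t *\<^sub>R s = u *\<^sub>R s'"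
      by (auto simp: Z_def y_def)
    then have "norm (t *\<^sub>R s) = norm (u *\<^sub>R s')" by simp
    then have "t = u" using ns directions_norm[OF s'(1)] t s'(3) by simp
    then show False using s' t by simp
  qed
  ultimately obtain d where d: "d > 0" "ball y d \<inter> Z = {}"
    using open_contains_ball[of "- Z"] by (metis ComplI Compl_disjoint2 disjoint_eq_subset_Compl inf_commute open_Compl)
  \<comment> \<open>\<open>r \<le> t\<close> keeps the line near the point on the positive side of
    the ray, and \<open>r \<le> \<epsilon> - t\<close> keeps the ball inside the star.\<close>
  define r where "r = min d (min t (\<epsilon> - t))"
  have r: "r > 0" "r \<le> d" "r \<le> t" "r \<le> \<epsilon> - t" using d t by (auto simp: r_def)
  have "X \<inter> ball y r = {y + u *\<^sub>R s | u. True} \<inter> ball y r"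
  proof (intro set_eqI iffI)
    fix z assume z: "z \<in> X \<inter> ball y r"
    have "dist x z \<le> dist x y + dist y z" by (rule dist_triangle)
    moreover have "dist x y = t" using ns t by (simp add: y_def dist_norm)
    ultimately have "dist x z < \<epsilon>" using z r by simp
    then obtain s' u where s': "s' \<in> directions X x" "0 \<le> u" "z = x + u *\<^sub>R s'"
      using star z by (auto elim: star_radius_cases)
    have "s' = s"
    proof (rule ccontr)
      assume "s' \<noteq> s"
      then have "z \<in> Z" using s' by (auto simp: Z_def)
      moreover have "z \<in> ball y d" using r z by simp
      ultimately show False using d(2) by blast
    qed
    then have "z = y + (u - t) *\<^sub>R s" by (simp add: s' y_def algebra_simps)
    then show "z \<in> {y + u *\<^sub>R s | u. True} \<inter> ball y r" using z by blast
  next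
    fix z assume "z \<in> {y + u *\<^sub>R s | u. True} \<inter> ball y r"
    then obtain u where u: "z = y + u *\<^sub>R s" "dist y z < r" by auto
    then have "\<bar>u\<bar> < r" using ns by (simp add: dist_norm)
    then have "x + (t + u) *\<^sub>R s \<in> X" using r by (intro star_radius_mem[OF star s]) auto
    then show "z \<in> X \<inter> ball y r" using u by (simp add: y_def algebra_simps)
  qed
  moreover have "s \<noteq> 0" using ns by auto
  ultimately show ?thesis using r by (auto simp: tangent_vector_def y_def)
qed

text \<open>A regular point is a star with two opposite directions, so regular and singular points
  can be treated alike.\<close>

lemma tangent_vector_star:
  assumes "tangent_vector X x v"
  obtains \<epsilon> where "star_radius X x \<epsilon>" "directions X x = {sgn v, - sgn v}"
proof -
  obtain \<epsilon> where v: "v \<noteq> 0" and \<epsilon>: "\<epsilon> > 0" "X \<inter> ball x \<epsilon> = {x + t *\<^sub>R v | t. True} \<inter> ball x \<epsilon>"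
    using assms by (auto simp: tangent_vector_def)
  have ns: "norm (sgn v) = 1" using v by (simp add: norm_sgn)
  have "X \<inter> ball x \<epsilon> = {x + t *\<^sub>R s | s t. s \<in> {sgn v, - sgn v} \<and> 0 \<le> t \<and> t < \<epsilon>}"
    unfolding \<epsilon>(2)
  proof (intro set_eqI iffI)
    fix z assume "z \<in> {x + t *\<^sub>R v | t. True} \<inter> ball x \<epsilon>"
    then obtain t where t: "z = x + t *\<^sub>R v" "dist x z < \<epsilon>" by auto
    have v': "t *\<^sub>R v = (t * norm v) *\<^sub>R sgn v" using v by (simp add: sgn_div_norm)
    have lt: "\<bar>t\<bar> * norm v < \<epsilon>" using t by (simp add: dist_norm)
    show "z \<in> {x + t *\<^sub>R s | s t. s \<in> {sgn v, - sgn v} \<and> 0 \<le> t \<and> t < \<epsilon>}"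
    proof (cases "0 \<le> t")
      case True
      then show ?thesis using t v' lt by (auto intro!: exI[where x = "sgn v"] exI[where x = "t * norm v"])
    next
      case False
      then have "z = x + (\<bar>t\<bar> * norm v) *\<^sub>R (- sgn v)" using t v' by simp
      then show ?thesis using lt by (intro CollectI exI[where x = "- sgn v"] exI[where x = "\<bar>t\<bar> * norm v"]) auto
    qed
  next
    fix z assume "z \<in> {x + t *\<^sub>R s | s t. s \<in> {sgn v, - sgn v} \<and> 0 \<le> t \<and> t < \<epsilon>}"
    then obtain s t where z: "s \<in> {sgn v, - sgn v}" "0 \<le> t" "t < \<epsilon>" "z = x + t *\<^sub>R s" by blast
    then have "z = x + (t / norm v) *\<^sub>R v \<or> z = x + (- t / norm v) *\<^sub>R v"
      by (auto simp: sgn_div_norm divide_inverse_commute)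
    moreover have "z \<in> ball x \<epsilon>" using z ns by (auto simp: dist_norm)
    ultimately show "z \<in> {x + t *\<^sub>R v | t. True} \<inter> ball x \<epsilon>" by blast
  qed
  moreover from this have "directions X x = {sgn v, - sgn v}"
    using \<epsilon>(1) ns by (intro directions_eqI[OF \<epsilon>(1)]) auto
  ultimately show thesis using \<epsilon>(1) that by (simp add: star_radius_def)
qed

lemma tangent_vector_regular: "tangent_vector X x v \<Longrightarrow> x \<in> regular_points X"
proof -
  assume t: "tangent_vector X x v"
  then obtain \<epsilon> where "\<epsilon> > 0" "X \<inter> ball x \<epsilon> = {x + t *\<^sub>R v | t. True} \<inter> ball x \<epsilon>"
    by (auto simp: tangent_vector_def)
  moreover have "x \<in> {x + t *\<^sub>R v | t. True}" by (auto intro: exI[where x = 0])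
  ultimately have "x \<in> X" by auto
  then show ?thesis using t by (auto simp: regular_points_def)
qed

lemma multiplicity_on_connected:
  assumes "multiplicity_on X \<Theta>" "connected C" "C \<subseteq> regular_points X" "y \<in> C" "z \<in> C"
  shows "\<Theta> y = \<Theta> z"
proof (rule connected_local_const[OF assms(2,4,5)], rule ballI)
  fix c assume "c \<in> C"
  then obtain U where "open U" "c \<in> U" "\<forall>y \<in> U \<inter> regular_points X. \<Theta> y = \<Theta> c"
    using assms(1,3) unfolding multiplicity_on_def by blast
  then show "\<forall>\<^sub>F b in at c within C. \<Theta> c = \<Theta> b"
    unfolding eventually_at_topological using assms(3) by (metis IntI subsetD)
qed

lemma edge_mult_eqI:
  assumes "0 < \<epsilon>" "\<And>t. 0 < t \<Longrightarrow> t < \<epsilon> \<Longrightarrow> \<Theta> (x + t *\<^sub>R s) = c"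
  shows "edge_mult \<Theta> x s = c"
  unfolding edge_mult_def
proof (rule the_equality)
  show ev: "\<forall>\<^sub>F t in at_right 0. \<Theta> (x + t *\<^sub>R s) = c"
    unfolding eventually_at_right_field using assms by auto
  fix d assume "\<forall>\<^sub>F t in at_right 0. \<Theta> (x + t *\<^sub>R s) = d"
  then have "\<forall>\<^sub>F t in at_right (0::real). c = d" using ev by eventually_elim simp
  then show "d = c" by simp
qed

section \<open>Balance at the points of an integral stationary network\<close>

locale isgn =
  fixes X :: "'a::euclidean_space set" and \<Theta> :: "'a \<Rightarrow> real"
  assumes isgn: "ISGN X \<Theta>"
begin

lemma net: "geodesic_network X" and mult: "multiplicity_on X \<Theta>"
  and int_mult: "integral_multiplicity X \<Theta>" and stat: "stationary X \<Theta>"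
  using isgn by (auto simp: ISGN_def)

lemma closed_X: "closed X" using net by (simp add: geodesic_network_def)

lemma regular_points_subset: "regular_points X \<subseteq> X" by (auto simp: regular_points_def)

lemmas finite_directions = network_star(1)[OF net] and directions_nonempty = network_star(2)[OF net]
  and star_exists = network_star(3)[OF net]

lemma star_regular:
  assumes "star_radius X x \<epsilon>" "x \<in> X" "s \<in> directions X x" "0 < t" "t < \<epsilon>"
  shows "x + t *\<^sub>R s \<in> regular_points X"
  using star_tangent_vector[OF assms(1) finite_directions[OF assms(2)] assms(3-5)]
  by (rule tangent_vector_regular)

lemma edge_mult_ray:
  assumes reg: "\<And>t. 0 < t \<Longrightarrow> t < \<epsilon> \<Longrightarrow> x + t *\<^sub>R s \<in> regular_points X" and t: "0 < t" "t < \<epsilon>"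
  shows "edge_mult \<Theta> x s = \<Theta> (x + t *\<^sub>R s)"
proof (rule edge_mult_eqI[where \<epsilon> = \<epsilon>])
  fix u assume u: "0 < u" "u < \<epsilon>"
  have "connected ((\<lambda>t. x + t *\<^sub>R s) ` {0<..<\<epsilon>})"
    by (intro connected_continuous_image continuous_intros) auto
  then show "\<Theta> (x + u *\<^sub>R s) = \<Theta> (x + t *\<^sub>R s)"
    by (rule multiplicity_on_connected[OF mult]) (use reg t u in auto)
qed (use t in simp)

lemma edge_mult_nat:
  assumes "x \<in> X" "s \<in> directions X x"
  shows "\<exists>m::nat. m \<ge> 1 \<and> edge_mult \<Theta> x s = real m"
proof -
  obtain \<epsilon> where \<epsilon>: "star_radius X x \<epsilon>" using star_exists[OF assms(1)] by blast
  then have e0: "\<epsilon> > 0" by (simp add: star_radius_def)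
  have "x + (\<epsilon>/2) *\<^sub>R s \<in> regular_points X" using \<epsilon> assms e0 by (intro star_regular) auto
  moreover have "edge_mult \<Theta> x s = \<Theta> (x + (\<epsilon>/2) *\<^sub>R s)"
    using e0 star_regular[OF \<epsilon> assms] by (intro edge_mult_ray[where \<epsilon> = \<epsilon>]) auto
  ultimately show ?thesis using int_mult unfolding integral_multiplicity_def by auto
qed

lemma edge_mult_ge_1: "x \<in> X \<Longrightarrow> s \<in> directions X x \<Longrightarrow> edge_mult \<Theta> x s \<ge> 1"
  using edge_mult_nat by fastforce

lemma edge_mult_regular:
  assumes "tangent_vector X x v" "s \<in> directions X x"
  shows "edge_mult \<Theta> x s = \<Theta> x"
proof -
  obtain \<epsilon> where \<epsilon>: "star_radius X x \<epsilon>" by (rule tangent_vector_star[OF assms(1)])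
  have x: "x \<in> regular_points X" using assms(1) by (rule tangent_vector_regular)
  then obtain U where U: "open U" "x \<in> U" "\<forall>y \<in> U \<inter> regular_points X. \<Theta> y = \<Theta> x"
    using mult unfolding multiplicity_on_def by blast
  obtain d where d: "d > 0" "ball x d \<subseteq> U" using U open_contains_ball by blast
  have xX: "x \<in> X" using x by (simp add: regular_points_def)
  show ?thesis
  proof (rule edge_mult_eqI[where \<epsilon> = "min d \<epsilon>"])
    show "0 < min d \<epsilon>" using d \<epsilon> by (simp add: star_radius_def)
    fix t assume t: "0 < t" "t < min d \<epsilon>"
    then have "x + t *\<^sub>R s \<in> regular_points X" using star_regular[OF \<epsilon> xX assms(2)] by simp
    moreover have "x + t *\<^sub>R s \<in> U" using d(2) t directions_norm[OF assms(2)] by (auto simp: dist_norm)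
    ultimately show "\<Theta> (x + t *\<^sub>R s) = \<Theta> x" using U by blast
  qed
qed

lemma tangent_vector_pair:
  assumes "tangent_vector X x v"
  shows "directions X x = {sgn v, - sgn v}" "sgn v \<noteq> - sgn v"
proof -
  show "directions X x = {sgn v, - sgn v}" by (rule tangent_vector_star[OF assms])
  have "sgn v \<noteq> 0" using assms by (simp add: tangent_vector_def sgn_zero_iff)
  then show "sgn v \<noteq> - sgn v" by (simp add: eq_neg_iff_add_eq_0 flip: scaleR_2)
qed

text \<open>At a regular point the two opposite directions carry the same multiplicity and cancel.
  Hence regular points may serve as vertices, which is what allows a vertex at any prescribed point
  of \<open>X\<close>.\<close>

lemma balance:
  assumes "x \<in> X"
  shows "(\<Sum>s\<in>directions X x. edge_mult \<Theta> x s *\<^sub>R s) = 0"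
proof (cases "x \<in> regular_points X")
  case True
  then obtain v where v: "tangent_vector X x v" by (auto simp: regular_points_def)
  have "(\<Sum>s\<in>directions X x. edge_mult \<Theta> x s *\<^sub>R s) = (\<Sum>s\<in>directions X x. \<Theta> x *\<^sub>R s)"
    using edge_mult_regular[OF v] by simp
  then show ?thesis using tangent_vector_pair[OF v] by simp
next
  case False
  then show ?thesis using stat assms by (auto simp: stationary_def singular_points_def)
qed

text \<open>At a regular point half the sum of two equal multiplicities is the multiplicity itself,
  so one formula covers all points of \<open>X\<close>.\<close>

lemma mult_ext_eq:
  assumes "x \<in> X"
  shows "mult_ext X \<Theta> x = (1/2) * (\<Sum>s\<in>directions X x. edge_mult \<Theta> x s)"
proof (cases "x \<in> regular_points X")
  case True
  then obtain v where v: "tangent_vector X x v" by (auto simp: regular_points_def)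
  have "(\<Sum>s\<in>directions X x. edge_mult \<Theta> x s) = (\<Sum>s\<in>directions X x. \<Theta> x)"
    using edge_mult_regular[OF v] by simp
  then show ?thesis using tangent_vector_pair[OF v] True by (simp add: mult_ext_def)
next
  case False
  then show ?thesis using assms by (auto simp: mult_ext_def singular_points_def)
qed

text \<open>A single direction cannot balance, so at least two leave \<open>x\<close>, each of
  multiplicity at least 1.\<close>

lemma mult_ext_ge_1:
  assumes "x \<in> X"
  shows "mult_ext X \<Theta> x \<ge> 1"
proof -
  obtain s where s: "s \<in> directions X x" using directions_nonempty[OF assms] by blast
  have "directions X x \<noteq> {s}"
  proof
    assume "directions X x = {s}"
    then have "edge_mult \<Theta> x s *\<^sub>R s = 0" using balance[OF assms] by simp
    then show False using edge_mult_ge_1[OF assms s] directions_norm[OF s] by auto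
  qed
  then obtain s' where s': "s' \<in> directions X x" "s' \<noteq> s" using s by blast
  have "(\<Sum>u\<in>{s, s'}. edge_mult \<Theta> x u) \<le> (\<Sum>u\<in>directions X x. edge_mult \<Theta> x u)"
    using s s' finite_directions[OF assms] edge_mult_ge_1[OF assms]
    by (intro sum_mono2) (auto intro: order_trans[of 0 1])
  moreover have "(\<Sum>u\<in>{s, s'}. edge_mult \<Theta> x u) \<ge> 2"
    using s' edge_mult_ge_1[OF assms s] edge_mult_ge_1[OF assms s'(1)] by auto
  ultimately show ?thesis unfolding mult_ext_eq[OF assms] by simp
qed

lemma mult_ext_outside: "x \<notin> X \<Longrightarrow> mult_ext X \<Theta> x = 0"
  by (simp add: mult_ext_def regular_points_def singular_points_def)

lemma mult_ext_nonneg: "mult_ext X \<Theta> x \<ge> 0"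
  using mult_ext_ge_1[of x] mult_ext_outside[of x] by (cases "x \<in> X") auto

text \<open>
  At a point of a compact piece of \<open>X\<close> that is farthest from \<open>x\<close> all directions would point
  strictly inwards, contradicting the balance of the tangent vectors.
\<close>

lemma meets_sphere:
  assumes x: "x \<in> X" and r: "0 \<le> r"
  shows "\<exists>z\<in>X. dist x z = r"
proof -
  have "compact (X \<inter> cball x r)" using closed_X by (intro closed_Int_compact) auto
  moreover have "x \<in> X \<inter> cball x r" using x r by simp
  moreover have "continuous_on (X \<inter> cball x r) (dist x)" by (intro continuous_intros)
  ultimately obtain z where z: "z \<in> X \<inter> cball x r" "\<And>y. y \<in> X \<inter> cball x r \<Longrightarrow> dist x y \<le> dist x z"
    using continuous_attains_sup[of "X \<inter> cball x r" "dist x"] by blast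
  show ?thesis
  proof (rule ccontr)
    assume "\<not> ?thesis"
    then have zr: "dist x z < r" using z(1) by force
    obtain \<epsilon> where \<epsilon>: "star_radius X z \<epsilon>" using star_exists z(1) by blast
    have neg: "s \<bullet> (z - x) < 0" if s: "s \<in> directions X z" for s
    proof -
      \<comment> \<open>The step is short enough to stay both in the star of \<open>z\<close> and in
        the ball of radius \<open>r\<close>, where \<open>z\<close> is farthest from
        \<open>x\<close>.\<close>
      define t where "t = min \<epsilon> (r - dist x z) / 2"
      have t: "0 < t" "t < \<epsilon>" "t \<le> r - dist x z" using \<epsilon> zr by (auto simp: t_def star_radius_def)
      have ns: "norm s = 1" using s by (rule directions_norm)
      have "dist x (z + t *\<^sub>R s) \<le> dist x z + t"
        using dist_triangle[of x "z + t *\<^sub>R s" z] ns t by (simp add: dist_norm)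
      then have "z + t *\<^sub>R s \<in> X \<inter> cball x r"
        using star_radius_mem[OF \<epsilon> s, of t] t by simp
      then have "dist (z + t *\<^sub>R s) x \<le> dist z x" using z(2) by (metis dist_commute)
      then have "norm ((z - x) + t *\<^sub>R s) \<le> norm (z - x)"
        by (simp add: dist_norm algebra_simps)
      then have "((z - x) + t *\<^sub>R s) \<bullet> ((z - x) + t *\<^sub>R s) \<le> (z - x) \<bullet> (z - x)"
        by (simp add: norm_le)
      then have "2 * t * (s \<bullet> (z - x)) + t * t * (s \<bullet> s) \<le> 0"
        by (simp add: inner_add_left inner_add_right inner_commute algebra_simps)
      \<comment> \<open>The positive term \<open>t * t\<close> left over from the square makes the
        inequality for the inner product strict.\<close>
      then have "2 * (t * (s \<bullet> (z - x))) + t * t \<le> 0" using ns by (simp add: norm_eq_1)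
      then have "t * (s \<bullet> (z - x)) < 0" using mult_pos_pos[OF t(1) t(1)] by linarith
      then show ?thesis using t by (simp add: mult_less_0_iff)
    qed
    have "(\<Sum>s\<in>directions X z. edge_mult \<Theta> z s *\<^sub>R s) \<bullet> (z - x) < 0"
    proof -
      have "(\<Sum>s\<in>directions X z. (edge_mult \<Theta> z s *\<^sub>R s) \<bullet> (z - x)) < (\<Sum>s\<in>directions X z. 0)"
        using z(1) finite_directions directions_nonempty neg edge_mult_ge_1[of z]
        by (intro sum_strict_mono) (auto simp: mult_less_0_iff intro: less_le_trans[of 0 1])
      then show ?thesis by (simp add: inner_sum_left)
    qed
    then show False using balance z(1) by simp
  qed
qed

end

section \<open>Vertices and edges\<close>

text \<open>
  Edges are ordered pairs: each edge occurs in both orientations, whence the factors 1/2 below.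
\<close>

definition edges :: "'a::euclidean_space set \<Rightarrow> 'a set \<Rightarrow> ('a \<times> 'a) set" where
  "edges X V = {(p, q) \<in> V \<times> V. p \<noteq> q \<and> open_segment p q \<subseteq> regular_points X - V}"

text \<open>The multiplicity is constant on an open edge; the midpoint is a representative that does
  not depend on the orientation.\<close>

definition edge_weight :: "('a::euclidean_space \<Rightarrow> real) \<Rightarrow> 'a \<Rightarrow> 'a \<Rightarrow> real" where
  "edge_weight \<Theta> p q = \<Theta> (midpoint p q)"

text \<open>A finite graph structure relative to a window \<open>K\<close>: singular points in
  \<open>K\<close> are vertices, and every geodesic leaving a point of \<open>X\<close> in
  \<open>K\<close> meets a vertex within length \<open>l\<close>, possibly outside \<open>K\<close>.
  At vertices outside \<open>K\<close> some edges may be missing.\<close>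

definition vertex_set :: "'a::euclidean_space set \<Rightarrow> 'a set \<Rightarrow> real \<Rightarrow> 'a set \<Rightarrow> bool" where
  "vertex_set X K l V \<longleftrightarrow> finite V \<and> V \<subseteq> X \<and> singular_points X \<inter> K \<subseteq> V \<and>
     (\<forall>x \<in> X \<inter> K. \<forall>s \<in> directions X x. \<exists>T>0. T \<le> l \<and> x + T *\<^sub>R s \<in> V \<and>
        (\<forall>t. 0 < t \<longrightarrow> t < T \<longrightarrow> x + t *\<^sub>R s \<in> regular_points X - V))"

lemma finite_edges: "finite V \<Longrightarrow> finite (edges X V)"
  by (rule finite_subset[of _ "V \<times> V"]) (auto simp: edges_def)

lemma edges_commute: "(p, q) \<in> edges X V \<longleftrightarrow> (q, p) \<in> edges X V"
  by (auto simp: edges_def open_segment_commute)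

lemma edge_weight_commute: "edge_weight \<Theta> p q = edge_weight \<Theta> q p"
  by (simp add: edge_weight_def midpoint_sym)

lemma edge_point:
  assumes "(p, q) \<in> edges X V" "0 < t" "t < norm (q - p)"
  shows "p + t *\<^sub>R sgn (q - p) \<in> regular_points X - V"
proof -
  have "p \<noteq> q" "open_segment p q \<subseteq> regular_points X - V" using assms(1) by (auto simp: edges_def)
  then show ?thesis using assms(2,3) open_segment_arclength[of p q] by (metis greaterThanLessThan_iff image_eqI subsetD)
qed

lemma scaleR_norm_sgn: "norm v *\<^sub>R sgn v = v" for v :: "'a::real_normed_vector"
  by (cases "v = 0") (simp_all add: sgn_div_norm)

context isgn
begin

section \<open>Edge directions, edge weights and the existence of vertex sets\<close>

lemma edge_direction:
  assumes "(p, q) \<in> edges X V"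
  shows "sgn (q - p) \<in> directions X p"
proof -
  have "p \<noteq> q" using assms by (auto simp: edges_def)
  then have "norm (sgn (q - p)) = 1" "0 < norm (q - p)" by (simp_all add: norm_sgn)
  moreover have "p + t *\<^sub>R sgn (q - p) \<in> X" if "0 < t" "t < norm (q - p)" for t
    using edge_point[OF assms that] regular_points_subset by auto
  ultimately show ?thesis unfolding directions_def eventually_at_right_field by blast
qed

lemma edge_mult_edge:
  assumes "(p, q) \<in> edges X V" "0 < t" "t < norm (q - p)"
  shows "edge_mult \<Theta> p (sgn (q - p)) = \<Theta> (p + t *\<^sub>R sgn (q - p))"
  using edge_point[OF assms(1)] assms(2,3) by (intro edge_mult_ray[where \<epsilon> = "norm (q - p)"]) auto

lemma edge_mult_weight:
  assumes "(p, q) \<in> edges X V"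
  shows "edge_mult \<Theta> p (sgn (q - p)) = edge_weight \<Theta> p q"
proof -
  have l: "0 < norm (q - p)" using assms by (auto simp: edges_def)
  have "p + (norm (q - p) / 2) *\<^sub>R sgn (q - p) = p + (1/2) *\<^sub>R (norm (q - p) *\<^sub>R sgn (q - p))"
    by simp
  also have "\<dots> = midpoint p q"
    unfolding scaleR_norm_sgn by (simp add: midpoint_def algebra_simps) (simp flip: scaleR_add_left)
  finally show ?thesis
    using edge_mult_edge[OF assms, of "norm (q - p) / 2"] l by (simp add: edge_weight_def)
qed

lemma edge_weight_ge_1:
  assumes "(p, q) \<in> edges X V" "V \<subseteq> X"
  shows "edge_weight \<Theta> p q \<ge> 1"
proof -
  have "p \<in> X" using assms by (auto simp: edges_def)
  then show ?thesis
    using edge_mult_ge_1 edge_direction[OF assms(1)] edge_mult_weight[OF assms(1)] by metis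
qed

text \<open>The centres of finitely many star balls of radius at most \<open>l / 2\<close> that
  cover \<open>X\<close> near \<open>K\<close> serve as vertices, together with the prescribed
  points \<open>W\<close>. A geodesic followed from a point of \<open>K\<close> stays regular until
  it meets a vertex, and it cannot avoid the vertices for length \<open>l\<close>: the point reached
  at \<open>l / 2\<close> lies in a star whose centre is nearer than \<open>l / 2\<close>.\<close>

lemma vertex_set_exists:
  assumes K: "compact K" and l: "0 < l" and W: "finite W" "W \<subseteq> X"
  shows "\<exists>V. vertex_set X K l V \<and> W \<subseteq> V"
proof -
  \<comment> \<open>Geodesics leaving \<open>K\<close> are followed for length \<open>l\<close>, so
    the points they reach need stars as well.\<close>
  define K' where "K' = {x + y | x y. x \<in> K \<and> y \<in> cball 0 l}"
  have K': "compact K'" unfolding K'_def using K by (intro compact_sums) auto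
  have K'I: "x + t *\<^sub>R s \<in> K'" if "x \<in> K" "norm s = 1" "\<bar>t\<bar> \<le> l" for x s and t :: real
    unfolding K'_def using that by (intro CollectI exI[of _ x] exI[of _ "t *\<^sub>R s"]) auto
  have "\<exists>\<epsilon>. star_radius X x \<epsilon> \<and> \<epsilon> \<le> l / 2" if xX: "x \<in> X" for x
  proof -
    obtain \<epsilon> where "star_radius X x \<epsilon>" using star_exists[OF xX] by blast
    moreover from this have "0 < \<epsilon>" by (simp add: star_radius_def)
    ultimately have "star_radius X x (min \<epsilon> (l / 2))"
      using l by (intro star_radius_mono[of X x \<epsilon> "min \<epsilon> (l / 2)"]) auto
    then show ?thesis by (intro exI[of _ "min \<epsilon> (l / 2)"]) simp
  qed
  then obtain e where e: "\<And>x. x \<in> X \<Longrightarrow> star_radius X x (e x)" "\<And>x. x \<in> X \<Longrightarrow> e x \<le> l / 2"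
    by metis
  have "compact (X \<inter> K')" using closed_X K' by (intro closed_Int_compact)
  moreover have "X \<inter> K' \<subseteq> (\<Union>x\<in>X. ball x (e x))"
    using e(1) by (force simp: star_radius_def)
  ultimately obtain C where C: "C \<subseteq> X" "finite C" "X \<inter> K' \<subseteq> (\<Union>x\<in>C. ball x (e x))"
    by (elim compactE_image[of _ X "\<lambda>x. ball x (e x)"]) auto
  define V where "V = C \<union> W"
  have V: "finite V" "V \<subseteq> X" using C W by (auto simp: V_def)
  \<comment> \<open>Outside \<open>V\<close>, every point of \<open>X\<close> in \<open>K'\<close>
    lies on an open ray of a star centred in \<open>V\<close>; in particular it is regular.\<close>
  have cov: "\<exists>v s t. v \<in> V \<and> s \<in> directions X v \<and> 0 < t \<and> t < l / 2 \<and> z = v + t *\<^sub>R s \<and> tangent_vector X z s"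
    if z: "z \<in> X" "z \<in> K'" "z \<notin> V" for z
  proof -
    obtain v where v: "v \<in> C" "z \<in> ball v (e v)" using z C(3) by blast
    then have vX: "v \<in> X" using C by blast
    obtain s t where s: "s \<in> directions X v" "0 \<le> t" "t < e v" "z = v + t *\<^sub>R s"
      using star_radius_cases[OF e(1)[OF vX] z(1)] v by auto
    have "t \<noteq> 0" using z(3) v s by (auto simp: V_def)
    then show ?thesis
      using s e[OF vX] v star_tangent_vector[OF e(1)[OF vX] finite_directions[OF vX] s(1)]
      by (intro exI[of _ v] exI[of _ s] exI[of _ t]) (auto simp: V_def)
  qed
  have "\<exists>T>0. T \<le> l \<and> x + T *\<^sub>R s \<in> V \<and> (\<forall>t. 0 < t \<longrightarrow> t < T \<longrightarrow> x + t *\<^sub>R s \<in> regular_points X - V)"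
    if x: "x \<in> X" "x \<in> K" and s: "s \<in> directions X x" for x s
  proof -
    have ns: "norm s = 1" using s by (rule directions_norm)
    \<comment> \<open>Only points strictly between 0 and \<open>T\<close> are required to be regular
      and no vertex; the end point is left free, so that the supremum can be attained at a
      vertex.\<close>
    define B where "B = {T \<in> {0..l}. \<forall>t. 0 < t \<longrightarrow> t < T \<longrightarrow> x + t *\<^sub>R s \<in> regular_points X - V}"
    define T where "T = Sup B"
    have B0: "0 \<in> B" using l by (auto simp: B_def)
    have Bbdd: "bdd_above B" unfolding B_def by (intro bdd_aboveI[of _ l]) auto
    have Tl: "T \<le> l" unfolding T_def using B0 by (intro cSup_least) (auto simp: B_def)
    have below: "x + t *\<^sub>R s \<in> regular_points X - V" if t: "0 < t" "t < T" for t
    proof -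
      obtain T' where "T' \<in> B" "t < T'" using t(2) B0 unfolding T_def
        by (metis less_cSupE empty_iff)
      then show ?thesis using t(1) by (auto simp: B_def)
    qed
    have upper: "T' \<le> T" if "T' \<in> B" for T' unfolding T_def using that Bbdd by (rule cSup_upper)
    obtain \<epsilon> where \<epsilon>: "star_radius X x \<epsilon>" using star_exists x by blast
    have \<epsilon>0: "\<epsilon> > 0" using \<epsilon> by (simp add: star_radius_def)
    have "finite {t. x + t *\<^sub>R s \<in> V}"
    proof (rule finite_imageD)
      show "finite ((\<lambda>t. x + t *\<^sub>R s) ` {t. x + t *\<^sub>R s \<in> V})"
        by (rule finite_subset[OF _ V(1)]) auto
      show "inj_on (\<lambda>t. x + t *\<^sub>R s) {t. x + t *\<^sub>R s \<in> V}" using ns by (auto simp: inj_on_def)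
    qed
    then have "finite ({t. x + t *\<^sub>R s \<in> V} \<inter> {0<..})" by simp
    \<comment> \<open>A lower bound for the distance to the first vertex ahead. The starting point
      is excluded, as it may itself be a vertex.\<close>
    then obtain \<eta> where \<eta>: "\<eta> > 0" "\<And>t. 0 < t \<Longrightarrow> x + t *\<^sub>R s \<in> V \<Longrightarrow> \<eta> \<le> t"
    proof (cases "{t. x + t *\<^sub>R s \<in> V} \<inter> {0<..} = {}")
      case True
      then show thesis using that[of 1] by auto
    next
      case False
      with \<open>finite ({t. x + t *\<^sub>R s \<in> V} \<inter> {0<..})\<close> show thesis
        using that[of "Min ({t. x + t *\<^sub>R s \<in> V} \<inter> {0<..})"] by auto
    qed
    have "min (min \<epsilon> \<eta>) l \<in> B"
      using star_regular[OF \<epsilon> x(1) s] \<eta> l \<epsilon>0 by (force simp: B_def)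
    then have T0: "T > 0" using upper \<eta> \<epsilon>0 l by (meson less_le_trans min_less_iff_conj)
    define w where "w = x + T *\<^sub>R s"
    have wX: "w \<in> X"
    proof -
      have "closed {t. x + t *\<^sub>R s \<in> X}"
        using continuous_closed_vimage[OF closed_X, of "\<lambda>t. x + t *\<^sub>R s"]
        by (auto simp: vimage_def intro!: continuous_intros)
      moreover have "{0<..<T} \<subseteq> {t. x + t *\<^sub>R s \<in> X}" using below regular_points_subset by auto
      ultimately have "closure {0<..<T} \<subseteq> {t. x + t *\<^sub>R s \<in> X}" by (rule closure_minimal[rotated])
      moreover have "T \<in> closure {0<..<T}" using T0 by simp
      ultimately show ?thesis unfolding w_def by blast
    qed
    have "w \<in> V"
    proof (rule ccontr)
      assume wV: "w \<notin> V"
      have wK': "w \<in> K'" unfolding w_def using K'I[OF x(2) ns, of T] T0 Tl by simp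
      obtain u where tan: "tangent_vector X w u" using cov[OF wX wK' wV] by blast
      show False
      \<comment> \<open>If \<open>T < l\<close> and the end point is no vertex, it is regular. The
        way back to \<open>x\<close> is one of its two directions, so the geodesic continues
        straight on, against the choice of \<open>T\<close>.\<close>
      proof (cases "T < l")
        case True
        obtain \<epsilon>' where \<epsilon>': "star_radius X w \<epsilon>'" "directions X w = {sgn u, - sgn u}"
          by (rule tangent_vector_star[OF tan])
        have e': "\<epsilon>' > 0" using \<epsilon>' by (simp add: star_radius_def)
        have "- s \<in> directions X w"
        proof -
          have "w + t *\<^sub>R (- s) \<in> X" if t: "0 < t" "t < T" for t
          proof -
            have "w + t *\<^sub>R (- s) = x + (T - t) *\<^sub>R s" by (simp add: w_def algebra_simps)
            then show ?thesis using below[of "T - t"] t regular_points_subset by auto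
          qed
          then have "\<forall>\<^sub>F t in at_right 0. w + t *\<^sub>R (- s) \<in> X"
            using T0 unfolding eventually_at_right_field by blast
          then show ?thesis using ns by (simp add: directions_def)
        qed
        then have "- s = sgn u \<or> - s = - sgn u" unfolding \<epsilon>'(2) by blast
        then have "s = - sgn u \<or> s = sgn u" by (metis minus_minus)
        then have sw: "s \<in> directions X w" unfolding \<epsilon>'(2) by blast
        have "open (- V)" using V by (simp add: finite_imp_closed open_Compl)
        moreover have "w \<in> - V" using wV by simp
        ultimately obtain d where d: "d > 0" "ball w d \<subseteq> - V" using openE by blast
        define T' where "T' = T + min (min \<epsilon>' d) (l - T)"
        have "T' \<in> B"
        proof -
          have "x + t *\<^sub>R s \<in> regular_points X - V" if t: "0 < t" "t < T'" for t
          proof -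
            consider "t < T" | "t = T" | "t > T" by linarith
            then show ?thesis
            proof cases
              case 2
              then show ?thesis using wV tangent_vector_regular[OF tan] by (simp add: w_def)
            next
              case 3
              have eq: "x + t *\<^sub>R s = w + (t - T) *\<^sub>R s" by (simp add: w_def algebra_simps)
              have "w + (t - T) *\<^sub>R s \<in> regular_points X"
                using 3 t by (intro star_regular[OF \<epsilon>'(1) wX sw]) (auto simp: T'_def)
              moreover have "w + (t - T) *\<^sub>R s \<in> ball w d"
                using 3 t ns by (auto simp: T'_def dist_norm)
              ultimately show ?thesis using d(2) eq by auto
            qed (use below t in auto)
          qed
          then show ?thesis using T0 True e' d by (auto simp: B_def T'_def)
        qed
        then have "T' \<le> T" by (rule upper)
        then show False using e' d True by (auto simp: T'_def)
      next
        case False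
        then have TT: "T = l" using Tl by simp
        \<comment> \<open>The middle of a stretch of length \<open>l\<close> without vertices. It is
          regular with directions \<open>s\<close> and \<open>- s\<close>, so the centre of a star
          through it lies on the same line, less than \<open>l / 2\<close> away: a vertex strictly
          inside the stretch.\<close>
        define m where "m = x + (l/2) *\<^sub>R s"
        have mreg: "m \<in> regular_points X - V" unfolding m_def using below[of "l/2"] l TT by simp
        have mK': "m \<in> K'" unfolding m_def using K'I[OF x(2) ns, of "l/2"] l by simp
        obtain v u t where v: "v \<in> V" "u \<in> directions X v" "0 < t" "t < l / 2" "m = v + t *\<^sub>R u"
          "tangent_vector X m u"
          using cov[of m] mreg mK' regular_points_subset by blast
        have "- s \<in> directions X m"
        proof -
          have "m + t *\<^sub>R (- s) \<in> X" if t: "0 < t" "t < l/2" for t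
          proof -
            have "m + t *\<^sub>R (- s) = x + (l/2 - t) *\<^sub>R s" by (simp add: m_def algebra_simps)
            then show ?thesis using below[of "l/2 - t"] TT t regular_points_subset by auto
          qed
          moreover have "0 < l/2" using l by simp
          ultimately have "\<forall>\<^sub>F t in at_right 0. m + t *\<^sub>R (- s) \<in> X"
            unfolding eventually_at_right_field by blast
          then show ?thesis using ns by (simp add: directions_def)
        qed
        moreover have "directions X m = {u, - u}"
          using tangent_vector_pair[OF v(6)] directions_norm[OF v(2)] by (simp add: sgn_div_norm)
        ultimately have "- s = u \<or> - s = - u" by blast
        then have "u = s \<or> u = - s" by (metis minus_minus)
        then have "v = x + (l/2 - t) *\<^sub>R s \<or> v = x + (l/2 + t) *\<^sub>R s"
          using v(5) by (auto simp: m_def algebra_simps)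
        then show False using below[of "l/2 - t"] below[of "l/2 + t"] v TT by auto
      qed
    qed
    then show ?thesis using T0 Tl below by (auto simp: w_def)
  qed
  moreover have "singular_points X \<inter> K \<subseteq> V"
  proof (intro subsetI, rule ccontr)
    fix x assume x: "x \<in> singular_points X \<inter> K" "x \<notin> V"
    moreover have "x \<in> K'" using x l unfolding K'_def by (intro CollectI exI[of _ x] exI[of _ 0]) auto
    ultimately show False
      using cov[of x] tangent_vector_regular by (auto simp: singular_points_def)
  qed
  ultimately have "vertex_set X K l V" using V by (auto simp: vertex_set_def)
  then show ?thesis by (auto simp: V_def)
qed

section \<open>Correspondence of edges with directions, first variation, covering by edges\<close>

lemma vertex_edge:
  assumes V: "vertex_set X K l V" and v: "v \<in> V" "v \<in> K" and s: "s \<in> directions X v"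
  shows "\<exists>q. (v, q) \<in> edges X V \<and> sgn (q - v) = s \<and> norm (q - v) \<le> l"
proof -
  have "v \<in> X" using V v by (auto simp: vertex_set_def)
  then obtain T where T: "T > 0" "T \<le> l" "v + T *\<^sub>R s \<in> V"
    "\<And>t. 0 < t \<Longrightarrow> t < T \<Longrightarrow> v + t *\<^sub>R s \<in> regular_points X - V"
    using V v(2) s unfolding vertex_set_def by blast
  define q where "q = v + T *\<^sub>R s"
  have ns: "norm s = 1" using s by (rule directions_norm)
  have qv: "q - v = T *\<^sub>R s" by (simp add: q_def)
  have nq: "norm (q - v) = T" using qv ns T(1) by simp
  have sg: "sgn (q - v) = s" using qv nq T(1) by (simp add: sgn_div_norm)
  have "v \<noteq> q" using nq T(1) by auto
  moreover from this have "open_segment v q \<subseteq> regular_points X - V"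
    using T(4) by (auto simp: open_segment_arclength nq sg)
  ultimately show ?thesis using v(1) T nq sg by (intro exI[of _ q]) (auto simp: edges_def q_def)
qed

text \<open>Otherwise the end of the shorter edge, a vertex, would be an inner point of the longer
  one.\<close>

lemma edge_inj:
  assumes pq: "(p, q) \<in> edges X V" and pq': "(p, q') \<in> edges X V" and eq: "sgn (q - p) = sgn (q' - p)"
  shows "q = q'"
proof -
  have *: "\<not> norm (q - p) < norm (q' - p)"
    if "(p, q) \<in> edges X V" "(p, q') \<in> edges X V" "sgn (q - p) = sgn (q' - p)" for q q'
  proof
    assume "norm (q - p) < norm (q' - p)"
    moreover have "0 < norm (q - p)" "q \<in> V" using that(1) by (auto simp: edges_def)
    ultimately have "p + norm (q - p) *\<^sub>R sgn (q' - p) \<notin> V" using edge_point[OF that(2)] by auto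
    then show False using that(3) \<open>q \<in> V\<close> scaleR_norm_sgn[of "q - p"] by simp
  qed
  have "norm (q - p) = norm (q' - p)" using *[OF pq pq' eq] *[OF pq' pq eq[symmetric]] by simp
  then have "q - p = q' - p" using eq scaleR_norm_sgn by metis
  then show ?thesis by simp
qed

lemma edge_length_le:
  assumes V: "vertex_set X K l V" and pq: "(p, q) \<in> edges X V" "p \<in> K"
  shows "norm (q - p) \<le> l"
proof -
  have "p \<in> V" using pq by (auto simp: edges_def)
  then obtain q' where q': "(p, q') \<in> edges X V" "sgn (q' - p) = sgn (q - p)" "norm (q' - p) \<le> l"
    using vertex_edge[OF V _ pq(2) edge_direction[OF pq(1)]] by blast
  then show ?thesis using edge_inj[OF q'(1) pq(1)] by simp
qed

text \<open>Sending an edge to its initial direction is injective by \<open>edge_inj\<close> and,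
  for \<open>v\<close> in the window, onto by \<open>vertex_edge\<close>. This carries the balance
  at a point over to edges.\<close>

lemma sum_directions:
  assumes V: "vertex_set X K l V" and v: "v \<in> V" "v \<in> K"
  shows "(\<Sum>s\<in>directions X v. F (edge_mult \<Theta> v s) s)
    = (\<Sum>q\<in>{q. (v, q) \<in> edges X V}. F (edge_weight \<Theta> v q) (sgn (q - v)))"
proof -
  have bij: "bij_betw (\<lambda>q. sgn (q - v)) {q. (v, q) \<in> edges X V} (directions X v)"
    unfolding bij_betw_def
  proof
    show "inj_on (\<lambda>q. sgn (q - v)) {q. (v, q) \<in> edges X V}"
      using edge_inj by (auto simp: inj_on_def)
    show "(\<lambda>q. sgn (q - v)) ` {q. (v, q) \<in> edges X V} = directions X v"
      using edge_direction vertex_edge[OF V v] by force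
  qed
  show ?thesis
    unfolding sum.reindex_bij_betw[OF bij, symmetric]
    using edge_mult_weight by (intro sum.cong) auto
qed

lemma sum_edges_fst:
  assumes "finite V"
  shows "(\<Sum>(p, q)\<in>edges X V. F p q) = (\<Sum>p\<in>V. \<Sum>q\<in>{q. (p, q) \<in> edges X V}. F p q)"
proof -
  have fin: "finite {q. (p, q) \<in> edges X V}" for p
    by (rule finite_subset[OF _ assms]) (auto simp: edges_def)
  have "edges X V = (SIGMA p:V. {q. (p, q) \<in> edges X V})" by (auto simp: edges_def)
  then have "(\<Sum>(p, q)\<in>edges X V. F p q) = (\<Sum>(p, q)\<in>(SIGMA p:V. {q. (p, q) \<in> edges X V}). F p q)"
    by simp
  also have "\<dots> = (\<Sum>p\<in>V. \<Sum>q\<in>{q. (p, q) \<in> edges X V}. F p q)"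
    using assms fin by (intro sum.Sigma[symmetric]) auto
  finally show ?thesis .
qed

lemma sum_edges_swap: "(\<Sum>(p, q)\<in>edges X V. F p q) = (\<Sum>(p, q)\<in>edges X V. F q p)"
proof (rule sum.reindex_bij_witness[where i = prod.swap and j = prod.swap])
  fix e assume "e \<in> edges X V"
  then show "prod.swap e \<in> edges X V" using edges_commute[of "fst e" "snd e"] by (cases e) simp
  then show "prod.swap e \<in> edges X V" .
qed (simp_all add: case_prod_beta)

text \<open>
  Summation by parts turns stationarity at the vertices into the first variation formula;
  no regularity of the test function \<open>f\<close> is involved.
\<close>

lemma first_variation:
  fixes f :: "'a \<Rightarrow> real"
  assumes V: "vertex_set X K l V" and f: "\<And>v. v \<in> V \<Longrightarrow> v \<notin> K \<Longrightarrow> f v = 0"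
  shows "(\<Sum>(p, q)\<in>edges X V. (edge_weight \<Theta> p q * (f q - f p)) *\<^sub>R sgn (q - p)) = 0"
proof -
  have finV: "finite V" and VX: "V \<subseteq> X" using V by (auto simp: vertex_set_def)
  define S where "S = (\<Sum>(p, q)\<in>edges X V. (edge_weight \<Theta> p q * f p) *\<^sub>R sgn (q - p))"
  \<comment> \<open>Grouped by initial vertex: inside \<open>K\<close> balance annihilates the inner
    sum; outside, where edges may be missing, \<open>f\<close> vanishes.\<close>
  have "(\<Sum>q\<in>{q. (p, q) \<in> edges X V}. (edge_weight \<Theta> p q * f p) *\<^sub>R sgn (q - p)) = 0" if p: "p \<in> V" for p
  proof (cases "p \<in> K")
    case True
    have "(\<Sum>q\<in>{q. (p, q) \<in> edges X V}. (edge_weight \<Theta> p q * f p) *\<^sub>R sgn (q - p))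
        = f p *\<^sub>R (\<Sum>q\<in>{q. (p, q) \<in> edges X V}. edge_weight \<Theta> p q *\<^sub>R sgn (q - p))"
      by (simp add: scaleR_sum_right mult.commute)
    also have "\<dots> = f p *\<^sub>R (\<Sum>s\<in>directions X p. edge_mult \<Theta> p s *\<^sub>R s)"
      using sum_directions[OF V p True, of "\<lambda>c s. c *\<^sub>R s"] by simp
    also have "\<dots> = 0" using balance[of p] p VX by auto
    finally show ?thesis .
  next
    case False
    then show ?thesis using f[OF p] by simp
  qed
  then have S0: "S = 0" unfolding S_def using finV by (simp add: sum_edges_fst)
  \<comment> \<open>Reversing every edge keeps its weight and flips its unit vector, so the terms
    with \<open>f q\<close> sum to \<open>- S\<close>.\<close>
  have "(\<Sum>(p, q)\<in>edges X V. (edge_weight \<Theta> p q * f q) *\<^sub>R sgn (q - p)) =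
      (\<Sum>(p, q)\<in>edges X V. (edge_weight \<Theta> q p * f p) *\<^sub>R sgn (p - q))"
    by (rule sum_edges_swap)
  also have "\<dots> = (\<Sum>(p, q)\<in>edges X V. - ((edge_weight \<Theta> p q * f p) *\<^sub>R sgn (q - p)))"
  proof -
    have "(edge_weight \<Theta> q p * f p) *\<^sub>R sgn (p - q) = - ((edge_weight \<Theta> p q * f p) *\<^sub>R sgn (q - p))" for p q
    proof -
    have "sgn (p - q) = - sgn (q - p)" by (metis minus_diff_eq sgn_minus)
    then show ?thesis by (simp only: edge_weight_commute[of \<Theta> q p] scaleR_minus_right)
    qed
    then show ?thesis by simp
  qed
  also have "\<dots> = - S" unfolding S_def by (simp add: sum_negf case_prod_beta)
  finally have S': "(\<Sum>(p, q)\<in>edges X V. (edge_weight \<Theta> p q * f q) *\<^sub>R sgn (q - p)) = 0"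
    using S0 by simp
  have "(\<Sum>(p, q)\<in>edges X V. (edge_weight \<Theta> p q * (f q - f p)) *\<^sub>R sgn (q - p))
     = (\<Sum>(p, q)\<in>edges X V. (edge_weight \<Theta> p q * f q) *\<^sub>R sgn (q - p)) - S"
    unfolding S_def
    by (simp add: sum_subtractf right_diff_distrib scaleR_diff_left case_prod_beta)
  then show ?thesis using S' S0 by simp
qed

text \<open>Both edges pass through a regular point, which has only two opposite directions. If
  theirs agree, the initial vertices coincide, since otherwise one of them would lie inside the
  other edge, and \<open>edge_inj\<close> applies. If they are opposite, one edge is
  reversed.\<close>

lemma edge_unique:
  assumes pq: "(p, q) \<in> edges X V" "x \<in> open_segment p q"
    and pq': "(p', q') \<in> edges X V" "x \<in> open_segment p' q'"
  shows "(p', q') = (p, q) \<or> (p', q') = (q, p)"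
proof -
  have param: "\<exists>t. 0 < t \<and> t < norm (q - p) \<and> x = p + t *\<^sub>R sgn (q - p) \<and> sgn (q - p) \<in> directions X x"
    if e: "(p, q) \<in> edges X V" "x \<in> open_segment p q" for p q
  proof -
    have "p \<noteq> q" using e by (auto simp: edges_def)
    then obtain t where t: "0 < t" "t < norm (q - p)" "x = p + t *\<^sub>R sgn (q - p)"
      using e(2) by (auto simp: open_segment_arclength)
    have "x + u *\<^sub>R sgn (q - p) \<in> X" if u: "0 < u" "u < norm (q - p) - t" for u
    proof -
      have "x + u *\<^sub>R sgn (q - p) = p + (t + u) *\<^sub>R sgn (q - p)" by (simp add: t algebra_simps)
      moreover have "p + (t + u) *\<^sub>R sgn (q - p) \<in> regular_points X - V"
        using t u by (intro edge_point[OF e(1)]) auto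
      ultimately show ?thesis using regular_points_subset by auto
    qed
    moreover have "0 < norm (q - p) - t" using t by simp
    ultimately have "\<forall>\<^sub>F u in at_right 0. x + u *\<^sub>R sgn (q - p) \<in> X"
      unfolding eventually_at_right_field by blast
    then have "sgn (q - p) \<in> directions X x" using \<open>p \<noteq> q\<close> by (simp add: directions_def norm_sgn)
    then show ?thesis using t by blast
  qed
  have same: "(p', q') = (p, q)"
    if e: "(p, q) \<in> edges X V" "x \<in> open_segment p q" "(p', q') \<in> edges X V" "x \<in> open_segment p' q'"
      and s: "sgn (q' - p') = sgn (q - p)" for p q p' q'
  proof -
    obtain t where t: "0 < t" "t < norm (q - p)" "x = p + t *\<^sub>R sgn (q - p)" using param[OF e(1,2)] by blast
    obtain t' where t': "0 < t'" "t' < norm (q' - p')" "x = p' + t' *\<^sub>R sgn (q' - p')" using param[OF e(3,4)] by blast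
    have pV: "p \<in> V" "p' \<in> V" using e by (auto simp: edges_def)
    have pp: "p = p' + (t' - t) *\<^sub>R sgn (q' - p')" "p' = p + (t - t') *\<^sub>R sgn (q - p)"
      using t(3) t'(3) s by (auto simp: algebra_simps)
    have "\<not> t < t'" using edge_point[OF e(3), of "t' - t"] t t' pV pp(1) by auto
    moreover have "\<not> t' < t" using edge_point[OF e(1), of "t - t'"] t t' pV pp(2) by auto
    ultimately have "p = p'" using pp(1) by simp
    then show ?thesis using edge_inj[of p q V q'] e s by simp
  qed
  have "x \<in> regular_points X" using pq by (auto simp: edges_def)
  then obtain v where "tangent_vector X x v" by (auto simp: regular_points_def)
  then have dir: "directions X x = {sgn v, - sgn v}" by (rule tangent_vector_pair)
  have "sgn (q - p) \<in> directions X x" "sgn (q' - p') \<in> directions X x"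
    using param[OF pq] param[OF pq'] by blast+
  then consider "sgn (q' - p') = sgn (q - p)" | "sgn (q' - p') = - sgn (q - p)"
    unfolding dir by fastforce
  then show ?thesis
  proof cases
    case 1
    then show ?thesis using same[OF pq pq'] by simp
  next
    case 2
    then have "sgn (p' - q') = sgn (q - p)" by (metis minus_diff_eq minus_minus sgn_minus)
    moreover have "(q', p') \<in> edges X V" "x \<in> open_segment q' p'"
      using pq' edges_commute open_segment_commute by metis+
    ultimately have "(q', p') = (p, q)" using same[OF pq] by blast
    then show ?thesis by simp
  qed
qed

text \<open>Follow both directions from \<open>x\<close> to the next vertex, each within length
  \<open>l\<close>. The bound \<open>2 * l\<close> takes the place of \<open>edge_length_le\<close>,
  because the end points may lie outside \<open>K\<close>.\<close>

lemma edges_cover: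
  assumes V: "vertex_set X K l V" and x: "x \<in> X" "x \<in> K" "x \<notin> V"
  shows "\<exists>(p, q)\<in>edges X V. x \<in> open_segment p q \<and> norm (q - p) \<le> 2 * l"
proof -
  have "x \<in> regular_points X" using x V by (auto simp: vertex_set_def singular_points_def)
  then obtain v where v: "tangent_vector X x v" by (auto simp: regular_points_def)
  define s where "s = sgn v"
  have dir: "directions X x = {s, - s}" unfolding s_def by (rule tangent_vector_pair[OF v])
  then have ns: "norm s = 1" using directions_norm by blast
  have hit: "\<And>u. u \<in> directions X x \<Longrightarrow> \<exists>T>0. T \<le> l \<and> x + T *\<^sub>R u \<in> V \<and>
      (\<forall>t. 0 < t \<longrightarrow> t < T \<longrightarrow> x + t *\<^sub>R u \<in> regular_points X - V)"
    using V x unfolding vertex_set_def by blast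
  obtain T where T: "T > 0" "x + T *\<^sub>R s \<in> V"
     "\<And>t. 0 < t \<Longrightarrow> t < T \<Longrightarrow> x + t *\<^sub>R s \<in> regular_points X - V" "T \<le> l"
    using hit[of s] dir by auto
  obtain T' where T': "T' > 0" "x + T' *\<^sub>R (- s) \<in> V"
     "\<And>t. 0 < t \<Longrightarrow> t < T' \<Longrightarrow> x + t *\<^sub>R (- s) \<in> regular_points X - V" "T' \<le> l"
    using hit[of "- s"] dir by blast
  define p where "p = x + T' *\<^sub>R (- s)"
  define q where "q = x + T *\<^sub>R s"
  have qp: "q - p = (T + T') *\<^sub>R s" by (simp add: p_def q_def algebra_simps)
  have nq: "norm (q - p) = T + T'" using qp ns T(1) T'(1) by simp
  have sg: "sgn (q - p) = s" unfolding sgn_div_norm nq using T(1) T'(1) by (simp add: qp)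
  have pq: "p \<noteq> q" using nq T(1) T'(1) by auto
  have pt: "p + t *\<^sub>R s = x + (t - T') *\<^sub>R s" "x + (t - T') *\<^sub>R s = x + (T' - t) *\<^sub>R (- s)" for t
    by (simp_all add: p_def algebra_simps)
  have "p + t *\<^sub>R s \<in> regular_points X - V" if t: "0 < t" "t < T + T'" for t
  proof -
    consider "t < T'" | "t = T'" | "T' < t" by linarith
    then show ?thesis
    proof cases
      case 1
      then show ?thesis using T'(3)[of "T' - t"] t unfolding pt by simp
    next
      case 2
      then show ?thesis using pt(1)[of t] \<open>x \<in> regular_points X\<close> x(3) by simp
    next
      case 3
      then show ?thesis using T(3)[of "t - T'"] t unfolding pt(1) by simp
    qed
  qed
  then have "open_segment p q \<subseteq> regular_points X - V"
    using pq by (auto simp: open_segment_arclength nq sg)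
  then have "(p, q) \<in> edges X V" using pq T T' by (simp add: edges_def p_def q_def)
  moreover have "x \<in> open_segment p q"
    unfolding open_segment_arclength[OF pq] nq sg using T(1) T'(1) pt(1)[of T']
    by (intro image_eqI[where x = T']) auto
  moreover have "norm (q - p) \<le> 2 * l" using nq T(4) T'(4) by simp
  ultimately show ?thesis by blast
qed

lemma edge_weight_point:
  assumes "(p, q) \<in> edges X V" "x \<in> open_segment p q"
  shows "mult_ext X \<Theta> x = edge_weight \<Theta> p q"
proof -
  have "p \<noteq> q" "x \<in> regular_points X" using assms by (auto simp: edges_def)
  moreover from this obtain t where "0 < t" "t < norm (q - p)" "x = p + t *\<^sub>R sgn (q - p)"
    using assms by (auto simp: open_segment_arclength)
  ultimately show ?thesis
    using edge_mult_edge[OF assms(1)] edge_mult_weight[OF assms(1)] by (simp add: mult_ext_def)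
qed

end

section \<open>Integration over a network\<close>

text \<open>The integrand lives on the line through \<open>p\<close> and \<open>q\<close>, where
  \<open>hausdorff1_line\<close> applies.\<close>

lemma hausdorff1_segment_integral:
  fixes \<phi> :: "'a::euclidean_space \<Rightarrow> real"
  assumes pq: "p \<noteq> q" and \<phi>: "continuous_on UNIV \<phi>"
  shows "integrable hausdorff1 (\<lambda>x. indicator (open_segment p q) x * \<phi> x)"
    and "(\<integral>x. indicator (open_segment p q) x * \<phi> x \<partial>hausdorff1)
      = (\<integral>t. indicator {0<..<norm (q - p)} t * \<phi> (p + t *\<^sub>R sgn (q - p)) \<partial>lborel)"
proof -
  define s where "s = sgn (q - p)"
  define l where "l = norm (q - p)"
  have ns: "norm s = 1" using pq by (simp add: s_def norm_sgn)
  define h where "h x = indicator (open_segment p q) x * \<phi> x" for x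
  have [measurable]: "\<phi> \<in> borel_measurable borel" using \<phi> by (rule borel_measurable_continuous_onI)
  have L [measurable]: "line p s \<in> sets borel" using closed_line[OF ns] by auto
  have seg: "open_segment p q = (\<lambda>t. p + t *\<^sub>R s) ` {0<..<l}"
    unfolding s_def l_def by (rule open_segment_arclength[OF pq])
  have [measurable]: "open_segment p q \<in> sets borel"
    unfolding open_segment_def by (intro sets.Diff) auto
  have hm [measurable]: "h \<in> borel_measurable borel" unfolding h_def by measurable
  have gm [measurable]: "(\<lambda>t. p + t *\<^sub>R s) \<in> borel_measurable borel" by measurable
  have hline: "indicator (line p s) x *\<^sub>R h x = h x" for x
    by (auto simp: h_def seg line_def split: split_indicator)
  have hg: "h (p + t *\<^sub>R s) = indicator {0<..<l} t * \<phi> (p + t *\<^sub>R s)" for t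
  proof -
    have "s \<noteq> 0" using ns by auto
    then have "p + t *\<^sub>R s \<in> open_segment p q \<longleftrightarrow> t \<in> {0<..<l}" by (auto simp: seg)
    then show ?thesis by (simp add: h_def indicator_def)
  qed
  have dens: "density hausdorff1 (\<lambda>x. ennreal (indicator (line p s) x)) = distr lborel borel (\<lambda>t. p + t *\<^sub>R s)"
    unfolding hausdorff1_line[OF ns, symmetric]
    by (intro density_cong AE_I2) (auto split: split_indicator)
  have int_line: "integrable lborel (\<lambda>t. indicator {0<..<l} t * \<phi> (p + t *\<^sub>R s))"
  proof -
    have "integrable lborel (\<lambda>t. indicator {0..l} t *\<^sub>R \<phi> (p + t *\<^sub>R s))"
      by (intro borel_integrable_compact continuous_on_compose2[OF \<phi>] continuous_intros) auto
    then have "integrable lborel (\<lambda>t. indicator {0<..<l} t *\<^sub>R (indicator {0..l} t *\<^sub>R \<phi> (p + t *\<^sub>R s)))"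
      by (rule integrable_mult_indicator[rotated]) simp
    also have "(\<lambda>t. indicator {0<..<l} t *\<^sub>R (indicator {0..l} t *\<^sub>R \<phi> (p + t *\<^sub>R s)))
        = (\<lambda>t. indicator {0<..<l} t * \<phi> (p + t *\<^sub>R s))"
      by (auto split: split_indicator)
    finally show ?thesis .
  qed
  have "integrable (distr lborel borel (\<lambda>t. p + t *\<^sub>R s)) h"
    using int_line by (subst integrable_distr_eq) (auto simp: hg)
  then have "integrable hausdorff1 (\<lambda>x. indicator (line p s) x *\<^sub>R h x)"
    unfolding dens[symmetric] by (subst (asm) integrable_density) auto
  then show "integrable hausdorff1 (\<lambda>x. indicator (open_segment p q) x * \<phi> x)"
    unfolding hline by (simp add: h_def)
  have "(\<integral>x. h x \<partial>hausdorff1) = (\<integral>x. indicator (line p s) x *\<^sub>R h x \<partial>hausdorff1)"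
    unfolding hline ..
  also have "\<dots> = (\<integral>x. h x \<partial>density hausdorff1 (\<lambda>x. ennreal (indicator (line p s) x)))"
    by (subst integral_density) auto
  also have "\<dots> = (\<integral>t. h (p + t *\<^sub>R s) \<partial>lborel)"
    unfolding dens by (rule integral_distr) auto
  finally show "(\<integral>x. indicator (open_segment p q) x * \<phi> x \<partial>hausdorff1)
      = (\<integral>t. indicator {0<..<norm (q - p)} t * \<phi> (p + t *\<^sub>R sgn (q - p)) \<partial>lborel)"
    unfolding hg by (simp add: h_def s_def l_def)
qed

definition edge_integral :: "('a::euclidean_space \<Rightarrow> real) \<Rightarrow> 'a \<Rightarrow> 'a \<Rightarrow> real" where
  "edge_integral \<phi> p q = (\<integral>t. indicator {0<..<norm (q - p)} t * \<phi> (p + t *\<^sub>R sgn (q - p)) \<partial>lborel)"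

context isgn
begin

section \<open>Measurability of the multiplicity, mass in balls, integrals as sums over
  edges\<close>

lemma open_regular: "\<exists>U. open U \<and> regular_points X = X \<inter> U"
proof -
  have "\<exists>U. open U \<and> x \<in> U \<and> X \<inter> U \<subseteq> regular_points X" if x: "x \<in> regular_points X" for x
  proof -
    obtain v where "tangent_vector X x v" using x by (auto simp: regular_points_def)
    then obtain \<epsilon> where \<epsilon>: "star_radius X x \<epsilon>" by (rule tangent_vector_star)
    have "X \<inter> ball x \<epsilon> \<subseteq> regular_points X"
    proof
      fix z assume z: "z \<in> X \<inter> ball x \<epsilon>"
      then obtain s t where s: "s \<in> directions X x" "0 \<le> t" "t < \<epsilon>" "z = x + t *\<^sub>R s"
        using star_radius_cases[OF \<epsilon>, of z] by auto
      then show "z \<in> regular_points X"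
        using star_regular[OF \<epsilon> _ s(1), of t] x regular_points_subset by (cases "t = 0") auto
    qed
    then show ?thesis using \<epsilon> by (intro exI[of _ "ball x \<epsilon>"]) (auto simp: star_radius_def)
  qed
  then obtain U where U: "\<And>x. x \<in> regular_points X \<Longrightarrow> open (U x) \<and> x \<in> U x \<and> X \<inter> U x \<subseteq> regular_points X"
    by metis
  then have "regular_points X = X \<inter> (\<Union>x\<in>regular_points X. U x)" using regular_points_subset by blast
  then show ?thesis using U by (intro exI[of _ "\<Union>x\<in>regular_points X. U x"]) auto
qed

text \<open>Singular points do not accumulate, since a punctured star consists of regular points.
  Hence any function is harmless for measurability on the singular set.\<close>

lemma closed_subset_singular:
  assumes "Z \<subseteq> singular_points X"
  shows "closed Z"
  unfolding closed_limpt
proof (intro allI impI)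
  fix z assume z: "z islimpt Z"
  have "Z \<subseteq> X" using assms by (auto simp: singular_points_def)
  then have zX: "z \<in> X" using z closed_X islimpt_subset closed_limpt by metis
  then obtain \<epsilon> where \<epsilon>: "star_radius X z \<epsilon>" using star_exists by blast
  then have "\<epsilon> > 0" by (simp add: star_radius_def)
  then obtain y where y: "y \<in> Z" "y \<noteq> z" "dist y z < \<epsilon>" using z unfolding islimpt_approachable by blast
  then obtain s t where s: "s \<in> directions X z" "0 \<le> t" "t < \<epsilon>" "y = z + t *\<^sub>R s"
    using star_radius_cases[OF \<epsilon>, of y] \<open>Z \<subseteq> X\<close> by (auto simp: dist_commute)
  moreover have "t \<noteq> 0" using y(2) s by auto
  ultimately have "y \<in> regular_points X" using star_regular[OF \<epsilon> zX s(1)] by auto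
  then show "z \<in> Z" using y(1) assms by (auto simp: singular_points_def)
qed

text \<open>A superlevel set consists of a relatively open part of the closed set \<open>X\<close>,
  by local constancy of \<open>\<Theta>\<close>, a closed set of singular points, and for negative
  levels the complement of \<open>X\<close>.\<close>

lemma mult_ext_measurable [measurable]: "mult_ext X \<Theta> \<in> borel_measurable borel"
proof (rule borel_measurableI_greater)
  fix c :: real
  obtain U where U: "open U" "regular_points X = X \<inter> U" using open_regular by blast
  define R where "R = {x \<in> regular_points X. \<Theta> x > c}"
  have "\<exists>O'. open O' \<and> R = X \<inter> O'"
  proof -
    have "\<exists>W. open W \<and> x \<in> W \<and> X \<inter> W \<subseteq> R" if x: "x \<in> R" for x
    proof -
      have xR: "x \<in> regular_points X" "\<Theta> x > c" using x by (auto simp: R_def)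
      have "\<exists>W. open W \<and> x \<in> W \<and> (\<forall>y \<in> W \<inter> regular_points X. \<Theta> y = \<Theta> x)"
        using mult xR(1) unfolding multiplicity_on_def by blast
      then obtain W where W: "open W" "x \<in> W" "\<forall>y \<in> W \<inter> regular_points X. \<Theta> y = \<Theta> x"
        by blast
      have "X \<inter> (W \<inter> U) \<subseteq> R"
      proof
        fix y assume y: "y \<in> X \<inter> (W \<inter> U)"
        then have "y \<in> regular_points X" unfolding U(2) by blast
        then show "y \<in> R" using W(3) xR(2) y by (simp add: R_def)
      qed
      moreover have "open (W \<inter> U)" "x \<in> W \<inter> U" using U W xR(1) by auto
      ultimately show ?thesis by blast
    qed
    then obtain W where W: "\<And>x. x \<in> R \<Longrightarrow> open (W x) \<and> x \<in> W x \<and> X \<inter> W x \<subseteq> R" by metis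
    moreover have "R \<subseteq> X" using regular_points_subset by (auto simp: R_def)
    ultimately have "R = X \<inter> (\<Union>x\<in>R. W x)" by blast
    then show ?thesis using W by (intro exI[of _ "\<Union>x\<in>R. W x"]) auto
  qed
  then have Rb: "R \<in> sets borel" using closed_X by (auto intro: sets.Int)
  define Z where "Z = {x \<in> singular_points X. mult_ext X \<Theta> x > c}"
  have Zb: "Z \<in> sets borel" using closed_subset_singular[of Z] by (auto simp: Z_def)
  define N where "N = (if c < 0 then - X else {})"
  have Nb: "N \<in> sets borel" using closed_X by (auto simp: N_def)
  have "mult_ext X \<Theta> x > c \<longleftrightarrow> x \<in> R \<union> Z \<union> N" for x
  proof (cases "x \<in> X")
    case True
    then show ?thesis
      by (cases "x \<in> regular_points X") (auto simp: R_def Z_def N_def mult_ext_def singular_points_def)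
  next
    case False
    then show ?thesis using mult_ext_outside[OF False] regular_points_subset
      by (auto simp: R_def Z_def N_def singular_points_def)
  qed
  then have "{x \<in> space borel. c < mult_ext X \<Theta> x} = R \<union> Z \<union> N" by auto
  then show "{x \<in> space borel. c < mult_ext X \<Theta> x} \<in> sets borel" using Rb Zb Nb by simp
qed

text \<open>\<open>dist x\<close> is 1-Lipschitz and by \<open>meets_sphere\<close> takes every
  value between 0 and \<open>\<rho>\<close> on \<open>X\<close>, so \<open>X\<close> has length at
  least \<open>\<rho>\<close> in the ball, with multiplicity at least 1. This crude form of
  monotonicity is enough to confine \<open>X\<close> to a tube.\<close>

lemma network_measure_ball:
  assumes x: "x \<in> X" and \<rho>: "0 < \<rho>"
  shows "ennreal \<rho> \<le> emeasure (network_measure X \<Theta>) (ball x \<rho>)"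
proof -
  have b: "X \<inter> ball x \<rho> \<in> sets borel" using closed_X by auto
  have "{0<..<\<rho>} \<subseteq> dist x ` (X \<inter> ball x \<rho>)"
  proof
    fix t assume t: "t \<in> {0<..<\<rho>}"
    then obtain z where "z \<in> X" "dist x z = t" using meets_sphere[OF x, of t] by auto
    then show "t \<in> dist x ` (X \<inter> ball x \<rho>)" using t by (intro image_eqI[of _ _ z]) auto
  qed
  then have "ennreal (\<rho> - 0) \<le> hausdorff1_outer (X \<inter> ball x \<rho>)"
    by (intro hausdorff1_outer_ge_length[where f = "dist x"])
      (metis abs_dist_diff_le dist_commute)+
  also have "\<dots> = (\<integral>\<^sup>+y. indicator (X \<inter> ball x \<rho>) y \<partial>hausdorff1)"
    using b by (simp add: emeasure_hausdorff1)
  also have "\<dots> \<le> (\<integral>\<^sup>+y. ennreal (mult_ext X \<Theta> y) * indicator (ball x \<rho>) y \<partial>hausdorff1)"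
  proof (intro nn_integral_mono)
    fix y
    have "1 \<le> ennreal (mult_ext X \<Theta> y)" if "y \<in> X"
      using mult_ext_ge_1[OF that] by (simp add: ennreal_ge_1)
    then show "indicator (X \<inter> ball x \<rho>) y \<le> ennreal (mult_ext X \<Theta> y) * indicator (ball x \<rho>) y"
      by (auto split: split_indicator)
  qed
  also have "\<dots> = emeasure (network_measure X \<Theta>) (ball x \<rho>)"
    unfolding network_measure_def by (subst emeasure_density) auto
  finally show ?thesis by simp
qed

text \<open>Up to the null set \<open>V\<close>, a point covered by an edge is covered by exactly
  one, counted in both orientations, whence the factor 1/2. Points of \<open>X\<close> that no edge
  covers lie outside the window, where \<open>\<phi>\<close> vanishes.\<close>

lemma network_integral:
  fixes \<phi> :: "'a \<Rightarrow> real"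
  assumes V: "vertex_set X K l V" and \<phi>: "continuous_on UNIV \<phi>" and K: "\<And>x. x \<notin> K \<Longrightarrow> \<phi> x = 0"
  shows "integrable (network_measure X \<Theta>) \<phi>"
    and "(\<integral>x. \<phi> x \<partial>network_measure X \<Theta>)
      = (1/2) * (\<Sum>(p, q)\<in>edges X V. edge_weight \<Theta> p q * edge_integral \<phi> p q)"
proof -
  define E where "E = edges X V"
  have finV: "finite V" and VX: "V \<subseteq> X" using V by (auto simp: vertex_set_def)
  have finE: "finite E" unfolding E_def using finV by (rule finite_edges)
  have [measurable]: "\<phi> \<in> borel_measurable borel" using \<phi> by (rule borel_measurable_continuous_onI)
  define F where "F = (\<lambda>(p, q) x. edge_weight \<Theta> p q * (indicator (open_segment p q) x * \<phi> x))"
  have ne: "p \<noteq> q" if "(p, q) \<in> E" for p q using that by (auto simp: E_def edges_def)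
  have intF: "integrable hausdorff1 (F e)" if "e \<in> E" for e
    using hausdorff1_segment_integral(1)[OF ne \<phi>] that by (cases e) (auto simp: F_def)
  have LF: "(\<integral>x. F e x \<partial>hausdorff1) = (case e of (p, q) \<Rightarrow> edge_weight \<Theta> p q * edge_integral \<phi> p q)"
    if "e \<in> E" for e
    using hausdorff1_segment_integral(2)[OF ne \<phi>] that by (cases e) (simp add: F_def edge_integral_def)
  have eq: "mult_ext X \<Theta> x *\<^sub>R \<phi> x = (1/2) * (\<Sum>e\<in>E. F e x)" if xV: "x \<notin> V" for x
  proof (cases "\<exists>(p, q)\<in>E. x \<in> open_segment p q")
    case True
    then obtain p q where pq: "(p, q) \<in> E" "x \<in> open_segment p q" by blast
    have qp: "(q, p) \<in> E" using pq(1) edges_commute[of p q] by (simp add: E_def)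
    have "(\<Sum>e\<in>E. F e x) = (\<Sum>e\<in>{(p, q), (q, p)}. F e x)"
    proof (rule sum.mono_neutral_right[OF finE])
      show "{(p, q), (q, p)} \<subseteq> E" using pq qp by simp
      show "\<forall>e\<in>E - {(p, q), (q, p)}. F e x = 0"
      proof
        fix e assume e: "e \<in> E - {(p, q), (q, p)}"
        then have "x \<notin> open_segment (fst e) (snd e)"
          using edge_unique[of p q V x "fst e" "snd e"] pq by (auto simp: E_def)
        then show "F e x = 0" by (simp add: F_def case_prod_beta)
      qed
    qed
    also have "\<dots> = 2 * (edge_weight \<Theta> p q * \<phi> x)"
      using ne[OF pq(1)] pq(2) by (simp add: F_def open_segment_commute[of q p] edge_weight_commute[of \<Theta> q p])
    finally show ?thesis using edge_weight_point[of p q V x] pq by (simp add: E_def)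
  next
    case False
    then have "(\<Sum>e\<in>E. F e x) = 0" by (intro sum.neutral) (auto simp: F_def)
    moreover have "mult_ext X \<Theta> x * \<phi> x = 0"
      using edges_cover[OF V, of x] False xV K[of x] mult_ext_outside[of x] by (force simp: E_def)
    ultimately show ?thesis by simp
  qed
  have ae: "AE x in hausdorff1. mult_ext X \<Theta> x *\<^sub>R \<phi> x = (1/2) * (\<Sum>e\<in>E. F e x)"
    using hausdorff1_finite_null[OF finV] eq by (auto intro: AE_I'[of V])
  have int: "integrable hausdorff1 (\<lambda>x. (1/2) * (\<Sum>e\<in>E. F e x))"
    using intF by (intro integrable_mult_right Bochner_Integration.integrable_sum) auto
  have Fm: "(\<lambda>x. mult_ext X \<Theta> x *\<^sub>R \<phi> x) \<in> borel_measurable hausdorff1" by measurable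
  have int': "integrable hausdorff1 (\<lambda>x. mult_ext X \<Theta> x *\<^sub>R \<phi> x)"
    using int ae Fm by (subst integrable_cong_AE) auto
  then show "integrable (network_measure X \<Theta>) \<phi>"
    unfolding network_measure_def using mult_ext_nonneg by (subst integrable_density) auto
  have "(\<integral>x. \<phi> x \<partial>network_measure X \<Theta>) = (\<integral>x. mult_ext X \<Theta> x *\<^sub>R \<phi> x \<partial>hausdorff1)"
    unfolding network_measure_def using mult_ext_nonneg by (subst integral_density) auto
  also have "\<dots> = (\<integral>x. (1/2) * (\<Sum>e\<in>E. F e x) \<partial>hausdorff1)"
    using int ae Fm by (intro integral_cong_AE) auto
  also have "\<dots> = (1/2) * (\<Sum>e\<in>E. (\<integral>x. F e x \<partial>hausdorff1))"
    using intF by simp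
  also have "(\<Sum>e\<in>E. (\<integral>x. F e x \<partial>hausdorff1)) = (\<Sum>(p, q)\<in>E. edge_weight \<Theta> p q * edge_integral \<phi> p q)"
    using LF by (intro sum.cong) auto
  finally show "(\<integral>x. \<phi> x \<partial>network_measure X \<Theta>)
      = (1/2) * (\<Sum>(p, q)\<in>edges X V. edge_weight \<Theta> p q * edge_integral \<phi> p q)"
    by (simp add: E_def)
qed

end

section \<open>Trapezoidal test functions\<close>

text \<open>For \<open>c \<le> d\<close> this is 1 on \<open>{c..d}\<close>, with ramps of slope 1
  over the adjacent unit intervals. It is written with positive parts because the primitive of
  \<open>max 0 (t - c)\<close> is half its square.\<close>

definition trapezoid :: "real \<Rightarrow> real \<Rightarrow> real \<Rightarrow> real" where
  "trapezoid c d t = max 0 (t - c + 1) - max 0 (t - c) - max 0 (t - d) + max 0 (t - d - 1)"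

definition trapezoid_primitive :: "real \<Rightarrow> real \<Rightarrow> real \<Rightarrow> real" where
  "trapezoid_primitive c d t =
     ((max 0 (t - c + 1))\<^sup>2 - (max 0 (t - c))\<^sup>2 - (max 0 (t - d))\<^sup>2 + (max 0 (t - d - 1))\<^sup>2) / 2"

lemma trapezoid_eq:
  assumes "c \<le> d"
  shows "trapezoid c d t = max 0 (min 1 (min (t - c + 1) (d + 1 - t)))"
proof -
  consider "t < c - 1" | "c - 1 \<le> t" "t < c" | "c \<le> t" "t \<le> d" | "d < t" "t \<le> d + 1" | "d + 1 < t"
    by linarith
  then show ?thesis using assms by cases (simp_all add: trapezoid_def)
qed

lemma trapezoid_bounds:
  assumes "c \<le> d"
  shows "0 \<le> trapezoid c d t" "trapezoid c d t \<le> 1"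
    and "t \<in> {c..d} \<Longrightarrow> trapezoid c d t = 1"
    and "t \<notin> {c - 1..d + 1} \<Longrightarrow> trapezoid c d t = 0"
proof -
  show "0 \<le> trapezoid c d t" "trapezoid c d t \<le> 1"
    unfolding trapezoid_eq[OF assms] by simp_all
  show "trapezoid c d t = 1" if "t \<in> {c..d}"
    using that by (simp add: trapezoid_eq[OF assms] min_absorb1)
  show "trapezoid c d t = 0" if "t \<notin> {c - 1..d + 1}"
  proof -
    have "t - c + 1 \<le> 0 \<or> d + 1 - t \<le> 0" using that by auto
    then have "min 1 (min (t - c + 1) (d + 1 - t)) \<le> 0" by (meson min.coboundedI1 min.coboundedI2)
    then show ?thesis unfolding trapezoid_eq[OF assms] by (rule max_absorb1)
  qed
qed

lemma trapezoid_lipschitz: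
  assumes "c \<le> d"
  shows "\<bar>trapezoid c d s - trapezoid c d t\<bar> \<le> \<bar>s - t\<bar>"
proof -
  have clamp: "\<bar>max 0 (min 1 x) - max 0 (min 1 y)\<bar> \<le> \<bar>x - y\<bar>" for x y :: real
    by (simp add: max_def min_def)
  have "\<bar>min x y - min x' y'\<bar> \<le> e" if "\<bar>x - x'\<bar> \<le> e" "\<bar>y - y'\<bar> \<le> e" for x y x' y' e :: real
    using that by linarith
  then have "\<bar>min (s - c + 1) (d + 1 - s) - min (t - c + 1) (d + 1 - t)\<bar> \<le> \<bar>s - t\<bar>" by simp
  with clamp show ?thesis unfolding trapezoid_eq[OF assms] by (rule order_trans)
qed

lemma continuous_on_trapezoid [continuous_intros]:
  "continuous_on A f \<Longrightarrow> continuous_on A (\<lambda>x. trapezoid c d (f x))"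
  unfolding trapezoid_def by (intro continuous_intros)

text \<open>At the kink the difference quotient is at most \<open>\<bar>h\<bar>\<close>, so the
  derivative exists there too.\<close>

lemma has_real_derivative_pos_part_square:
  "((\<lambda>t. (max 0 (t - c))\<^sup>2) has_real_derivative 2 * max 0 (t - c)) (at t)" for c t :: real
proof -
  consider "t < c" | "t = c" | "c < t" by linarith
  then show ?thesis
  proof cases
    case 1
    have "((\<lambda>t. 0) has_real_derivative 0) (at t)" by simp
    then have "((\<lambda>t. (max 0 (t - c))\<^sup>2) has_real_derivative 0) (at t)"
      by (rule DERIV_cong_ev[OF refl _ refl, THEN iffD1, rotated])
        (use 1 in \<open>auto simp: eventually_nhds max_def intro!: exI[of _ "{..<c}"]\<close>)
    then show ?thesis using 1 by simp
  next
    case 2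
    have "((\<lambda>h. ((max 0 (t + h - c))\<^sup>2 - (max 0 (t - c))\<^sup>2) / h) \<longlongrightarrow> 0) (at 0)"
    proof (rule Lim_null_comparison)
      show "\<forall>\<^sub>F h in at 0. norm (((max 0 (t + h - c))\<^sup>2 - (max 0 (t - c))\<^sup>2) / h) \<le> \<bar>h\<bar>"
        using 2 by (intro always_eventually allI) (auto simp: max_def power2_eq_square)
      show "((\<lambda>h. \<bar>h\<bar>) \<longlongrightarrow> 0) (at (0::real))" by (intro tendsto_rabs_zero tendsto_ident_at)
    qed
    then show ?thesis using 2 by (simp add: DERIV_def)
  next
    case 3
    have "((\<lambda>t. (t - c)\<^sup>2) has_real_derivative 2 * (t - c)) (at t)"
      by (auto intro!: derivative_eq_intros)
    then have "((\<lambda>t. (max 0 (t - c))\<^sup>2) has_real_derivative 2 * (t - c)) (at t)"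
      by (rule DERIV_cong_ev[OF refl _ refl, THEN iffD1, rotated])
        (use 3 in \<open>auto simp: eventually_nhds max_def intro!: exI[of _ "{c<..}"]\<close>)
    then show ?thesis using 3 by simp
  qed
qed

lemma trapezoid_primitive_deriv:
  "(trapezoid_primitive c d has_real_derivative trapezoid c d t) (at t)"
proof -
  have "((\<lambda>t. ((max 0 (t - (c - 1)))\<^sup>2 - (max 0 (t - c))\<^sup>2 - (max 0 (t - d))\<^sup>2 + (max 0 (t - (d + 1)))\<^sup>2) / 2)
     has_real_derivative (2 * max 0 (t - (c - 1)) - 2 * max 0 (t - c) - 2 * max 0 (t - d)
       + 2 * max 0 (t - (d + 1))) / 2) (at t)"
    by (intro DERIV_cdivide DERIV_add DERIV_diff has_real_derivative_pos_part_square)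
  then show ?thesis
    by (rule DERIV_cong_ev[OF refl _ _, THEN iffD1, rotated 2])
      (simp_all add: trapezoid_primitive_def trapezoid_def algebra_simps add_divide_distrib diff_divide_distrib)
qed

lemma trapezoid_primitive_left: "c \<le> d \<Longrightarrow> t \<le> c - 1 \<Longrightarrow> trapezoid_primitive c d t = 0"
  by (simp add: trapezoid_primitive_def)

lemma trapezoid_primitive_right: "c \<le> d \<Longrightarrow> d + 1 \<le> t \<Longrightarrow> trapezoid_primitive c d t = d - c + 1"
proof -
  assume cd: "c \<le> d" "d + 1 \<le> t"
  then have "trapezoid_primitive c d t = ((t - c + 1)\<^sup>2 - (t - c)\<^sup>2 - (t - d)\<^sup>2 + (t - d - 1)\<^sup>2) / 2"
    by (simp add: trapezoid_primitive_def)
  also have "(t - c + 1)\<^sup>2 - (t - c)\<^sup>2 - (t - d)\<^sup>2 + (t - d - 1)\<^sup>2 = 2 * (d - c + 1)"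
    by (simp add: power2_eq_square algebra_simps)
  finally show ?thesis by simp
qed

lemma trapezoid_primitive_mono: 
  assumes "c \<le> d" "s \<le> t"
  shows "trapezoid_primitive c d s \<le> trapezoid_primitive c d t"
  by (rule DERIV_nonneg_imp_nondecreasing[OF assms(2)])
    (use trapezoid_primitive_deriv trapezoid_bounds(1)[OF assms(1)] in blast)

text \<open>\<open>c\<close> will be the axial component of a unit tangent vector; dividing by it is
  the change of variables from arclength to the axial coordinate.\<close>

lemma integral_trapezoid_line:
  assumes c: "c \<noteq> 0" and l: "0 \<le> l"
  shows "(\<integral>u. indicator {0<..<l} u * trapezoid a b (t + u * c) \<partial>lborel)
    = (trapezoid_primitive a b (t + l * c) - trapezoid_primitive a b t) / c"
proof -
  have "(\<integral>u. indicator {0<..<l} u * trapezoid a b (t + u * c) \<partial>lborel)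
      = (\<integral>u. trapezoid a b (t + u * c) * indicator {0..l} u \<partial>lborel)"
  proof (rule integral_cong_AE)
    show "AE u in lborel. indicator {0<..<l} u * trapezoid a b (t + u * c) = trapezoid a b (t + u * c) * indicator {0..l} u"
      by (rule AE_I'[of "{0, l}"]) (auto intro!: finite_imp_null_set_lborel split: split_indicator)
  qed (auto simp: trapezoid_def)
  also have "\<dots> = trapezoid_primitive a b (t + l * c) / c - trapezoid_primitive a b (t + 0 * c) / c"
  proof (rule integral_FTC_Icc_real[OF l])
    fix u
    show "((\<lambda>u. trapezoid_primitive a b (t + u * c) / c) has_real_derivative trapezoid a b (t + u * c)) (at u)"
      using c by (auto intro!: derivative_eq_intros DERIV_chain2[OF trapezoid_primitive_deriv])
    show "isCont (\<lambda>u. trapezoid a b (t + u * c)) u"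
      unfolding trapezoid_def by (intro continuous_intros)
  qed
  finally show ?thesis by (simp add: diff_divide_distrib)
qed

lemma integral_trapezoid:
  assumes "a \<le> b"
  shows "(\<integral>t. trapezoid a b t \<partial>lborel) = b - a + 1"
proof -
  have "(\<integral>t. trapezoid a b t \<partial>lborel) = (\<integral>t. trapezoid a b t * indicator {a - 1..b + 1} t \<partial>lborel)"
    using trapezoid_bounds(4)[OF assms] by (intro Bochner_Integration.integral_cong) (auto split: split_indicator)
  also have "\<dots> = trapezoid_primitive a b (b + 1) - trapezoid_primitive a b (a - 1)"
  proof (rule integral_FTC_Icc_real)
    show "isCont (\<lambda>u. trapezoid a b u) u" for u
      unfolding trapezoid_def by (intro continuous_intros)
  qed (use assms trapezoid_primitive_deriv in auto)
  finally show ?thesis using assms by (simp add: trapezoid_primitive_left trapezoid_primitive_right)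
qed

section \<open>Networks confined to a narrow tube\<close>

definition slab :: "real \<Rightarrow> real \<Rightarrow> real \<Rightarrow> (real \<times> (real ^ 'm)) set" where
  "slab c d R = {c..d} \<times> cball 0 R"

lemma mem_slab: "z \<in> slab c d R \<longleftrightarrow> c \<le> fst z \<and> fst z \<le> d \<and> norm (snd z) \<le> R"
  by (cases z) (auto simp: slab_def)

lemma compact_slab: "compact (slab c d R)"
  unfolding slab_def by (intro compact_Times) auto

text \<open>A test function supported in \<open>S\<close> has no increment along an edge with both
  ends outside \<open>S\<close>; the active edges are the others.\<close>

definition active :: "'a::euclidean_space set \<Rightarrow> 'a set \<Rightarrow> 'a set \<Rightarrow> ('a \<times> 'a) set" where
  "active X V S = {(p, q) \<in> edges X V. p \<in> S \<or> q \<in> S}"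

lemma finite_active: "finite V \<Longrightarrow> finite (active X V S)"
  by (rule finite_subset[OF _ finite_edges]) (auto simp: active_def)

lemma active_edges: "(p, q) \<in> active X V S \<Longrightarrow> (p, q) \<in> edges X V"
  by (simp add: active_def)

lemma vertex_setD:
  assumes "vertex_set X K l V"
  shows "finite V" "V \<subseteq> X"
  using assms by (simp_all add: vertex_set_def)

lemma abs_fst_diff_le: "\<bar>fst q - fst p\<bar> \<le> norm (q - p)"
  for p q :: "real \<times> 'b::real_normed_vector" 
proof -
  have "norm (fst (q - p)) \<le> norm (q - p)" by (metis norm_fst_le prod.collapse)
  then show ?thesis by simp
qed

lemma norm_snd_le_add: "norm (snd y) \<le> norm (snd x) + norm (y - x)"
  for x y :: "'a::real_normed_vector \<times> 'b::real_normed_vector"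
proof -
  have "norm (snd y) \<le> norm (snd x) + norm (snd (y - x))"
    using norm_triangle_ineq[of "snd x" "snd (y - x)"] by simp
  also have "norm (snd (y - x)) \<le> norm (y - x)" by (metis norm_snd_le prod.collapse)
  finally show ?thesis by simp
qed

text \<open>The windows shrink by 1 from stage to stage: vertices are controlled for
  \<open>a - 8\<close>, confinement for \<open>a - 7\<close>, mass for \<open>a - 6\<close>, slopes
  for \<open>a - 5\<close>, single points for \<open>a - 4\<close>. A unit margin accommodates a
  ramp of a trapezoid or an edge, as \<open>l \<le> 1\<close>. The condition \<open>lR\<close>
  prevents a short edge from leading out of the narrow tube beyond radius \<open>R\<close>, where
  nothing is known about \<open>X\<close>.\<close>

locale narrow_network = isgn X \<Theta> for X :: "(real \<times> (real ^ 'm)) set" and \<Theta> +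
  fixes a b R \<rho> C l :: real
  assumes ab: "a \<le> b" and \<rho>0: "0 < \<rho>" and l0: "0 < l" and l1: "l \<le> 1" and lR: "\<rho> + 2 * l \<le> R"
    and no_leak: "\<And>z. z \<in> X \<Longrightarrow> z \<in> slab (a - 7) (b + 7) R \<Longrightarrow> norm (snd z) < \<rho>"
    and mass: "\<And>V. vertex_set X (slab (a - 8) (b + 8) (R + 2)) l V \<Longrightarrow>
      (\<Sum>(p, q)\<in>active X V (slab (a - 6) (b + 6) R). edge_weight \<Theta> p q * norm (q - p)) \<le> C"
begin

abbreviation "big_slab \<equiv> slab (a - 8) (b + 8) (R + 2)"

text \<open>An end in the slab lies in the narrow tube by \<open>no_leak\<close>. The other end is
  at most \<open>l\<close> away, hence still within radius \<open>R\<close> and in the longer slab,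
  so \<open>no_leak\<close> applies to it as well.\<close>

lemma active_ends:
  assumes V: "vertex_set X big_slab l V" and cd: "a - 6 \<le> c" "d \<le> b + 6"
    and pq: "(p, q) \<in> active X V (slab c d R)"
  shows "norm (snd p) < \<rho> \<and> norm (snd q) < \<rho> \<and> norm (q - p) \<le> l \<and>
    fst p \<in> {c - 1..d + 1} \<and> fst q \<in> {c - 1..d + 1}"
proof -
  have *: "norm (snd p) < \<rho> \<and> norm (snd q) < \<rho> \<and> norm (q - p) \<le> l \<and>
    fst p \<in> {c - 1..d + 1} \<and> fst q \<in> {c - 1..d + 1}"
    if pq: "(p, q) \<in> edges X V" and p: "p \<in> slab c d R" for p q
  proof -
    have X: "p \<in> X" "q \<in> X" using pq V by (auto simp: edges_def vertex_set_def)
    have len: "norm (q - p) \<le> l"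
      using edge_length_le[OF V pq] p cd l0 by (auto simp: mem_slab)
    have t: "\<bar>fst q - fst p\<bar> \<le> norm (q - p)" by (rule abs_fst_diff_le)
    have np: "norm (snd p) < \<rho>" using no_leak[OF X(1)] p cd by (auto simp: mem_slab)
    have "norm (snd q) \<le> R" using norm_snd_le_add[of q p] np len lR l0 by simp
    have pc: "c \<le> fst p" "fst p \<le> d" using p by (auto simp: mem_slab)
    have pq1: "\<bar>fst q - fst p\<bar> \<le> 1" using t len l1 by linarith
    have "a - 7 \<le> fst q" "fst q \<le> b + 7" using pq1 pc cd by linarith+
    then have nq: "norm (snd q) < \<rho>"
      using no_leak[OF X(2)] \<open>norm (snd q) \<le> R\<close> by (simp add: mem_slab)
    have "c - 1 \<le> fst p" "fst p \<le> d + 1" "c - 1 \<le> fst q" "fst q \<le> d + 1"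
      using pq1 pc by linarith+
    then show ?thesis using np nq len by simp
  qed
  from pq have "((p, q) \<in> edges X V \<and> p \<in> slab c d R) \<or> ((q, p) \<in> edges X V \<and> q \<in> slab c d R)"
    using edges_commute[of p q] by (auto simp: active_def)
  then show ?thesis using *[of p q] *[of q p] by (auto simp: norm_minus_commute)
qed

text \<open>Discrete Leibniz rule: along an edge the increment of the product is the mean of
  \<open>\<phi>\<close> times the increment of \<open>g\<close> plus the mean of \<open>g\<close>
  times the increment of \<open>\<phi>\<close>. The total vanishes by first variation, and the
  second part is bounded by \<open>G\<close> times length times slope, as \<open>\<phi>\<close> is
  1-Lipschitz. \<open>g\<close> may be discontinuous, as it is in \<open>flux_bound\<close>.\<close>

lemma product_test:
  assumes V: "vertex_set X big_slab l V" and cd: "a - 6 \<le> c" "d \<le> b + 6"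
    and \<phi>0: "\<And>t. t \<notin> {c..d} \<Longrightarrow> \<phi> t = 0" and \<phi>1: "\<And>s t. \<bar>\<phi> s - \<phi> t\<bar> \<le> \<bar>s - t\<bar>"
    and g: "\<And>z. norm (snd z) < \<rho> \<Longrightarrow> \<bar>g z\<bar> \<le> G"
  shows "(\<Sum>(p, q)\<in>active X V (slab c d R). edge_weight \<Theta> p q *
        ((\<phi> (fst p) + \<phi> (fst q)) / 2 * ((g q - g p) * (sgn (q - p) \<bullet> u))))
    \<le> G * (\<Sum>(p, q)\<in>active X V (slab c d R). edge_weight \<Theta> p q * (norm (q - p) * \<bar>sgn (q - p) \<bullet> u\<bar>))"
proof -
  note finV = vertex_setD(1)[OF V] and VX = vertex_setD(2)[OF V]
  define A where "A = active X V (slab c d R)"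
  \<comment> \<open>The cutoff at radius \<open>R\<close> is discontinuous, but by
    \<open>active_ends\<close> no active edge crosses it.\<close>
  define f where "f z = (if norm (snd z) \<le> R then \<phi> (fst z) * g z else 0)" for z
  have f0: "f z = 0" if "z \<notin> slab c d R" for z
    using that \<phi>0 by (auto simp: f_def mem_slab)
  have "f v = 0" if "v \<notin> big_slab" for v
    using that cd by (intro f0) (auto simp: mem_slab)
  then have "(\<Sum>(p, q)\<in>edges X V. (edge_weight \<Theta> p q * (f q - f p)) *\<^sub>R sgn (q - p)) \<bullet> u = 0"
    using first_variation[OF V, of f] by simp
  then have "0 = (\<Sum>(p, q)\<in>edges X V. (edge_weight \<Theta> p q * (f q - f p)) * (sgn (q - p) \<bullet> u))"
    by (simp add: inner_sum_left case_prod_beta)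
  also have "\<dots> = (\<Sum>(p, q)\<in>A. (edge_weight \<Theta> p q * (f q - f p)) * (sgn (q - p) \<bullet> u))"
  proof (rule sum.mono_neutral_right[OF finite_edges[OF finV]])
    show "\<forall>e\<in>edges X V - A. (case e of (p, q) \<Rightarrow> edge_weight \<Theta> p q * (f q - f p) * (sgn (q - p) \<bullet> u)) = 0"
    proof clarify
      fix p q assume "(p, q) \<in> edges X V" "(p, q) \<notin> A"
      then have "f p = 0" "f q = 0" by (auto simp: A_def active_def intro: f0)
      then show "edge_weight \<Theta> p q * (f q - f p) * (sgn (q - p) \<bullet> u) = 0" by simp
    qed
  qed (auto simp: A_def active_def)
  finally have FV: "(\<Sum>(p, q)\<in>A. (edge_weight \<Theta> p q * (f q - f p)) * (sgn (q - p) \<bullet> u)) = 0" ..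
  have term_le: "edge_weight \<Theta> p q * ((\<phi> (fst p) + \<phi> (fst q)) / 2 * ((g q - g p) * (sgn (q - p) \<bullet> u)))
      \<le> (edge_weight \<Theta> p q * (f q - f p)) * (sgn (q - p) \<bullet> u)
        + G * (edge_weight \<Theta> p q * (norm (q - p) * \<bar>sgn (q - p) \<bullet> u\<bar>))"
    if pq: "(p, q) \<in> A" for p q
  proof -
    note ends = active_ends[OF V cd pq[unfolded A_def]]
    define \<sigma> where "\<sigma> = sgn (q - p) \<bullet> u"
    define w where "w = edge_weight \<Theta> p q"
    have w: "w \<ge> 0" using edge_weight_ge_1[OF active_edges VX, of p q "slab c d R"] pq by (simp add: A_def w_def)
    have "f q - f p = \<phi> (fst q) * g q - \<phi> (fst p) * g p" using ends lR l0 by (simp add: f_def)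
    also have "\<dots> = (\<phi> (fst p) + \<phi> (fst q)) / 2 * (g q - g p) + (g p + g q) / 2 * (\<phi> (fst q) - \<phi> (fst p))"
      by (simp add: field_simps)
    finally have "(\<phi> (fst p) + \<phi> (fst q)) / 2 * (g q - g p) * \<sigma>
        = (f q - f p) * \<sigma> + - ((g p + g q) / 2 * (\<phi> (fst q) - \<phi> (fst p)) * \<sigma>)"
      by (simp add: algebra_simps)
    moreover have "- ((g p + g q) / 2 * (\<phi> (fst q) - \<phi> (fst p)) * \<sigma>) \<le> G * norm (q - p) * \<bar>\<sigma>\<bar>"
    proof -
      have "\<bar>g p\<bar> \<le> G" "\<bar>g q\<bar> \<le> G" using g ends by blast+
      then have "\<bar>(g p + g q) / 2\<bar> \<le> G" by (simp add: abs_le_iff)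
      moreover have "\<bar>\<phi> (fst q) - \<phi> (fst p)\<bar> \<le> norm (q - p)"
        using \<phi>1[of "fst q" "fst p"] abs_fst_diff_le[of q p] by linarith
      ultimately have "\<bar>(g p + g q) / 2\<bar> * \<bar>\<phi> (fst q) - \<phi> (fst p)\<bar> * \<bar>\<sigma>\<bar> \<le> G * norm (q - p) * \<bar>\<sigma>\<bar>"
        by (intro mult_right_mono mult_mono) auto
      then have "\<bar>(g p + g q) / 2 * (\<phi> (fst q) - \<phi> (fst p)) * \<sigma>\<bar> \<le> G * norm (q - p) * \<bar>\<sigma>\<bar>"
        by (simp only: abs_mult)
      then show ?thesis by (rule order_trans[OF abs_ge_minus_self])
    qed
    ultimately have "(\<phi> (fst p) + \<phi> (fst q)) / 2 * (g q - g p) * \<sigma> \<le> (f q - f p) * \<sigma> + G * norm (q - p) * \<bar>\<sigma>\<bar>"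
      by linarith
    from mult_left_mono[OF this w]
    have "w * ((\<phi> (fst p) + \<phi> (fst q)) / 2 * ((g q - g p) * \<sigma>))
        \<le> w * (f q - f p) * \<sigma> + G * (w * (norm (q - p) * \<bar>\<sigma>\<bar>))"
      by (simp only: mult.assoc distrib_left mult.left_commute[of w G])
    then show ?thesis unfolding \<sigma>_def w_def .
  qed
  have "(\<Sum>(p, q)\<in>A. edge_weight \<Theta> p q * ((\<phi> (fst p) + \<phi> (fst q)) / 2 * ((g q - g p) * (sgn (q - p) \<bullet> u))))
      \<le> (\<Sum>(p, q)\<in>A. (edge_weight \<Theta> p q * (f q - f p)) * (sgn (q - p) \<bullet> u)
        + G * (edge_weight \<Theta> p q * (norm (q - p) * \<bar>sgn (q - p) \<bullet> u\<bar>)))"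
    using term_le by (intro sum_mono) (simp only: split_paired_all prod.case)
  also have "\<dots> = (\<Sum>(p, q)\<in>A. (edge_weight \<Theta> p q * (f q - f p)) * (sgn (q - p) \<bullet> u))
     + G * (\<Sum>(p, q)\<in>A. edge_weight \<Theta> p q * (norm (q - p) * \<bar>sgn (q - p) \<bullet> u\<bar>))"
    by (simp add: case_prod_beta sum.distrib sum_distrib_left)
  finally show ?thesis unfolding FV unfolding A_def add_0_left .
qed

lemma active_weight_ge_1:
  assumes "vertex_set X K l V" "(p, q) \<in> active X V S"
  shows "edge_weight \<Theta> p q \<ge> 1"
  by (rule edge_weight_ge_1[OF active_edges[OF assms(2)] vertex_setD(2)[OF assms(1)]])

text \<open>Here \<open>g\<close> is the coordinate \<open>z \<bullet> (0, e)\<close>, at most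
  \<open>\<rho>\<close> in the tube; its increment times the slope is length times squared
  slope.\<close>

lemma tilt_square_bound:
  fixes e :: "real ^ 'm"
  assumes V: "vertex_set X big_slab l V" and e: "norm e = 1"
  shows "(\<Sum>(p, q)\<in>active X V (slab (a - 5) (b + 5) R). edge_weight \<Theta> p q * (norm (q - p) * (sgn (q - p) \<bullet> (0, e))\<^sup>2))
    \<le> 2 * \<rho> * C"
proof -
  define A where "A = active X V (slab (a - 6) (b + 6) R)"
  define B where "B = active X V (slab (a - 5) (b + 5) R)"
  define \<phi> where "\<phi> = trapezoid (a - 5) (b + 5)"
  have ab5: "a - 5 \<le> b + 5" using ab by simp
  note \<phi> = trapezoid_bounds[OF ab5, folded \<phi>_def]
  have finA: "finite A" unfolding A_def by (intro finite_active vertex_setD(1)[OF V])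
  have BA: "B \<subseteq> A" by (auto simp: A_def B_def active_def mem_slab)
  have w: "edge_weight \<Theta> p q \<ge> 1" if "(p, q) \<in> A" for p q
    using active_weight_ge_1[OF V] that unfolding A_def by blast
  have unit: "norm (0 :: real, e) = 1" using e by (simp add: norm_Pair)
  have "(\<Sum>(p, q)\<in>B. edge_weight \<Theta> p q * (norm (q - p) * (sgn (q - p) \<bullet> (0, e))\<^sup>2))
     \<le> (\<Sum>(p, q)\<in>B. 2 * (edge_weight \<Theta> p q *
        ((\<phi> (fst p) + \<phi> (fst q)) / 2 * ((q \<bullet> (0, e) - p \<bullet> (0, e)) * (sgn (q - p) \<bullet> (0, e))))))"
  proof (intro sum_mono, clarify)
    fix p q assume pq: "(p, q) \<in> B"
    define s where "s = sgn (q - p) \<bullet> (0, e)"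
    have "q \<bullet> (0, e) - p \<bullet> (0, e) = norm (q - p) * s"
      unfolding s_def by (metis inner_diff_left inner_scaleR_left scaleR_norm_sgn)
    then have eq: "(q \<bullet> (0, e) - p \<bullet> (0, e)) * s = norm (q - p) * s\<^sup>2" by (simp add: power2_eq_square)
    \<comment> \<open>An edge in \<open>B\<close> has an end where \<open>\<phi>\<close> is 1, so
      the mean of \<open>\<phi>\<close> is at least 1/2; this is the origin of the factor 2.\<close>
    have "\<phi> (fst p) + \<phi> (fst q) \<ge> 1"
      using pq \<phi>(1)[of "fst p"] \<phi>(1)[of "fst q"] \<phi>(3)[of "fst p"] \<phi>(3)[of "fst q"]
      by (auto simp: B_def active_def mem_slab)
    then have "1 * (edge_weight \<Theta> p q * (norm (q - p) * s\<^sup>2)) \<le> (\<phi> (fst p) + \<phi> (fst q)) * (edge_weight \<Theta> p q * (norm (q - p) * s\<^sup>2))"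
      using w[of p q] pq BA by (intro mult_right_mono mult_nonneg_nonneg) auto
    then show "edge_weight \<Theta> p q * (norm (q - p) * (sgn (q - p) \<bullet> (0, e))\<^sup>2) \<le> 2 * (edge_weight \<Theta> p q *
        ((\<phi> (fst p) + \<phi> (fst q)) / 2 * ((q \<bullet> (0, e) - p \<bullet> (0, e)) * (sgn (q - p) \<bullet> (0, e)))))"
      unfolding s_def[symmetric] eq by (simp add: algebra_simps)
  qed
  \<comment> \<open>All terms are nonnegative, so the sum may be extended to the edges that meet the
    full support of \<open>\<phi>\<close>, as \<open>product_test\<close> demands.\<close>
  also have "\<dots> \<le> (\<Sum>(p, q)\<in>A. 2 * (edge_weight \<Theta> p q *
        ((\<phi> (fst p) + \<phi> (fst q)) / 2 * ((q \<bullet> (0, e) - p \<bullet> (0, e)) * (sgn (q - p) \<bullet> (0, e))))))"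
  proof (rule sum_mono2[OF finA BA], clarify)
    fix p q assume "(p, q) \<in> A"
    have "q \<bullet> (0, e) - p \<bullet> (0, e) = norm (q - p) * (sgn (q - p) \<bullet> (0, e))"
      by (metis inner_diff_left inner_scaleR_left scaleR_norm_sgn)
    then have "(q \<bullet> (0, e) - p \<bullet> (0, e)) * (sgn (q - p) \<bullet> (0, e)) \<ge> 0" by (simp add: mult.assoc)
    then show "0 \<le> 2 * (edge_weight \<Theta> p q *
        ((\<phi> (fst p) + \<phi> (fst q)) / 2 * ((q \<bullet> (0, e) - p \<bullet> (0, e)) * (sgn (q - p) \<bullet> (0, e)))))"
      using w[OF \<open>(p, q) \<in> A\<close>] \<phi>(1)
      by (intro mult_nonneg_nonneg[OF _ mult_nonneg_nonneg[OF _ mult_nonneg_nonneg]]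
          divide_nonneg_nonneg add_nonneg_nonneg) auto
  qed
  also have "\<dots> = 2 * (\<Sum>(p, q)\<in>A. edge_weight \<Theta> p q *
        ((\<phi> (fst p) + \<phi> (fst q)) / 2 * ((q \<bullet> (0, e) - p \<bullet> (0, e)) * (sgn (q - p) \<bullet> (0, e)))))"
    by (simp add: sum_distrib_left case_prod_beta)
  also have "\<dots> \<le> 2 * (\<rho> * (\<Sum>(p, q)\<in>A. edge_weight \<Theta> p q * (norm (q - p) * \<bar>sgn (q - p) \<bullet> (0, e)\<bar>)))"
    unfolding A_def
  proof (intro mult_left_mono product_test[OF V, where g = "\<lambda>z. z \<bullet> (0, e)"])
    show "\<phi> t = 0" if "t \<notin> {a - 6..b + 6}" for t using \<phi>(4)[of t] that by (auto simp: add.commute)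
    show "\<bar>\<phi> s - \<phi> t\<bar> \<le> \<bar>s - t\<bar>" for s t unfolding \<phi>_def by (rule trapezoid_lipschitz[OF ab5])
    fix z :: "real \<times> (real ^ 'm)" assume "norm (snd z) < \<rho>"
    moreover have "\<bar>z \<bullet> (0, e)\<bar> \<le> norm (snd z)"
      using Cauchy_Schwarz_ineq2[of "snd z" e] e by (cases z) simp
    ultimately show "\<bar>z \<bullet> (0, e)\<bar> \<le> \<rho>" by simp
  qed auto
  also have "\<dots> \<le> 2 * (\<rho> * (\<Sum>(p, q)\<in>A. edge_weight \<Theta> p q * norm (q - p)))"
  proof (intro mult_left_mono sum_mono, clarify)
    fix p q assume "(p, q) \<in> A"
    have "\<bar>sgn (q - p) \<bullet> (0, e)\<bar> \<le> norm (sgn (q - p)) * norm (0 :: real, e)"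
      by (rule Cauchy_Schwarz_ineq2)
    also have "\<dots> \<le> 1" unfolding unit by (simp add: norm_sgn)
    finally have "norm (q - p) * \<bar>sgn (q - p) \<bullet> (0, e)\<bar> \<le> norm (q - p)" by (simp add: mult_left_le)
    then show "edge_weight \<Theta> p q * (norm (q - p) * \<bar>sgn (q - p) \<bullet> (0, e)\<bar>) \<le> edge_weight \<Theta> p q * norm (q - p)"
      using w[OF \<open>(p, q) \<in> A\<close>] by (intro mult_left_mono) auto
  qed (use \<rho>0 in auto)
  also have "\<dots> \<le> 2 * (\<rho> * C)"
    using mass[OF V] \<rho>0 by (intro mult_left_mono) (auto simp: A_def)
  finally show ?thesis by (simp add: B_def)
qed

text \<open>Weighted Cauchy--Schwarz, in the form \<open>x \<le> \<kappa> / 2 + x\<^sup>2 / (2 * \<kappa>)\<close> with \<open>\<kappa> = sqrt (2 * \<rho>)\<close>.\<close>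

lemma tilt_bound:
  fixes e :: "real ^ 'm"
  assumes V: "vertex_set X big_slab l V" and e: "norm e = 1"
  shows "(\<Sum>(p, q)\<in>active X V (slab (a - 5) (b + 5) R). edge_weight \<Theta> p q * (norm (q - p) * \<bar>sgn (q - p) \<bullet> (0, e)\<bar>))
    \<le> C * sqrt (2 * \<rho>)"
proof -
  define \<kappa> where "\<kappa> = sqrt (2 * \<rho>)"
  have \<kappa>: "\<kappa> > 0" "\<kappa>\<^sup>2 = 2 * \<rho>" using \<rho>0 by (simp_all add: \<kappa>_def)
  define A where "A = active X V (slab (a - 6) (b + 6) R)"
  define B where "B = active X V (slab (a - 5) (b + 5) R)"
  have finA: "finite A" unfolding A_def by (intro finite_active vertex_setD(1)[OF V])
  have BA: "B \<subseteq> A" by (auto simp: A_def B_def active_def mem_slab)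
  have w: "edge_weight \<Theta> p q \<ge> 1" if "(p, q) \<in> A" for p q
    using active_weight_ge_1[OF V] that unfolding A_def by blast
  have "(\<Sum>(p, q)\<in>B. edge_weight \<Theta> p q * norm (q - p)) \<le> (\<Sum>(p, q)\<in>A. edge_weight \<Theta> p q * norm (q - p))"
    by (rule sum_mono2[OF finA BA]) (auto intro!: mult_nonneg_nonneg order_trans[OF zero_le_one w])
  also have "\<dots> \<le> C" unfolding A_def by (rule mass[OF V])
  finally have massB: "(\<Sum>(p, q)\<in>B. edge_weight \<Theta> p q * norm (q - p)) \<le> C" .
  have amgm: "\<bar>x\<bar> \<le> \<kappa> / 2 + x\<^sup>2 / (2 * \<kappa>)" for x :: real
  proof -
    have "0 \<le> (\<bar>x\<bar> - \<kappa>)\<^sup>2" by simp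
    then have "2 * \<kappa> * \<bar>x\<bar> \<le> \<kappa>\<^sup>2 + x\<^sup>2" by (simp add: power2_diff algebra_simps)
    then show ?thesis using \<kappa>(1) by (simp add: field_simps power2_eq_square)
  qed
  have "(\<Sum>(p, q)\<in>B. edge_weight \<Theta> p q * (norm (q - p) * \<bar>sgn (q - p) \<bullet> (0, e)\<bar>))
    \<le> (\<Sum>(p, q)\<in>B. edge_weight \<Theta> p q * (norm (q - p) * (\<kappa> / 2 + (sgn (q - p) \<bullet> (0, e))\<^sup>2 / (2 * \<kappa>))))"
  proof (intro sum_mono, clarify)
    fix p q assume "(p, q) \<in> B"
    then have "edge_weight \<Theta> p q \<ge> 1" using w BA by blast
    then show "edge_weight \<Theta> p q * (norm (q - p) * \<bar>sgn (q - p) \<bullet> (0, e)\<bar>)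
      \<le> edge_weight \<Theta> p q * (norm (q - p) * (\<kappa> / 2 + (sgn (q - p) \<bullet> (0, e))\<^sup>2 / (2 * \<kappa>)))"
      using amgm by (intro mult_left_mono) auto
  qed
  also have "\<dots> = (\<kappa> / 2) * (\<Sum>(p, q)\<in>B. edge_weight \<Theta> p q * norm (q - p))
      + (1 / (2 * \<kappa>)) * (\<Sum>(p, q)\<in>B. edge_weight \<Theta> p q * (norm (q - p) * (sgn (q - p) \<bullet> (0, e))\<^sup>2))"
    by (simp add: sum_distrib_left sum.distrib[symmetric] case_prod_beta algebra_simps)
  also have "\<dots> \<le> (\<kappa> / 2) * C + (1 / (2 * \<kappa>)) * (2 * \<rho> * C)"
    using massB tilt_square_bound[OF V e] \<kappa> unfolding B_def by (intro add_mono mult_left_mono) auto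
  also have "\<dots> = C * \<kappa>"
    using \<kappa>(1) unfolding \<kappa>(2)[symmetric] by (simp add: field_simps power2_eq_square)
  finally show ?thesis by (simp add: B_def \<kappa>_def)
qed

text \<open>
  Testing with a step function of \<open>z \<bullet> u\<close> that jumps at \<open>z\<^sub>0\<close> bounds the flux through \<open>z\<^sub>0\<close>.
\<close>

lemma flux_bound:
  assumes V: "vertex_set X big_slab l V" and z: "z \<in> V" "fst z \<in> {a - 4..b + 4}" "norm (snd z) \<le> R"
  shows "(\<Sum>s\<in>{s \<in> directions X z. s \<bullet> u > 0}. edge_mult \<Theta> z s * (s \<bullet> u))
    \<le> 2 * (\<Sum>(p, q)\<in>active X V (slab (a - 5) (b + 5) R). edge_weight \<Theta> p q * (norm (q - p) * \<bar>sgn (q - p) \<bullet> u\<bar>))"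
proof -
  define B where "B = active X V (slab (a - 5) (b + 5) R)"
  define \<phi> where "\<phi> = trapezoid (a - 4) (b + 4)"
  have ab4: "a - 4 \<le> b + 4" using ab by simp
  note \<phi> = trapezoid_bounds[OF ab4, folded \<phi>_def]
  define g where "g y = (if z \<bullet> u < y \<bullet> u then 1 else 0 :: real)" for y
  define F where "F = (\<lambda>(p, q). edge_weight \<Theta> p q * ((\<phi> (fst p) + \<phi> (fst q)) / 2 * ((g q - g p) * (sgn (q - p) \<bullet> u))))"
  have finV: "finite V" and zX: "z \<in> X" using V z(1) by (auto simp: vertex_set_def)
  have finB: "finite B" unfolding B_def using finV by (rule finite_active)
  have w: "edge_weight \<Theta> p q \<ge> 1" if "(p, q) \<in> B" for p q
    using active_weight_ge_1[OF V] that unfolding B_def by blast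
  have zbig: "z \<in> big_slab" using z by (auto simp: mem_slab)
  have du: "q \<bullet> u = p \<bullet> u + norm (q - p) * (sgn (q - p) \<bullet> u)" for p q
    by (metis add_diff_cancel_left' diff_add_cancel inner_add_left inner_scaleR_left scaleR_norm_sgn)
  define Q where "Q = {q. (z, q) \<in> edges X V}"
  have finQ: "finite Q" by (rule finite_subset[OF _ finV]) (auto simp: Q_def edges_def)
  \<comment> \<open>\<open>g\<close> is nondecreasing in \<open>y \<bullet> u\<close>, so its
    increment never has the sign opposite to the slope. With all terms nonnegative, those of the
    edges at \<open>z\<close> can be singled out.\<close>
  have Fnn: "F (p, q) \<ge> 0" if pq: "(p, q) \<in> B" for p q
  proof -
    have "(g q - g p) * (sgn (q - p) \<bullet> u) \<ge> 0"
    proof (cases "sgn (q - p) \<bullet> u \<ge> 0")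
      case True
      then have "p \<bullet> u \<le> q \<bullet> u" unfolding du[of q p] by simp
      then have "g p \<le> g q" by (auto simp: g_def)
      then show ?thesis using True by simp
    next
      case False
      then have "q \<bullet> u \<le> p \<bullet> u" unfolding du[of q p] by (simp add: mult_nonneg_nonpos)
      then have "g q \<le> g p" by (auto simp: g_def)
      then show ?thesis using False by (intro mult_nonpos_nonpos) auto
    qed
    then show ?thesis unfolding F_def prod.case using w[OF pq] \<phi>(1)
      by (intro mult_nonneg_nonneg[OF _ mult_nonneg_nonneg]
          divide_nonneg_nonneg add_nonneg_nonneg) auto
  qed
  have "(\<Sum>s\<in>{s \<in> directions X z. s \<bullet> u > 0}. edge_mult \<Theta> z s * (s \<bullet> u))
      = (\<Sum>s\<in>directions X z. edge_mult \<Theta> z s * max 0 (s \<bullet> u))"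
    using finite_directions[OF zX] by (intro sum.mono_neutral_cong_left) (auto simp: max_def)
  also have "\<dots> = (\<Sum>q\<in>Q. edge_weight \<Theta> z q * max 0 (sgn (q - z) \<bullet> u))"
    unfolding Q_def by (rule sum_directions[OF V z(1) zbig, of "\<lambda>c s. c * max 0 (s \<bullet> u)"])
  \<comment> \<open>\<open>\<phi>\<close> is 1 at \<open>z\<close>, so its mean over an edge at
    \<open>z\<close> is at least 1/2, and along every edge with positive slope \<open>g\<close>
    jumps from 0 to 1, however short the edge is.\<close>
  also have "\<dots> \<le> (\<Sum>q\<in>Q. 2 * F (z, q))"
  proof (rule sum_mono)
    fix q assume "q \<in> Q"
    then have zq: "(z, q) \<in> edges X V" by (simp add: Q_def)
    then have zB: "(z, q) \<in> B" using z by (auto simp: B_def active_def mem_slab)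
    show "edge_weight \<Theta> z q * max 0 (sgn (q - z) \<bullet> u) \<le> 2 * F (z, q)"
    proof (cases "sgn (q - z) \<bullet> u > 0")
      case True
      have "z \<noteq> q" using zq by (auto simp: edges_def)
      then have "z \<bullet> u < q \<bullet> u" using du[of q z] True by simp
      then have "g q - g z = 1" by (simp add: g_def)
      moreover have "1 * (edge_weight \<Theta> z q * (sgn (q - z) \<bullet> u)) \<le> (\<phi> (fst z) + \<phi> (fst q)) * (edge_weight \<Theta> z q * (sgn (q - z) \<bullet> u))"
        using \<phi>(3)[OF z(2)] \<phi>(1)[of "fst q"] w[OF zB] True by (intro mult_right_mono) auto
      ultimately show ?thesis using True by (simp add: F_def mult.assoc mult.left_commute)
    qed (use Fnn[OF zB] in auto)
  qed
  also have "\<dots> = 2 * (\<Sum>e\<in>Pair z ` Q. F e)"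
    by (simp add: sum.reindex inj_on_def sum_distrib_left)
  also have "\<dots> \<le> 2 * (\<Sum>e\<in>B. F e)"
  proof (intro mult_left_mono sum_mono2[OF finB])
    show "Pair z ` Q \<subseteq> B" using z by (auto simp: Q_def B_def active_def mem_slab)
  qed (use Fnn in auto)
  also have "\<dots> \<le> 2 * (1 * (\<Sum>(p, q)\<in>B. edge_weight \<Theta> p q * (norm (q - p) * \<bar>sgn (q - p) \<bullet> u\<bar>)))"
    unfolding B_def F_def
  proof (intro mult_left_mono product_test[OF V])
    show "\<phi> t = 0" if "t \<notin> {a - 5..b + 5}" for t using \<phi>(4)[of t] that by (auto simp: add.commute)
    show "\<bar>\<phi> s - \<phi> t\<bar> \<le> \<bar>s - t\<bar>" for s t unfolding \<phi>_def by (rule trapezoid_lipschitz[OF ab4])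
  qed (auto simp: g_def)
  finally show ?thesis by (simp add: B_def)
qed

end

section \<open>From averaged slopes to flatness at every point\<close>

lemma inner_E1: "s \<bullet> E1 = fst s"
  by (cases s) (simp add: E1_def)

text \<open>For \<open>\<rho> < R\<close> the radial factor is 1 on the narrow tube and 0 from
  radius \<open>R\<close> on, so on a confined network only the trapezoid is felt.\<close>

definition tube_test :: "real \<Rightarrow> real \<Rightarrow> real \<Rightarrow> real \<Rightarrow> real \<times> (real ^ 'm) \<Rightarrow> real" where
  "tube_test a b R \<rho> z = trapezoid a b (fst z) * max 0 (min 1 ((R - norm (snd z)) / (R - \<rho>)))"

lemma continuous_tube_test: "continuous_on A (tube_test a b R \<rho>)"
proof (cases "R = \<rho>")
  case True
  then show ?thesis unfolding tube_test_def[abs_def] by (simp add: continuous_intros)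
next
  case False
  then show ?thesis unfolding tube_test_def[abs_def] by (intro continuous_intros) auto
qed

lemma tube_test_support:
  assumes "a \<le> b" "\<rho> < R" "tube_test a b R \<rho> z \<noteq> 0"
  shows "fst z \<in> {a - 1..b + 1} \<and> norm (snd z) < R"
proof -
  have "trapezoid a b (fst z) \<noteq> 0" "\<not> (R - norm (snd z)) / (R - \<rho>) \<le> 0"
    using assms(3) by (auto simp: tube_test_def)
  then show ?thesis using trapezoid_bounds(4)[OF assms(1)] assms(2) by (auto simp: divide_le_0_iff)
qed

context narrow_network
begin

lemma vertex_set_point:
  assumes "z \<in> X"
  obtains V where "vertex_set X big_slab l V" "z \<in> V"
  using vertex_set_exists[OF compact_slab[of "a - 8" "b + 8" "R + 2"] l0, of "{z}"] assms by auto

text \<open>All terms of the flux are nonnegative and multiplicities are at least 1, so the flux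
  bound holds for each direction by itself. Taking for \<open>e\<close> plus and minus the
  coordinate vectors bounds every coordinate, and the sum of the coordinates dominates the norm,
  whence \<open>CARD('m)\<close>.\<close>

lemma direction_tilt:
  assumes z: "z \<in> X" "fst z \<in> {a - 4..b + 4}" "norm (snd z) \<le> R" and s: "s \<in> directions X z"
  shows "norm (snd s) \<le> real CARD('m) * (2 * C * sqrt (2 * \<rho>))"
proof -
  obtain V where V: "vertex_set X big_slab l V" "z \<in> V" using vertex_set_point[OF z(1)] by blast
  have comp: "s \<bullet> (0, e) \<le> 2 * C * sqrt (2 * \<rho>)" if e: "norm e = 1" for e :: "real ^ 'm"
  proof -
    define D where "D = {s \<in> directions X z. s \<bullet> (0, e) > 0}"
    have nn: "edge_mult \<Theta> z s' * (s' \<bullet> (0, e)) \<ge> 0" if "s' \<in> D" for s'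
      using that edge_mult_ge_1[OF z(1), of s'] by (auto simp: D_def intro!: mult_nonneg_nonneg)
    have le: "(\<Sum>s'\<in>D. edge_mult \<Theta> z s' * (s' \<bullet> (0, e))) \<le> 2 * C * sqrt (2 * \<rho>)"
      using flux_bound[OF V(1,2) z(2,3), of "(0, e)"] tilt_bound[OF V(1) e] by (simp add: D_def)
    show ?thesis
    proof (cases "s \<in> D")
      case True
      have "1 * (s \<bullet> (0, e)) \<le> edge_mult \<Theta> z s * (s \<bullet> (0, e))"
        using True edge_mult_ge_1[OF z(1) s] by (intro mult_right_mono) (auto simp: D_def)
      also have "\<dots> \<le> (\<Sum>s'\<in>D. edge_mult \<Theta> z s' * (s' \<bullet> (0, e)))"
        using nn finite_directions[OF z(1)] True by (intro member_le_sum) (auto simp: D_def)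
      finally show ?thesis using le by simp
    next
      case False
      then have "s \<bullet> (0, e) \<le> 0" using s by (simp add: D_def)
      also have "0 \<le> (\<Sum>s'\<in>D. edge_mult \<Theta> z s' * (s' \<bullet> (0, e)))" using nn by (rule sum_nonneg)
      finally show ?thesis using le by simp
    qed
  qed
  have "\<bar>snd s $ i\<bar> \<le> 2 * C * sqrt (2 * \<rho>)" for i
  proof -
    have "s \<bullet> (0, axis i 1) = snd s $ i" "s \<bullet> (0, - axis i 1) = - (snd s $ i)"
      by (cases s; simp add: inner_axis)+
    then show ?thesis using comp[of "axis i 1"] comp[of "- axis i 1"] by (simp add: abs_le_iff)
  qed
  then have "(\<Sum>i\<in>UNIV. \<bar>snd s $ i\<bar>) \<le> (\<Sum>i\<in>(UNIV :: 'm set). 2 * C * sqrt (2 * \<rho>))"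
    by (intro sum_mono)
  then show ?thesis using norm_le_l1_cart[of "snd s"] by simp
qed

text \<open>Slopes are at most 1, so the mass bound limits the axial flux through a point, and with
  it the multiplicity that can meet there. Integrality can be exploited only because of this
  limit.\<close>

lemma axial_flux_bound:
  assumes z: "z \<in> X" "fst z \<in> {a - 4..b + 4}" "norm (snd z) \<le> R"
  shows "(\<Sum>s\<in>{s \<in> directions X z. s \<bullet> E1 > 0}. edge_mult \<Theta> z s * (s \<bullet> E1)) \<le> 2 * C"
proof -
  obtain V where V: "vertex_set X big_slab l V" "z \<in> V" using vertex_set_point[OF z(1)] by blast
  define A where "A = active X V (slab (a - 6) (b + 6) R)"
  define B where "B = active X V (slab (a - 5) (b + 5) R)"
  have finA: "finite A" unfolding A_def by (intro finite_active vertex_setD(1)[OF V(1)])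
  have BA: "B \<subseteq> A" by (auto simp: A_def B_def active_def mem_slab)
  have w: "edge_weight \<Theta> p q \<ge> 1" if "(p, q) \<in> A" for p q
    using active_weight_ge_1[OF V(1)] that unfolding A_def by blast
  have "(\<Sum>(p, q)\<in>B. edge_weight \<Theta> p q * (norm (q - p) * \<bar>sgn (q - p) \<bullet> E1\<bar>))
     \<le> (\<Sum>(p, q)\<in>B. edge_weight \<Theta> p q * norm (q - p))"
  proof (intro sum_mono, clarify)
    fix p q assume pq: "(p, q) \<in> B"
    have "\<bar>sgn (q - p) \<bullet> E1\<bar> \<le> norm (sgn (q - p)) * norm (E1 :: real \<times> (real ^ 'm))"
      by (rule Cauchy_Schwarz_ineq2)
    also have "\<dots> \<le> 1" by (simp add: norm_sgn E1_def norm_Pair)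
    finally have "norm (q - p) * \<bar>sgn (q - p) \<bullet> E1\<bar> \<le> norm (q - p)" by (simp add: mult_left_le)
    moreover have "edge_weight \<Theta> p q \<ge> 1" using w pq BA by blast
    ultimately show "edge_weight \<Theta> p q * (norm (q - p) * \<bar>sgn (q - p) \<bullet> E1\<bar>) \<le> edge_weight \<Theta> p q * norm (q - p)"
      by (intro mult_left_mono) auto
  qed
  also have "\<dots> \<le> (\<Sum>(p, q)\<in>A. edge_weight \<Theta> p q * norm (q - p))"
    by (rule sum_mono2[OF finA BA]) (auto intro!: mult_nonneg_nonneg order_trans[OF zero_le_one w])
  also have "\<dots> \<le> C" unfolding A_def by (rule mass[OF V(1)])
  finally show ?thesis using flux_bound[OF V z(2,3), of E1] by (simp add: B_def)
qed

end

text \<open>\<open>c\<close> is a lower bound for the axial component of unit tangents, obtained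
  from \<open>tilt\<close> and \<open>direction_tilt\<close>. \<open>C_small\<close> keeps the error
  in passing from axial flux, which is at most \<open>2 * C\<close>, to multiplicity below
  1.\<close>

locale flat_network = narrow_network X \<Theta> a b R \<rho> C l
  for X :: "(real \<times> (real ^ 'm)) set" and \<Theta> a b R \<rho> C l +
  fixes c :: real
  assumes c0: "0 < c" and tilt: "(real CARD('m) * (2 * C * sqrt (2 * \<rho>)))\<^sup>2 \<le> 1 - c"
    and C_small: "2 * C * (1 / c - 1) < 1"
begin

lemma direction_flat:
  assumes z: "z \<in> X" "fst z \<in> {a - 4..b + 4}" "norm (snd z) \<le> R" and s: "s \<in> directions X z"
  shows "c \<le> \<bar>fst s\<bar>" "\<bar>fst s\<bar> \<le> 1"
proof -
  have "(norm s)\<^sup>2 = (fst s)\<^sup>2 + (norm (snd s))\<^sup>2"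
    by (simp add: norm_prod_def)
  then have 1: "(fst s)\<^sup>2 + (norm (snd s))\<^sup>2 = 1" using directions_norm[OF s] by simp
  have "(norm (snd s))\<^sup>2 \<le> (real CARD('m) * (2 * C * sqrt (2 * \<rho>)))\<^sup>2"
    by (intro power_mono direction_tilt[OF assms]) auto
  then have c: "c \<le> (fst s)\<^sup>2" using 1 tilt by linarith
  have "(fst s)\<^sup>2 \<le> 1" using 1 zero_le_power2[of "norm (snd s)"] by linarith
  then show le1: "\<bar>fst s\<bar> \<le> 1" by (simp add: abs_square_le_1)
  \<comment> \<open>As \<open>\<bar>fst s\<bar> \<le> 1\<close>, its square is the smaller number,
    so the bound on the square passes to the absolute value without a root.\<close>
  have "(fst s)\<^sup>2 = \<bar>fst s\<bar> * \<bar>fst s\<bar>" by (simp add: power2_eq_square)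
  also have "\<dots> \<le> \<bar>fst s\<bar> * 1" using le1 by (intro mult_left_mono) auto
  finally show "c \<le> \<bar>fst s\<bar>" using c by simp
qed

lemma c1: "c \<le> 1" 
  using tilt zero_le_power2[of "real CARD('m) * (2 * C * sqrt (2 * \<rho>))"] by linarith

lemma axial_flux:
  assumes z: "z \<in> X" "fst z \<in> {a - 4..b + 4}" "norm (snd z) \<le> R"
  shows "c * right_mult X \<Theta> z \<le> (\<Sum>s\<in>{s \<in> directions X z. s \<bullet> E1 > 0}. edge_mult \<Theta> z s * (s \<bullet> E1))"
    and "(\<Sum>s\<in>{s \<in> directions X z. s \<bullet> E1 > 0}. edge_mult \<Theta> z s * (s \<bullet> E1)) \<le> right_mult X \<Theta> z"
    and "c * left_mult X \<Theta> z \<le> (\<Sum>s\<in>{s \<in> directions X z. s \<bullet> E1 < 0}. edge_mult \<Theta> z s * - (s \<bullet> E1))"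
    and "(\<Sum>s\<in>{s \<in> directions X z. s \<bullet> E1 < 0}. edge_mult \<Theta> z s * - (s \<bullet> E1)) \<le> left_mult X \<Theta> z"
proof -
  have *: "c * edge_mult \<Theta> z s \<le> edge_mult \<Theta> z s * \<bar>s \<bullet> E1\<bar>" "edge_mult \<Theta> z s * \<bar>s \<bullet> E1\<bar> \<le> edge_mult \<Theta> z s"
    if s: "s \<in> directions X z" for s
  proof -
    have m: "edge_mult \<Theta> z s \<ge> 0" using edge_mult_ge_1[OF z(1) s] by simp
    show "c * edge_mult \<Theta> z s \<le> edge_mult \<Theta> z s * \<bar>s \<bullet> E1\<bar>"
      using mult_right_mono[OF direction_flat(1)[OF z s] m] by (simp add: inner_E1 mult.commute)
    show "edge_mult \<Theta> z s * \<bar>s \<bullet> E1\<bar> \<le> edge_mult \<Theta> z s"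
      using mult_left_mono[OF direction_flat(2)[OF z s] m] by (simp add: inner_E1)
  qed
  show "c * right_mult X \<Theta> z \<le> (\<Sum>s\<in>{s \<in> directions X z. s \<bullet> E1 > 0}. edge_mult \<Theta> z s * (s \<bullet> E1))"
    unfolding right_mult_def sum_distrib_left using *(1) by (intro sum_mono) force
  show "(\<Sum>s\<in>{s \<in> directions X z. s \<bullet> E1 > 0}. edge_mult \<Theta> z s * (s \<bullet> E1)) \<le> right_mult X \<Theta> z"
    unfolding right_mult_def using *(2) by (intro sum_mono) force
  show "c * left_mult X \<Theta> z \<le> (\<Sum>s\<in>{s \<in> directions X z. s \<bullet> E1 < 0}. edge_mult \<Theta> z s * - (s \<bullet> E1))"
    unfolding left_mult_def sum_distrib_left using *(1) by (intro sum_mono) force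
  show "(\<Sum>s\<in>{s \<in> directions X z. s \<bullet> E1 < 0}. edge_mult \<Theta> z s * - (s \<bullet> E1)) \<le> left_mult X \<Theta> z"
    unfolding left_mult_def using *(2) by (intro sum_mono) force
qed

lemma sum_directions_split:
  fixes F :: "_ \<Rightarrow> real"
  assumes z: "z \<in> X" and F: "\<And>s. s \<in> directions X z \<Longrightarrow> s \<bullet> E1 = 0 \<Longrightarrow> F s = 0"
  shows "(\<Sum>s\<in>directions X z. F s) = (\<Sum>s\<in>{s \<in> directions X z. s \<bullet> E1 > 0}. F s) + (\<Sum>s\<in>{s \<in> directions X z. s \<bullet> E1 < 0}. F s)"
proof -
  have "(\<Sum>s\<in>directions X z. F s) = (\<Sum>s\<in>{s \<in> directions X z. s \<bullet> E1 > 0} \<union> {s \<in> directions X z. s \<bullet> E1 < 0}. F s)"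
    using finite_directions[OF z] F by (intro sum.mono_neutral_right) (auto simp: not_less intro: antisym)
  also have "\<dots> = (\<Sum>s\<in>{s \<in> directions X z. s \<bullet> E1 > 0}. F s) + (\<Sum>s\<in>{s \<in> directions X z. s \<bullet> E1 < 0}. F s)"
    using finite_directions[OF z] by (intro sum.union_disjoint) auto
  finally show ?thesis .
qed

lemma sum_edge_mult_nat:
  assumes "z \<in> X" "S \<subseteq> directions X z"
  shows "\<exists>n::nat. (\<Sum>s\<in>S. edge_mult \<Theta> z s) = real n"
proof -
  obtain m :: "_ \<Rightarrow> nat" where m: "\<And>s. s \<in> directions X z \<Longrightarrow> edge_mult \<Theta> z s = real (m s)"
    using edge_mult_nat[OF assms(1)] by metis
  have "(\<Sum>s\<in>S. edge_mult \<Theta> z s) = real (\<Sum>s\<in>S. m s)"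
    unfolding of_nat_sum using m assms(2) by (intro sum.cong) auto
  then show ?thesis by blast
qed

text \<open>By balance the axial fluxes to the right and to the left have a common value
  \<open>P\<close>. Both multiplicities lie between \<open>P\<close> and \<open>P / c\<close>, an
  interval of length below 1, and both are integers.\<close>

lemma left_mult_eq_right_mult:
  assumes z: "z \<in> X" "fst z \<in> {a - 4..b + 4}" "norm (snd z) \<le> R"
  shows "left_mult X \<Theta> z = right_mult X \<Theta> z"
proof -
  define P where "P = (\<Sum>s\<in>{s \<in> directions X z. s \<bullet> E1 > 0}. edge_mult \<Theta> z s * (s \<bullet> E1))"
  define M where "M = (\<Sum>s\<in>{s \<in> directions X z. s \<bullet> E1 < 0}. edge_mult \<Theta> z s * - (s \<bullet> E1))"
  have "0 = (\<Sum>s\<in>directions X z. edge_mult \<Theta> z s *\<^sub>R s) \<bullet> E1" using balance[OF z(1)] by simp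
  also have "\<dots> = (\<Sum>s\<in>directions X z. edge_mult \<Theta> z s * (s \<bullet> E1))" by (simp add: inner_sum_left)
  also have "\<dots> = P + (\<Sum>s\<in>{s \<in> directions X z. s \<bullet> E1 < 0}. edge_mult \<Theta> z s * (s \<bullet> E1))"
    unfolding P_def by (rule sum_directions_split[OF z(1)]) simp
  also have "\<dots> = P - M" by (simp add: M_def sum_negf)
  finally have PM: "P = M" by simp
  note flux = axial_flux[OF z, folded P_def M_def]
  have "P \<le> 2 * C" unfolding P_def by (rule axial_flux_bound[OF z])
  moreover have "0 \<le> 1 / c - 1" using c0 c1 by simp
  ultimately have small: "P * (1 / c - 1) < 1" using C_small by (meson mult_right_mono order_le_less_trans)
  have "right_mult X \<Theta> z \<le> P / c" "left_mult X \<Theta> z \<le> P / c"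
    using flux(1,3) PM c0 by (simp_all add: field_simps)
  then have diff: "\<bar>left_mult X \<Theta> z - right_mult X \<Theta> z\<bar> < 1"
    using flux(2,4) PM small by (simp add: right_diff_distrib abs_less_iff)
  obtain i j :: nat where ij: "left_mult X \<Theta> z = real i" "right_mult X \<Theta> z = real j"
    unfolding left_mult_def right_mult_def using sum_edge_mult_nat[OF z(1)] by (metis (no_types, lifting) mem_Collect_eq subsetI)
  then have "real i < real (j + 1)" "real j < real (i + 1)" using diff by (simp_all add: abs_less_iff)
  then show ?thesis unfolding ij of_nat_less_iff by simp
qed

text \<open>No direction is orthogonal to the axis, so left and right multiplicity exhaust the sum
  over all directions. In particular the value is an integer at singular points too.\<close>

lemma mult_ext_eq_right_mult:
  assumes z: "z \<in> X" "fst z \<in> {a - 4..b + 4}" "norm (snd z) \<le> R"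
  shows "mult_ext X \<Theta> z = right_mult X \<Theta> z"
proof -
  have "(\<Sum>s\<in>directions X z. edge_mult \<Theta> z s) = right_mult X \<Theta> z + left_mult X \<Theta> z"
    unfolding right_mult_def left_mult_def
    using direction_flat(1)[OF z] c0 by (intro sum_directions_split[OF z(1)]) (force simp: inner_E1)
  then show ?thesis using mult_ext_eq[OF z(1)] left_mult_eq_right_mult[OF z] by simp
qed

section \<open>Slices orthogonal to the axis\<close>

lemma slice_multiplicity_nat:
  assumes t: "t \<in> {a - 4..b + 4}"
  shows "\<exists>n::nat. (\<Sum>z\<in>X \<inter> tube {t} R. mult_ext X \<Theta> z) = real n"
proof -
  have "\<exists>n::nat. mult_ext X \<Theta> z = real n" if z: "z \<in> X \<inter> tube {t} R" for z
  proof -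
    have "z \<in> X" "fst z \<in> {a - 4..b + 4}" "norm (snd z) \<le> R"
      using z t by (auto simp: tube_def)
    then show ?thesis using mult_ext_eq_right_mult sum_edge_mult_nat[of z "{s \<in> directions X z. s \<bullet> E1 > 0}"]
      by (auto simp: right_mult_def)
  qed
  then obtain m :: "_ \<Rightarrow> nat" where "\<And>z. z \<in> X \<inter> tube {t} R \<Longrightarrow> mult_ext X \<Theta> z = real (m z)" by metis
  then have "(\<Sum>z\<in>X \<inter> tube {t} R. mult_ext X \<Theta> z) = real (\<Sum>z\<in>X \<inter> tube {t} R. m z)"
    unfolding of_nat_sum by (intro sum.cong) auto
  then show ?thesis by blast
qed

text \<open>Near an accumulation point a second point of the slice would give a direction orthogonal
  to the axis.\<close>

lemma finite_slice:
  assumes t: "t \<in> {a - 4..b + 4}"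
  shows "finite (X \<inter> tube {t} R)"
proof (rule ccontr)
  assume inf: "infinite (X \<inter> tube {t} R)"
  have sub: "X \<inter> tube {t} R \<subseteq> slab t t R" by (auto simp: tube_def mem_slab)
  obtain x where x: "x \<in> slab t t R" "x islimpt (X \<inter> tube {t} R)"
    using Heine_Borel_imp_Bolzano_Weierstrass[OF compact_slab inf sub] by blast
  have xX: "x \<in> X" using x(2) closed_X by (meson Int_lower1 closed_limpt islimpt_subset)
  obtain \<epsilon> where \<epsilon>: "star_radius X x \<epsilon>" using star_exists[OF xX] by blast
  then have "\<epsilon> > 0" by (simp add: star_radius_def)
  then obtain y where y: "y \<in> X \<inter> tube {t} R" "y \<noteq> x" "dist y x < \<epsilon>"
    using x(2) unfolding islimpt_approachable by blast
  then have "y \<in> X" "dist x y < \<epsilon>" by (simp_all add: dist_commute)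
  then obtain s u where s: "s \<in> directions X x" "0 \<le> u" "y = x + u *\<^sub>R s"
    by (rule star_radius_cases[OF \<epsilon>])
  have "fst y = t" "fst x = t" using y(1) x(1) by (auto simp: tube_def mem_slab)
  then have "u * fst s = 0" using s(3) by simp
  moreover have "u \<noteq> 0" using y(2) s(3) by auto
  moreover have "c \<le> \<bar>fst s\<bar>" using direction_flat(1)[OF xX _ _ s(1)] x(1) t by (auto simp: mem_slab)
  ultimately show False using c0 by simp
qed

abbreviation "test \<equiv> tube_test a b R \<rho>"

text \<open>First variation in the direction \<open>E1\<close> with a function of the axial
  coordinate: the primitive \<open>\<Psi>\<close> of the trapezoid minus \<open>K\<close> times the
  step at \<open>t\<close>. \<open>K = b - a + 1\<close> is the total rise of \<open>\<Psi>\<close>,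
  so the difference has compact support along the axis. The step contributes the axial flux
  \<open>P\<close> through the slice, and \<open>\<Psi>\<close> the integral of the test function
  weighted with the square of the axial slope \<open>\<gamma>\<close>. As
  \<open>c \<le> \<bar>\<gamma>\<bar> \<le> 1\<close>, the latter is comparable to \<open>J\<close>,
  and \<open>P\<close> to \<open>N\<close>.\<close>

lemma slice_multiplicity:
  assumes t: "t \<in> {a..b}"
  defines "N \<equiv> (\<Sum>z\<in>X \<inter> tube {t} R. mult_ext X \<Theta> z)"
    and "J \<equiv> (\<integral>z. test z \<partial>network_measure X \<Theta>)"
  shows "c * N * (b - a + 1) \<le> J" "c\<^sup>2 * J \<le> N * (b - a + 1)"
proof -
  define Z where "Z = X \<inter> tube {t} R"
  have finZ: "finite Z" unfolding Z_def using t by (intro finite_slice) auto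
  have "Z \<subseteq> X" by (auto simp: Z_def)
  \<comment> \<open>The points of the slice become vertices, so that no edge inside the narrow tube
    crosses the level \<open>t\<close> at an inner point.\<close>
  then obtain V where V: "vertex_set X big_slab l V" and ZV: "Z \<subseteq> V"
    using vertex_set_exists[OF compact_slab l0 finZ] by blast
  note finV = vertex_setD(1)[OF V] and VX = vertex_setD(2)[OF V]
  define E where "E = edges X V"
  have finE: "finite E" unfolding E_def by (rule finite_edges[OF finV])
  have sym: "(q, p) \<in> E" if "(p, q) \<in> E" for p q using that edges_commute[of p q X V] by (simp add: E_def)
  have RR: "\<rho> < R" using lR l0 by simp
  \<comment> \<open>\<open>G\<close> is convex, so an edge with both ends in it, that is, an edge of
    \<open>B\<close>, runs inside it. All other edges turn out to contribute nothing.\<close>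
  define G where "G = {z :: real \<times> (real ^ 'm). fst z \<in> {a - 3..b + 3} \<and> norm (snd z) < \<rho>}"
  have convG: "convex G"
  proof -
    have "G = {a - 3..b + 3} \<times> ball 0 \<rho>" by (auto simp: G_def)
    then show ?thesis by (simp add: convex_Times)
  qed
  define B where "B = {(p, q) \<in> E. p \<in> G \<and> q \<in> G}"
  have BE: "B \<subseteq> E" by (auto simp: B_def)
  have finB: "finite B" using finite_subset[OF BE finE] .
  have symB: "(q, p) \<in> B" if "(p, q) \<in> B" for p q using that sym by (auto simp: B_def)
  define w where "w p q = edge_weight \<Theta> p q" for p q
  define \<gamma> where "\<gamma> p q = fst (sgn (q - p))" for p q :: "real \<times> (real ^ 'm)"
  define \<Psi> where "\<Psi> = trapezoid_primitive a b"
  have wsym: "w q p = w p q" for p q unfolding w_def by (rule edge_weight_commute)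
  have \<gamma>sym: "\<gamma> q p = - \<gamma> p q" for p q unfolding \<gamma>_def by (metis fst_uminus minus_diff_eq sgn_minus)
  have w1: "w p q \<ge> 1" if "(p, q) \<in> E" for p q
    unfolding w_def using that edge_weight_ge_1[OF _ VX] by (simp add: E_def)
  have fstq: "fst q = fst p + norm (q - p) * \<gamma> p q" for p q
    unfolding \<gamma>_def by (metis add_diff_cancel_left' diff_add_cancel fst_add fst_scaleR real_scaleR_def scaleR_norm_sgn)
  have ne: "p \<noteq> q" if "(p, q) \<in> E" for p q using that by (auto simp: E_def edges_def)
  have openX: "open_segment p q \<subseteq> X" "open_segment p q \<inter> V = {}" if "(p, q) \<in> E" for p q
    using that regular_points_subset by (auto simp: E_def edges_def)
  have \<gamma>c: "c \<le> \<bar>\<gamma> p q\<bar>" "\<bar>\<gamma> p q\<bar> \<le> 1" if pq: "(p, q) \<in> B" for p q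
  proof -
    have "sgn (q - p) \<in> directions X p" "p \<in> V"
      using edge_direction[of p q V] pq by (auto simp: B_def E_def edges_def)
    moreover have "fst p \<in> {a - 4..b + 4}" "norm (snd p) \<le> R" using pq RR by (auto simp: B_def G_def)
    ultimately show "c \<le> \<bar>\<gamma> p q\<bar>" "\<bar>\<gamma> p q\<bar> \<le> 1"
      unfolding \<gamma>_def using VX by (auto intro!: direction_flat)
  qed

  have test_cont: "continuous_on UNIV test" by (rule continuous_tube_test)
  have test_supp: "fst z \<in> {a - 1..b + 1} \<and> norm (snd z) < R" if "test z \<noteq> 0" for z
    using tube_test_support[OF ab RR that] .
  have test_G: "test z = trapezoid a b (fst z)" if "norm (snd z) < \<rho>" for z
    using that RR by (simp add: tube_test_def min_def max_def)

  \<comment> \<open>If the test function is nonzero at an inner point, the edge has length at most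
    \<open>2 * l\<close> by \<open>edges_cover\<close>, and confinement puts both ends into
    \<open>G\<close>.\<close>
  have edge_out: "edge_integral test p q = 0" if pq: "(p, q) \<in> E" "(p, q) \<notin> B" for p q
  proof -
    have "test x = 0" if x: "x \<in> open_segment p q" for x
    proof (rule ccontr)
      assume "test x \<noteq> 0"
      then have xs: "fst x \<in> {a - 1..b + 1}" "norm (snd x) < R" using test_supp[of x] by blast+
      have xX: "x \<in> X" "x \<notin> V" using openX[OF pq(1)] x by auto
      have "x \<in> big_slab" using xs by (simp add: mem_slab)
      then obtain p' q' where pq': "(p', q') \<in> edges X V" "x \<in> open_segment p' q'" "norm (q' - p') \<le> 2 * l"
        using edges_cover[OF V xX(1) _ xX(2)] by blast
      then have "(p', q') = (p, q) \<or> (p', q') = (q, p)"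
        using edge_unique[of p q V x p' q'] pq(1) x by (simp add: E_def)
      then have len: "norm (q - p) \<le> 2 * l" using pq'(3) by (auto simp: norm_minus_commute)
      have nx: "norm (snd x) < \<rho>" using no_leak[OF xX(1)] xs by (simp add: mem_slab)
      have near: "y \<in> G" if y: "y \<in> {p, q}" for y
      proof -
        have yV: "y \<in> V" using pq(1) y by (auto simp: E_def edges_def)
        have "dist x y \<le> dist p q"
          using x y dist_in_closed_segment[of x p q] by (auto simp: open_closed_segment dist_commute)
        then have d: "norm (y - x) \<le> 2 * l" using len by (simp add: dist_norm norm_minus_commute)
        have 1: "\<bar>fst y - fst x\<bar> \<le> 2" using abs_fst_diff_le[of y x] d l1 by linarith
        have 2: "norm (snd y) \<le> R" using norm_snd_le_add[of y x] nx d lR by simp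
        have 3: "a - 3 \<le> fst y" "fst y \<le> b + 3" using 1 xs by (auto simp: abs_le_iff)
        then show ?thesis using no_leak[of y] yV VX 2 by (auto simp: G_def mem_slab)
      qed
      then have "(p, q) \<in> B" using pq(1) by (simp add: B_def)
      then show False using pq(2) by simp
    qed
    moreover have "p + u *\<^sub>R sgn (q - p) \<in> open_segment p q" if "u \<in> {0<..<norm (q - p)}" for u
      unfolding open_segment_arclength[OF ne[OF pq(1)]] using that by blast
    ultimately have "indicator {0<..<norm (q - p)} u * test (p + u *\<^sub>R sgn (q - p)) = 0" for u
      by (cases "u \<in> {0<..<norm (q - p)}") auto
    then show ?thesis unfolding edge_integral_def by (simp only: Bochner_Integration.integral_zero)
  qed

  have edge_in: "edge_integral test p q = (\<Psi> (fst q) - \<Psi> (fst p)) / \<gamma> p q" if pq: "(p, q) \<in> B" for p q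
  proof -
    have pqE: "(p, q) \<in> E" and pG: "p \<in> G" "q \<in> G" using pq by (auto simp: B_def)
    have seg: "x \<in> G" if "x \<in> open_segment p q" for x
      using convG pG that convex_contains_open_segment by blast
    have "indicator {0<..<norm (q - p)} u * test (p + u *\<^sub>R sgn (q - p))
        = indicator {0<..<norm (q - p)} u * trapezoid a b (fst p + u * \<gamma> p q)" for u
    proof (cases "u \<in> {0<..<norm (q - p)}")
      case True
      then have "p + u *\<^sub>R sgn (q - p) \<in> G"
        using seg open_segment_arclength[OF ne[OF pqE]] by blast
      then show ?thesis using test_G[of "p + u *\<^sub>R sgn (q - p)"] by (simp add: G_def \<gamma>_def)
    qed simp
    then have "edge_integral test p q = (\<integral>u. indicator {0<..<norm (q - p)} u * trapezoid a b (fst p + u * \<gamma> p q) \<partial>lborel)"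
      by (simp only: edge_integral_def)
    also have "\<dots> = (\<Psi> (fst p + norm (q - p) * \<gamma> p q) - \<Psi> (fst p)) / \<gamma> p q"
      unfolding \<Psi>_def using \<gamma>c[OF pq] c0 by (intro integral_trapezoid_line) auto
    finally show ?thesis using fstq[of q p] by simp
  qed

  have J: "J = (1/2) * (\<Sum>(p, q)\<in>B. w p q * ((\<Psi> (fst q) - \<Psi> (fst p)) / \<gamma> p q))"
  proof -
    have "J = (1/2) * (\<Sum>(p, q)\<in>E. w p q * edge_integral test p q)"
      unfolding J_def E_def w_def
    proof (rule network_integral(2)[OF V test_cont])
      fix z assume "z \<notin> big_slab"
      then have "\<not> (fst z \<in> {a - 1..b + 1} \<and> norm (snd z) < R)" by (auto simp: mem_slab)
      then show "test z = 0" using test_supp[of z] by blast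
    qed
    also have "(\<Sum>(p, q)\<in>E. w p q * edge_integral test p q) = (\<Sum>(p, q)\<in>B. w p q * edge_integral test p q)"
      using edge_out by (intro sum.mono_neutral_right finE BE) auto
    also have "\<dots> = (\<Sum>(p, q)\<in>B. w p q * ((\<Psi> (fst q) - \<Psi> (fst p)) / \<gamma> p q))"
      using edge_in by (intro sum.cong) auto
    finally show ?thesis .
  qed

  \<comment> \<open>\<open>H\<close> is 0 at \<open>t\<close> itself, so its jump is seen by edges
    leaving the slice to the right and not by edges reaching it from the left.\<close>
  define H where "H u = (if t < u then 1 else 0 :: real)" for u
  define F where "F p q = (if p \<in> Z then w p q * max 0 (\<gamma> p q) else 0)" for p q
  have activeB: "(p, q) \<in> B"
    if pq: "(p, q) \<in> E" and p: "fst p \<in> {a - 1..b + 1}" "norm (snd p) \<le> R" for p q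
  proof -
    have "(p, q) \<in> active X V (slab (a - 1) (b + 1) R)" using pq p by (simp add: active_def E_def mem_slab)
    from active_ends[OF V _ _ this] show ?thesis using pq by (auto simp: B_def G_def)
  qed
  \<comment> \<open>An edge of \<open>B\<close> sees the jump exactly if its left end lies in the
    slice: \<open>F p q\<close> accounts for edges traversed to the right, \<open>F q p\<close> for
    the reversed ones.\<close>
  have jump: "w p q * (\<gamma> p q * (H (fst q) - H (fst p))) = F p q + F q p" if pq: "(p, q) \<in> B" for p q
  proof -
    have *: "w p q * (\<gamma> p q * (H (fst q) - H (fst p))) = F p q + F q p" if pq: "(p, q) \<in> B" and pos: "\<gamma> p q > 0" for p q
    proof -
      have pqE: "(p, q) \<in> E" and pG: "p \<in> G" "q \<in> G" using pq by (auto simp: B_def)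
      have Fq: "F q p = 0" using pos by (simp add: F_def \<gamma>sym[of p q])
      have lt: "fst p < fst q" using fstq[of q p] pos ne[OF pqE] by simp
      show ?thesis
      proof (cases "p \<in> Z")
        case True
        then have "fst p = t" by (auto simp: Z_def tube_def)
        then show ?thesis using Fq True lt pos by (simp add: F_def H_def)
      next
        case False
        have "fst p \<noteq> t"
        proof
          assume "fst p = t"
          moreover have "p \<in> X" using pqE VX by (auto simp: E_def edges_def)
          ultimately have "p \<in> Z" using pG RR by (cases p) (auto simp: Z_def tube_def G_def)
          then show False using False by simp
        qed
        moreover have "\<not> (fst p < t \<and> t < fst q)"
        proof
          assume between: "fst p < t \<and> t < fst q"
          define u where "u = (t - fst p) / \<gamma> p q"
          define x where "x = p + u *\<^sub>R sgn (q - p)"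
          have u: "0 < u" "u < norm (q - p)"
            using between pos fstq[of q p] by (auto simp: u_def field_simps)
          have xs: "x \<in> open_segment p q"
            unfolding open_segment_arclength[OF ne[OF pqE]] x_def using u by auto
          have "fst x = t" using pos by (simp add: x_def u_def \<gamma>_def)
          moreover have "x \<in> G" using xs convG pG convex_contains_open_segment by blast
          moreover have "x \<in> X" using xs openX[OF pqE] by blast
          ultimately have "x \<in> Z" using RR by (cases x) (auto simp: Z_def tube_def G_def)
          then show False using xs openX[OF pqE] ZV by blast
        qed
        ultimately have "H (fst q) = H (fst p)" using lt by (auto simp: H_def)
        then show ?thesis using Fq False by (simp add: F_def)
      qed
    qed
    have "\<gamma> p q \<noteq> 0" using \<gamma>c[OF pq] c0 by auto
    then consider "\<gamma> p q > 0" | "\<gamma> q p > 0" using \<gamma>sym[of p q] by linarith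
    then show ?thesis
    proof cases
      case 1
      then show ?thesis by (rule *[OF pq])
    next
      case 2
      then have "w q p * (\<gamma> q p * (H (fst p) - H (fst q))) = F q p + F p q" by (rule *[OF symB[OF pq]])
      then show ?thesis unfolding wsym[of p q] \<gamma>sym[of p q] by (simp add: algebra_simps)
    qed
  qed

  define P where "P = (\<Sum>z\<in>Z. \<Sum>s\<in>directions X z. edge_mult \<Theta> z s * max 0 (s \<bullet> E1))"
  have Zprop: "z \<in> X" "fst z = t" "norm (snd z) \<le> R" if "z \<in> Z" for z
    using that by (auto simp: Z_def tube_def)
  have tab: "t \<in> {a - 4..b + 4}" using t by auto
  have PN: "c * N \<le> P" "P \<le> N"
  proof -
    have eq: "(\<Sum>s\<in>directions X z. edge_mult \<Theta> z s * max 0 (s \<bullet> E1))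
      = (\<Sum>s\<in>{s \<in> directions X z. s \<bullet> E1 > 0}. edge_mult \<Theta> z s * (s \<bullet> E1))" if "z \<in> Z" for z
      using finite_directions[OF Zprop(1)[OF that]]
      by (intro sum.mono_neutral_cong_right) (auto simp: max_def)
    have z: "c * mult_ext X \<Theta> z \<le> (\<Sum>s\<in>directions X z. edge_mult \<Theta> z s * max 0 (s \<bullet> E1))"
      "(\<Sum>s\<in>directions X z. edge_mult \<Theta> z s * max 0 (s \<bullet> E1)) \<le> mult_ext X \<Theta> z" if "z \<in> Z" for z
      using axial_flux(1,2)[of z] mult_ext_eq_right_mult[of z] Zprop[OF that] tab eq[OF that] by auto
    show "c * N \<le> P" unfolding N_def P_def Z_def[symmetric] sum_distrib_left using z(1) by (rule sum_mono)
    show "P \<le> N" unfolding N_def P_def Z_def[symmetric] using z(2) by (rule sum_mono)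
  qed
  have EF: "(\<Sum>(p, q)\<in>E. F p q) = P"
  proof -
    have "(\<Sum>(p, q)\<in>E. F p q) = (\<Sum>p\<in>V. \<Sum>q\<in>{q. (p, q) \<in> E}. F p q)"
      unfolding E_def by (rule sum_edges_fst[OF finV])
    also have "\<dots> = (\<Sum>p\<in>Z. \<Sum>q\<in>{q. (p, q) \<in> E}. F p q)"
      using ZV by (intro sum.mono_neutral_right finV) (auto simp: F_def)
    also have "\<dots> = P"
      unfolding P_def
    proof (rule sum.cong[OF refl])
      fix p assume p: "p \<in> Z"
      then have "p \<in> V" "p \<in> big_slab" using ZV Zprop[OF p] t by (auto simp: mem_slab)
      from sum_directions[OF V this, of "\<lambda>m s. m * max 0 (s \<bullet> E1)"]
      show "(\<Sum>q\<in>{q. (p, q) \<in> E}. F p q) = (\<Sum>s\<in>directions X p. edge_mult \<Theta> p s * max 0 (s \<bullet> E1))"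
        using p by (simp add: F_def E_def w_def \<gamma>_def inner_E1)
    qed
    finally show ?thesis .
  qed
  have F0: "F p q = 0" if "(p, q) \<in> E" "(p, q) \<notin> B" for p q
    using activeB[OF that(1)] that(2) Zprop[of p] t by (auto simp: F_def)
  have BF: "(\<Sum>(p, q)\<in>B. F p q) = P"
    unfolding EF[symmetric] using F0 by (intro sum.mono_neutral_left finE BE) auto
  have BF': "(\<Sum>(p, q)\<in>B. F q p) = P"
  proof -
    have "F q p = 0" if "(p, q) \<in> E" "(p, q) \<notin> B" for p q
      using F0[OF sym[OF that(1)]] symB that(2) by blast
    then have "(\<Sum>(p, q)\<in>B. F q p) = (\<Sum>(p, q)\<in>E. F q p)"
      by (intro sum.mono_neutral_left finE BE) auto
    also have "\<dots> = P" unfolding EF[symmetric] E_def by (rule sum_edges_swap)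
    finally show ?thesis .
  qed

  define K where "K = b - a + 1"
  have K0: "K > 0" using ab by (simp add: K_def)
  \<comment> \<open>Both parts vanish to the left of \<open>a - 1\<close> and cancel to the right of
    \<open>b + 1\<close>; the radial cutoff is not crossed by any edge of \<open>B\<close>.\<close>
  define f where "f z = (if norm (snd z) \<le> R then \<Psi> (fst z) - K * H (fst z) else 0)" for z :: "real \<times> (real ^ 'm)"
  have f0: "f z = 0" if out: "\<not> (fst z \<in> {a - 1..b + 1} \<and> norm (snd z) \<le> R)" for z
  proof -
    consider "\<not> norm (snd z) \<le> R" | "fst z \<le> a - 1" | "b + 1 \<le> fst z" using out by force
    then show ?thesis
    proof cases
      case 2
      then show ?thesis using t ab by (simp add: f_def H_def \<Psi>_def trapezoid_primitive_left)
    next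
      case 3
      then show ?thesis using t ab by (simp add: f_def H_def \<Psi>_def trapezoid_primitive_right K_def)
    qed (simp add: f_def)
  qed
  have "(\<Sum>(p, q)\<in>E. (w p q * (f q - f p)) *\<^sub>R sgn (q - p)) = 0"
    unfolding E_def w_def
  proof (rule first_variation[OF V])
    show "f v = 0" if "v \<notin> big_slab" for v using that by (intro f0) (auto simp: mem_slab)
  qed
  then have "(\<Sum>(p, q)\<in>E. (w p q * (f q - f p)) *\<^sub>R sgn (q - p)) \<bullet> E1 = 0" by simp
  then have "0 = (\<Sum>(p, q)\<in>E. w p q * (f q - f p) * (sgn (q - p) \<bullet> E1))"
    by (simp add: inner_sum_left case_prod_beta)
  also have "\<dots> = (\<Sum>(p, q)\<in>E. w p q * (\<gamma> p q * (f q - f p)))"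
    by (simp add: inner_E1 \<gamma>_def mult_ac)
  also have "\<dots> = (\<Sum>(p, q)\<in>B. w p q * (\<gamma> p q * (f q - f p)))"
  proof (rule sum.mono_neutral_right[OF finE BE], clarify)
    fix p q assume pq: "(p, q) \<in> E" "(p, q) \<notin> B"
    have "f p = 0" using f0[of p] activeB[OF pq(1)] pq(2) by blast
    moreover have "f q = 0" using f0[of q] activeB[OF sym[OF pq(1)]] symB pq(2) by blast
    ultimately show "w p q * (\<gamma> p q * (f q - f p)) = 0" by simp
  qed
  also have "\<dots> = (\<Sum>(p, q)\<in>B. w p q * (\<gamma> p q * (\<Psi> (fst q) - \<Psi> (fst p))) - K * (F p q + F q p))"
  proof (rule sum.cong[OF refl], clarify)
    fix p q assume pq: "(p, q) \<in> B"
    have df: "f q - f p = (\<Psi> (fst q) - \<Psi> (fst p)) - K * (H (fst q) - H (fst p))"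
      using pq RR by (auto simp: f_def B_def G_def algebra_simps)
    have "w p q * (\<gamma> p q * (f q - f p)) = w p q * (\<gamma> p q * (\<Psi> (fst q) - \<Psi> (fst p)))
      - K * (w p q * (\<gamma> p q * (H (fst q) - H (fst p))))" unfolding df by (simp add: algebra_simps)
    then show "w p q * (\<gamma> p q * (f q - f p)) = w p q * (\<gamma> p q * (\<Psi> (fst q) - \<Psi> (fst p))) - K * (F p q + F q p)"
      unfolding jump[OF pq] .
  qed
  also have "\<dots> = (\<Sum>(p, q)\<in>B. w p q * (\<gamma> p q * (\<Psi> (fst q) - \<Psi> (fst p))))
      - K * ((\<Sum>(p, q)\<in>B. F p q) + (\<Sum>(p, q)\<in>B. F q p))"
    by (simp add: case_prod_beta sum_subtractf flip: sum_distrib_left sum.distrib)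
  \<comment> \<open>Each of the two oriented sums of \<open>F\<close> equals \<open>P\<close>;
    together they cancel the factor 1/2.\<close>
  finally have S: "(1/2) * (\<Sum>(p, q)\<in>B. w p q * (\<gamma> p q * (\<Psi> (fst q) - \<Psi> (fst p)))) = K * P"
    unfolding BF BF' by simp

  \<comment> \<open>\<open>D\<close> below is the integral of the test function along the edge. The
    two expressions differ by the factor \<open>(\<gamma> p q)\<^sup>2\<close>, which lies between
    \<open>c\<^sup>2\<close> and 1.\<close>
  have edge_term: "w p q * (\<gamma> p q * (\<Psi> (fst q) - \<Psi> (fst p))) \<le> w p q * ((\<Psi> (fst q) - \<Psi> (fst p)) / \<gamma> p q)"
    "c\<^sup>2 * (w p q * ((\<Psi> (fst q) - \<Psi> (fst p)) / \<gamma> p q)) \<le> w p q * (\<gamma> p q * (\<Psi> (fst q) - \<Psi> (fst p)))"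
    if pq: "(p, q) \<in> B" for p q
  proof -
    define D where "D = (\<Psi> (fst q) - \<Psi> (fst p)) / \<gamma> p q"
    have g0: "\<gamma> p q \<noteq> 0" using \<gamma>c[OF pq] c0 by auto
    have g2: "c\<^sup>2 \<le> (\<gamma> p q)\<^sup>2" "(\<gamma> p q)\<^sup>2 \<le> 1"
      using \<gamma>c[OF pq] c0 by (auto simp: abs_le_square_iff[symmetric] abs_square_le_1)
    have D0: "D \<ge> 0"
    proof (cases "\<gamma> p q > 0")
      case True
      then have "fst p \<le> fst q" using fstq[of q p] by simp
      then show ?thesis using True trapezoid_primitive_mono[OF ab] by (simp add: D_def \<Psi>_def)
    next
      case False
      then have "fst q \<le> fst p" using fstq[of q p] by (simp add: mult_nonneg_nonpos)
      then show ?thesis using False trapezoid_primitive_mono[OF ab]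
        by (auto simp: D_def \<Psi>_def intro!: divide_nonpos_nonpos)
    qed
    have w0: "w p q \<ge> 0" using w1[of p q] pq by (auto simp: B_def)
    have eq: "\<gamma> p q * (\<Psi> (fst q) - \<Psi> (fst p)) = (\<gamma> p q)\<^sup>2 * D"
      using g0 by (simp add: D_def power2_eq_square)
    show "w p q * (\<gamma> p q * (\<Psi> (fst q) - \<Psi> (fst p))) \<le> w p q * ((\<Psi> (fst q) - \<Psi> (fst p)) / \<gamma> p q)"
      unfolding eq D_def[symmetric] using w0 mult_right_mono[OF g2(2) D0] by (intro mult_left_mono) auto
    show "c\<^sup>2 * (w p q * ((\<Psi> (fst q) - \<Psi> (fst p)) / \<gamma> p q)) \<le> w p q * (\<gamma> p q * (\<Psi> (fst q) - \<Psi> (fst p)))"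
      unfolding eq D_def[symmetric] using mult_left_mono[OF mult_right_mono[OF g2(1) D0] w0]
      by (simp add: mult_ac)
  qed
  have "K * P \<le> J"
    unfolding S[symmetric] J using edge_term(1) by (intro mult_left_mono sum_mono) auto
  moreover have "K * (c * N) \<le> K * P" using PN(1) K0 by (intro mult_left_mono) auto
  ultimately show "c * N * (b - a + 1) \<le> J" by (simp add: K_def mult.commute)
  have "c\<^sup>2 * J = (1/2) * (\<Sum>(p, q)\<in>B. c\<^sup>2 * (w p q * ((\<Psi> (fst q) - \<Psi> (fst p)) / \<gamma> p q)))"
    unfolding J by (simp add: sum_distrib_left case_prod_beta mult_ac)
  also have "\<dots> \<le> K * P"
    unfolding S[symmetric] using edge_term(2) by (intro mult_left_mono sum_mono) auto
  also have "\<dots> \<le> K * N" using PN(2) K0 by (intro mult_left_mono) auto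
  finally show "c\<^sup>2 * J \<le> N * (b - a + 1)" by (simp add: K_def mult.commute)
qed

end

section \<open>Consequences of weak convergence\<close>

lemma axis_measure_integral:
  fixes \<phi> :: "real \<times> (real ^ 'm) \<Rightarrow> real"
  assumes \<phi>: "continuous_on UNIV \<phi>"
  shows "(\<integral>z. \<phi> z \<partial>axis_measure k) = real k * (\<integral>t. \<phi> (t, 0) \<partial>lborel)"
proof -
  let ?E = "E1 :: real \<times> (real ^ 'm)"
  have [measurable]: "\<phi> \<in> borel_measurable borel" using \<phi> by (rule borel_measurable_continuous_onI)
  have nE: "norm ?E = 1" by (simp add: E1_def norm_Pair)
  have ax: "E1_axis = line 0 ?E" by (simp add: E1_axis_def line_def span_singleton)
  have [measurable]: "line 0 ?E \<in> sets borel" using closed_line[OF nE] by auto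
  have "axis_measure k = density hausdorff1 (\<lambda>x. ennreal (real k * indicator (line 0 ?E) x))"
    unfolding axis_measure_def ax
    by (intro density_cong AE_I2) (auto split: split_indicator simp: ennreal_of_nat_eq_real_of_nat)
  then have "(\<integral>z. \<phi> z \<partial>axis_measure k) = (\<integral>x. (real k * indicator (line 0 ?E) x) *\<^sub>R \<phi> x \<partial>hausdorff1)"
    by (simp only:) (rule integral_density, auto)
  also have "\<dots> = real k * (\<integral>x. indicator (line 0 ?E) x *\<^sub>R \<phi> x \<partial>hausdorff1)"
    by (simp add: mult.assoc)
  also have "(\<integral>x. indicator (line 0 ?E) x *\<^sub>R \<phi> x \<partial>hausdorff1)
      = (\<integral>x. \<phi> x \<partial>density hausdorff1 (\<lambda>x. ennreal (indicator (line 0 ?E) x)))"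
    by (rule integral_density[symmetric]) auto
  also have "density hausdorff1 (\<lambda>x. ennreal (indicator (line 0 ?E) x)) = density hausdorff1 (indicator (line 0 ?E))"
    by (intro density_cong AE_I2) (auto split: split_indicator)
  also have "\<dots> = distr lborel borel (\<lambda>t. 0 + t *\<^sub>R ?E)" by (rule hausdorff1_line[OF nE])
  also have "(\<integral>x. \<phi> x \<partial>\<dots>) = (\<integral>t. \<phi> (0 + t *\<^sub>R ?E) \<partial>lborel)" by (rule integral_distr) auto
  finally show ?thesis by (simp add: E1_def)
qed

lemma weak_conv_test:
  fixes \<phi> :: "'a::euclidean_space \<Rightarrow> real"
  assumes conv: "radon_weak_conv \<mu> \<nu>" and \<phi>: "continuous_on UNIV \<phi>"
    and K: "compact K" "\<And>z. z \<notin> K \<Longrightarrow> \<phi> z = 0"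
  shows "(\<lambda>i. \<integral>z. \<phi> z \<partial>\<mu> i) \<longlonglongrightarrow> (\<integral>z. \<phi> z \<partial>\<nu>)"
proof -
  have "{z. \<phi> z \<noteq> 0} \<subseteq> K" using K(2) by blast
  then have "bounded {z. \<phi> z \<noteq> 0}" by (rule bounded_subset[OF compact_imp_bounded[OF K(1)]])
  then have "compact (closure {z. \<phi> z \<noteq> 0})" by (simp only: compact_closure)
  then show ?thesis using conv \<phi> unfolding radon_weak_conv_def by blast
qed

text \<open>Let \<open>A\<close> be the part of the slab at distance at least \<open>\<rho>\<close>
  from the axis. A bump around \<open>A\<close> that vanishes on the axis has integrals tending to
  0, whereas a single point of \<open>X i\<close> in \<open>A\<close> would contribute at least
  \<open>\<rho> / 4\<close>.\<close>

lemma eventually_narrow: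
  fixes X :: "nat \<Rightarrow> (real \<times> (real ^ 'm)) set"
  assumes net: "\<And>i. ISGN (X i) (\<Theta> i)"
    and conv: "radon_weak_conv (\<lambda>i. network_measure (X i) (\<Theta> i)) (axis_measure k)"
    and \<rho>: "0 < \<rho>"
  shows "\<forall>\<^sub>F i in sequentially. \<forall>z. z \<in> X i \<longrightarrow> z \<in> slab c d R \<longrightarrow> norm (snd z) < \<rho>"
proof -
  define A where "A = (slab c d R :: (real \<times> (real ^ 'm)) set) \<inter> {z. \<rho> \<le> norm (snd z)}"
  have cA: "compact A"
    unfolding A_def using compact_slab
    by (intro compact_Int_closed closed_Collect_le continuous_intros) auto
  show ?thesis
  \<comment> \<open>For empty \<open>A\<close> the function \<open>infdist\<close> is constantly 0,
    and the bump below would be 1 everywhere.\<close>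
  proof (cases "A = {}")
    case True
    have "norm (snd z) < \<rho>" if "z \<in> slab c d R" for z :: "real \<times> (real ^ 'm)"
    proof (rule ccontr)
      assume "\<not> norm (snd z) < \<rho>"
      then have "z \<in> A" using that by (simp add: A_def)
      then show False using True by simp
    qed
    then show ?thesis by simp
  next
    case False
    \<comment> \<open>The value is 1 within \<open>\<rho> / 4\<close> of \<open>A\<close> and 0 from
      distance \<open>\<rho> / 2\<close> on, which is reached before the axis.\<close>
    define \<phi> where "\<phi> z = max 0 (min 1 (2 - (4 / \<rho>) * infdist z A))" for z
    define K where "K = {z. infdist z A \<le> \<rho> / 2}"
    have K: "compact K" unfolding K_def using cA False \<rho> by (intro compact_infdist_le) auto
    have cont: "continuous_on UNIV \<phi>" unfolding \<phi>_def by (intro continuous_intros)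
    have \<phi>0: "\<phi> z = 0" if "z \<notin> K" for z
      using that \<rho> by (auto simp: K_def \<phi>_def field_simps)
    have \<phi>nn: "\<phi> z \<ge> 0" for z by (simp add: \<phi>_def)
    have \<phi>1: "\<phi> y = 1" if "z \<in> A" "y \<in> ball z (\<rho> / 4)" for y z
    proof -
      have "infdist y A \<le> dist y z" using that(1) by (rule infdist_le)
      then have "infdist y A < \<rho> / 4" using that(2) by (simp add: dist_commute)
      then have "(4 / \<rho>) * infdist y A < 1" using \<rho> by (simp add: field_simps)
      then show ?thesis by (simp add: \<phi>_def)
    qed
    have axis: "\<phi> (t, 0) = 0" for t
    proof (rule \<phi>0)
      have "\<rho> \<le> infdist (t, 0) A"
        unfolding infdist_notempty[OF False]
      proof (rule cINF_greatest[OF False])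
        fix z assume "z \<in> A"
        then have "\<rho> \<le> norm (snd z)" by (simp add: A_def)
        also have "\<dots> = dist (snd (t, 0)) (snd z)" by (simp add: dist_norm)
        also have "\<dots> \<le> dist (t, 0) z" by (rule dist_snd_le)
        finally show "\<rho> \<le> dist (t, 0) z" .
      qed
      then show "(t, 0) \<notin> K" using \<rho> by (simp add: K_def)
    qed
    have "(\<integral>z. \<phi> z \<partial>axis_measure k) = 0"
      unfolding axis_measure_integral[OF cont] axis by simp
    then have "(\<lambda>i. \<integral>z. \<phi> z \<partial>network_measure (X i) (\<Theta> i)) \<longlonglongrightarrow> 0"
      using weak_conv_test[OF conv cont K \<phi>0] by simp
    then have "\<forall>\<^sub>F i in sequentially. (\<integral>z. \<phi> z \<partial>network_measure (X i) (\<Theta> i)) < \<rho> / 4"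
      using \<rho> by (intro order_tendstoD(2)) auto
    then show ?thesis
    proof eventually_elim
      case (elim i)
      interpret isgn "X i" "\<Theta> i" using net by unfold_locales
      obtain V where V: "vertex_set (X i) K 1 V"
        using vertex_set_exists[OF K, of 1 "{}"] by auto
      have int: "integrable (network_measure (X i) (\<Theta> i)) \<phi>"
        by (rule network_integral(1)[OF V cont \<phi>0])
      have "norm (snd z) < \<rho>" if z: "z \<in> X i" "z \<in> slab c d R" for z
      proof (rule ccontr)
        assume "\<not> norm (snd z) < \<rho>"
        then have zA: "z \<in> A" using z by (simp add: A_def)
        have sets: "sets (network_measure (X i) (\<Theta> i)) = sets borel" by (simp add: network_measure_def)
        have "ennreal (\<rho> / 4) \<le> emeasure (network_measure (X i) (\<Theta> i)) (ball z (\<rho> / 4))"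
          using \<rho> by (intro network_measure_ball[OF z(1)]) simp
        also have "\<dots> = (\<integral>\<^sup>+y. indicator (ball z (\<rho> / 4)) y \<partial>network_measure (X i) (\<Theta> i))"
          by (simp add: sets)
        also have "\<dots> \<le> (\<integral>\<^sup>+y. ennreal (\<phi> y) \<partial>network_measure (X i) (\<Theta> i))"
          using \<phi>1[OF zA] by (intro nn_integral_mono) (auto split: split_indicator)
        also have "\<dots> = ennreal (\<integral>y. \<phi> y \<partial>network_measure (X i) (\<Theta> i))"
          using int \<phi>nn by (intro nn_integral_eq_integral) auto
        finally have "ennreal (\<rho> / 4) \<le> ennreal (\<integral>y. \<phi> y \<partial>network_measure (X i) (\<Theta> i))" .
        moreover have "0 \<le> (\<integral>y. \<phi> y \<partial>network_measure (X i) (\<Theta> i))" using \<phi>nn by (rule Bochner_Integration.integral_nonneg)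
        ultimately have "\<rho> / 4 \<le> (\<integral>y. \<phi> y \<partial>network_measure (X i) (\<Theta> i))" by simp
        then show False using elim by simp
      qed
      then show ?case by blast
    qed
  qed
qed

text \<open>It does not involve \<open>\<rho>\<close>, so the mass constant is known before
  \<open>\<rho>\<close> is chosen in terms of it.\<close>

definition mass_test :: "real \<Rightarrow> real \<Rightarrow> real \<Rightarrow> real \<times> (real ^ 'm) \<Rightarrow> real" where
  "mass_test a b R z = trapezoid (a - 7) (b + 7) (fst z) * max 0 (min 1 (R + 2 - norm (snd z)))"

lemma continuous_mass_test: "continuous_on A (mass_test a b R)"
  unfolding mass_test_def[abs_def] by (intro continuous_intros)

lemma mass_test_props:
  assumes "a \<le> b"
  shows "0 \<le> mass_test a b R z" "z \<notin> slab (a - 8) (b + 8) (R + 2) \<Longrightarrow> mass_test a b R z = 0"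
    and "z \<in> slab (a - 7) (b + 7) (R + 1) \<Longrightarrow> mass_test a b R z = 1"
proof -
  have ab: "a - 7 \<le> b + 7" using assms by simp
  note tr = trapezoid_bounds[OF ab, of "fst z"]
  show "0 \<le> mass_test a b R z" unfolding mass_test_def using tr by simp
  show "mass_test a b R z = 1" if "z \<in> slab (a - 7) (b + 7) (R + 1)"
    using that tr(3) by (simp add: mass_test_def mem_slab)
  show "mass_test a b R z = 0" if out: "z \<notin> slab (a - 8) (b + 8) (R + 2)"
  proof -
    consider "fst z \<notin> {a - 7 - 1..b + 7 + 1}" | "R + 2 - norm (snd z) \<le> 0"
      using out by (force simp: mem_slab)
    then show ?thesis by cases (auto simp: mass_test_def tr(4))
  qed
qed

lemma edge_integral_nonneg:
  assumes "\<And>z. 0 \<le> \<phi> z"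
  shows "0 \<le> edge_integral \<phi> p q"
  unfolding edge_integral_def using assms by (intro Bochner_Integration.integral_nonneg) simp

text \<open>Active edges have length at most 1, so they run where \<open>mass_test\<close> equals 1,
  and the integral over such an edge is its length. The factor 2 counts orientations.\<close>

lemma mass_bound:
  fixes X :: "(real \<times> (real ^ 'm)) set"
  assumes "ISGN X \<Theta>" and ab: "a \<le> b" and l1: "l \<le> 1"
    and V: "vertex_set X (slab (a - 8) (b + 8) (R + 2)) l V"
  shows "(\<Sum>(p, q)\<in>active X V (slab (a - 6) (b + 6) R). edge_weight \<Theta> p q * norm (q - p))
    \<le> 2 * (\<integral>z. mass_test a b R z \<partial>network_measure X \<Theta>)"
proof -
  interpret isgn X \<Theta> using assms(1) by unfold_locales
  define A where "A = active X V (slab (a - 6) (b + 6) R)"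
  define E where "E = edges X V"
  have finE: "finite E" unfolding E_def by (rule finite_edges[OF vertex_setD(1)[OF V]])
  have AE: "A \<subseteq> E" by (auto simp: A_def E_def active_def)
  have w: "edge_weight \<Theta> p q \<ge> 1" if "(p, q) \<in> E" for p q
    using edge_weight_ge_1[OF _ vertex_setD(2)[OF V]] that by (simp add: E_def)
  have full: "edge_integral (mass_test a b R) p q = norm (q - p)" if pq: "(p, q) \<in> A" for p q
  proof -
    have *: "p + u *\<^sub>R sgn (q - p) \<in> slab (a - 7) (b + 7) (R + 1)"
      if pq: "(p, q) \<in> E" and y: "y \<in> {p, q}" "y \<in> slab (a - 6) (b + 6) R"
        and u: "0 < u" "u < norm (q - p)" and len: "norm (q - p) \<le> l" for p q y u
    proof -
      define x where "x = p + u *\<^sub>R sgn (q - p)"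
      have "p \<noteq> q" using u by auto
      then have "x \<in> open_segment p q" unfolding x_def open_segment_arclength[OF \<open>p \<noteq> q\<close>] using u by auto
      then have "dist x y \<le> dist p q"
        using y(1) dist_in_closed_segment[of x p q] by (auto simp: open_closed_segment dist_commute)
      then have d: "norm (x - y) \<le> 1" using len l1 by (simp add: dist_norm norm_minus_commute)
      have 1: "\<bar>fst x - fst y\<bar> \<le> 1" using abs_fst_diff_le[of x y] d by linarith
      have 2: "norm (snd x) \<le> norm (snd y) + 1" using norm_snd_le_add[of x y] d by simp
      have "a - 6 \<le> fst y" "fst y \<le> b + 6" "norm (snd y) \<le> R" using y(2) by (auto simp: mem_slab)
      then have "x \<in> slab (a - 7) (b + 7) (R + 1)" using 1 2 unfolding mem_slab by linarith
      then show ?thesis by (simp add: x_def)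
    qed
    have pqE: "(p, q) \<in> E" using pq AE by blast
    obtain y where y: "y \<in> {p, q}" "y \<in> slab (a - 6) (b + 6) R"
      using pq unfolding A_def active_def by blast
    have yb: "y \<in> slab (a - 8) (b + 8) (R + 2)" using y(2) by (auto simp: mem_slab)
    have len: "norm (q - p) \<le> l"
    proof (cases "y = p")
      case True
      then show ?thesis using edge_length_le[OF V, of p q] pqE yb by (simp add: E_def)
    next
      case False
      then have "y = q" using y by simp
      then show ?thesis using edge_length_le[OF V, of q p] pqE yb edges_commute[of p q]
        by (simp add: E_def norm_minus_commute)
    qed
    have "indicator {0<..<norm (q - p)} u * mass_test a b R (p + u *\<^sub>R sgn (q - p)) = indicator {0<..<norm (q - p)} u" for u
      using mass_test_props(3)[OF ab *[OF pqE y _ _ len, of u]] by (auto split: split_indicator)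
    then have "edge_integral (mass_test a b R) p q = (\<integral>u. indicator {0<..<norm (q - p)} u \<partial>lborel)"
      by (simp only: edge_integral_def)
    then show ?thesis by simp
  qed
  have "(\<Sum>(p, q)\<in>A. edge_weight \<Theta> p q * norm (q - p)) = (\<Sum>(p, q)\<in>A. edge_weight \<Theta> p q * edge_integral (mass_test a b R) p q)"
    using full by (intro sum.cong) auto
  also have "\<dots> \<le> (\<Sum>(p, q)\<in>E. edge_weight \<Theta> p q * edge_integral (mass_test a b R) p q)"
  proof (rule sum_mono2[OF finE AE], clarify)
    fix p q assume "(p, q) \<in> E"
    then show "0 \<le> edge_weight \<Theta> p q * edge_integral (mass_test a b R) p q"
      using w[of p q] edge_integral_nonneg[OF mass_test_props(1)[OF ab]] by (intro mult_nonneg_nonneg) auto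
  qed
  also have "\<dots> = 2 * (\<integral>z. mass_test a b R z \<partial>network_measure X \<Theta>)"
    using network_integral(2)[OF V continuous_mass_test mass_test_props(2)[OF ab, where R = R]] by (simp add: E_def)
  finally show ?thesis by (simp add: A_def)
qed

text \<open>Three demands on \<open>c\<close>: the angle bound, the comparison of left and right
  multiplicities, and the squeeze of a slice multiplicity \<open>N\<close> between
  \<open>k - 1\<close> and \<open>k + 1\<close>, where the error 1/4 of the mass and the error due
  to \<open>c\<close> must stay below 1 together.\<close>

lemma flat_constant_exists:
  fixes C \<theta> :: real and k :: nat
  assumes C: "0 < C" and \<theta>: "0 < \<theta>"
  obtains c where "0 < c" "c < 1" "2 * C * (1 / c - 1) < 1" "arccos c \<le> \<theta>"
    and "\<And>N J :: real. c * N \<le> J \<Longrightarrow> c\<^sup>2 * J \<le> N \<Longrightarrow> \<bar>J - real k\<bar> < 1/4 \<Longrightarrow> real k - 1 < N \<and> N < real k + 1"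
proof -
  \<comment> \<open>The errors to be absorbed are multiples of \<open>\<delta> * C\<close>,
    \<open>\<delta> * k\<close> and \<open>\<delta>\<close>; this choice makes eight times their sum
    equal to 1.\<close>
  define \<delta> where "\<delta> = 1 / (8 * (C + real k + 1))"
  have \<delta>: "0 < \<delta>" "\<delta> \<le> 1 / 8" "8 * \<delta> * (C + real k + 1) = 1" using C by (auto simp: \<delta>_def field_simps)
  \<comment> \<open>\<open>min \<theta> 1\<close> stays in the range where \<open>arccos\<close>
    inverts \<open>cos\<close>, also for large \<open>\<theta>\<close>.\<close>
  define c where "c = max (cos (min \<theta> 1)) (1 - \<delta>)"
  have c\<delta>: "1 - \<delta> \<le> c" by (simp add: c_def)
  have "cos (min \<theta> 1) < cos 0" using \<theta> pi_gt3 by (intro cos_monotone_0_pi) auto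
  then have c1: "c < 1" using \<delta> by (simp add: c_def)
  have c0: "0 < c" using c\<delta> \<delta> by linarith
  have inv: "1 / c \<le> 1 + 2 * \<delta>"
  proof -
    have "1 \<le> (1 + 2 * \<delta>) * (1 - \<delta>)" using \<delta> mult_mono[of \<delta> "1/8" \<delta> \<delta>] by (simp add: algebra_simps)
    also have "\<dots> \<le> (1 + 2 * \<delta>) * c" using c\<delta> \<delta> by (intro mult_left_mono) auto
    finally show ?thesis using c0 by (simp add: field_simps)
  qed
  have sq: "1 - 2 * \<delta> \<le> c\<^sup>2"
  proof -
    have "1 - 2 * \<delta> \<le> (1 - \<delta>)\<^sup>2" by (simp add: power2_diff)
    also have "\<dots> \<le> c\<^sup>2" using c\<delta> \<delta> by (intro power_mono) auto
    finally show ?thesis .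
  qed
  have prod: "8 * (\<delta> * C) + 8 * (\<delta> * real k) + 8 * \<delta> = 1" using \<delta>(3) by (simp add: algebra_simps)
  have pos: "0 < \<delta> * C" "0 \<le> \<delta> * real k" using \<delta> C by auto
  show thesis
  proof (rule that[OF c0 c1])
    have "2 * C * (1 / c - 1) \<le> 2 * C * (2 * \<delta>)" using inv C by (intro mult_left_mono) auto
    also have "\<dots> = 4 * (\<delta> * C)" by simp
    finally show "2 * C * (1 / c - 1) < 1" using prod pos \<delta>(1) by linarith
    have "arccos c \<le> arccos (cos (min \<theta> 1))" using c1 by (intro arccos_le_arccos) (auto simp: c_def)
    also have "\<dots> = min \<theta> 1" using \<theta> pi_gt3 by (intro arccos_cos) auto
    finally show "arccos c \<le> \<theta>" by simp
    fix N J :: real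
    assume NJ: "c * N \<le> J" "c\<^sup>2 * J \<le> N" and Jk: "\<bar>J - real k\<bar> < 1/4"
    have Jk': "J \<le> real k + 1/4" "real k - 1/4 \<le> J" using Jk unfolding abs_less_iff by linarith+
    have "N \<le> J * (1 / c)" using NJ(1) c0 by (simp add: field_simps)
    also have "\<dots> \<le> (real k + 1/4) * (1 / c)" using Jk' c0 by (intro mult_right_mono) auto
    also have "\<dots> \<le> (real k + 1/4) * (1 + 2 * \<delta>)" using inv by (intro mult_left_mono) auto
    also have "\<dots> = real k + 1/4 + 2 * (\<delta> * real k) + \<delta> / 2" by (simp add: algebra_simps)
    finally have up: "N < real k + 1" using prod pos \<delta>(1) by linarith
    have "real k - 1 < N"
    \<comment> \<open>For \<open>k = 0\<close> the number \<open>k - 1/4\<close> is negative, and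
      multiplying by it would reverse the estimate of \<open>c\<^sup>2\<close>.\<close>
    proof (cases "k = 0")
      case True
      have "c\<^sup>2 * (- 1/4) \<le> c\<^sup>2 * J" using Jk' True by (intro mult_left_mono) auto
      moreover have "c\<^sup>2 \<le> 1" using c0 c1 by (simp add: power_le_one)
      ultimately show ?thesis using NJ(2) True by simp
    next
      case False
      have "(1 - 2 * \<delta>) * (real k - 1/4) \<le> c\<^sup>2 * (real k - 1/4)" using sq False by (intro mult_right_mono) auto
      also have "\<dots> \<le> c\<^sup>2 * J" using Jk' by (intro mult_left_mono) auto
      finally have "real k - 1/4 - 2 * (\<delta> * real k) + \<delta> / 2 \<le> N" using NJ(2) by (simp add: algebra_simps)
      then show ?thesis using prod pos \<delta>(1) by linarith
    qed
    then show "real k - 1 < N \<and> N < real k + 1" using up by simp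
  qed
qed

theorem theorem11:
  fixes k :: nat
    and X :: "nat \<Rightarrow> (real \<times> (real ^ 'm)) set"
    and \<Theta> :: "nat \<Rightarrow> real \<times> (real ^ 'm) \<Rightarrow> real"
    and a b r R \<theta> :: real
    and I :: "real set"
  assumes "k \<ge> 1"
    and "\<And>i. ISGN (X i) (\<Theta> i)"
    and "radon_weak_conv (\<lambda>i. network_measure (X i) (\<Theta> i)) (axis_measure k)"
    and "I = {a<..<b}"
    and "0 < r" and "r < R" and "\<theta> > 0"
  shows "\<exists>N. \<forall>i\<ge>N.
      X i \<inter> tube I R \<subseteq> tube I r
    \<and> (\<forall>x \<in> regular_points (X i) \<inter> tube I R. \<forall>v. tangent_vector (X i) x v \<longrightarrow> axis_angle v \<le> \<theta>)
    \<and> (\<forall>x \<in> singular_points (X i) \<inter> tube I R. left_mult (X i) (\<Theta> i) x = right_mult (X i) (\<Theta> i) x)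
    \<and> (\<forall>t \<in> I. finite (X i \<inter> tube {t} R) \<and> card (X i \<inter> tube {t} R) \<le> k
         \<and> (\<Sum>x \<in> X i \<inter> tube {t} R. mult_ext (X i) (\<Theta> i) x) = real k)"
proof (cases "a < b")
  case False
  then have "I = {}" using assms(4) by simp
  then show ?thesis by (simp add: tube_def)
next
  case True
  then have ab: "a \<le> b" by simp
  note net = assms(2) and conv = assms(3)
  define \<mu> where "\<mu> i = network_measure (X i) (\<Theta> i)" for i
  define L where "L = (\<integral>z. mass_test a b R z \<partial>(axis_measure k :: (real \<times> (real ^ 'm)) measure))"
  \<comment> \<open>The summand 1 leaves room for convergence, the absolute value keeps
    \<open>C\<close> positive, and the factor 2 is that of \<open>mass_bound\<close>.\<close>
  define C where "C = 2 * (\<bar>L\<bar> + 1)"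
  have C: "0 < C" by (simp add: C_def)
  define K where "K = b - a + 1"
  have K: "0 < K" using True by (simp add: K_def)
  obtain c where c: "0 < c" "c < 1" "2 * C * (1 / c - 1) < 1" "arccos c \<le> \<theta>"
    and cN: "\<And>N J :: real. c * N \<le> J \<Longrightarrow> c\<^sup>2 * J \<le> N \<Longrightarrow> \<bar>J - real k\<bar> < 1/4 \<Longrightarrow> real k - 1 < N \<and> N < real k + 1"
    using flat_constant_exists[OF C assms(7)] by blast
  define m where "m = real CARD('m)"
  have m: "0 < m" by (simp add: m_def)
  \<comment> \<open>The second bound is the solution of
    \<open>8 * m\<^sup>2 * C\<^sup>2 * \<rho> = 1 - c\<close>, the tilt condition written out; the
    first places the confining tube inside radius \<open>r\<close>.\<close>
  define \<rho> where "\<rho> = min r ((1 - c) / (8 * m\<^sup>2 * C\<^sup>2))"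
  have \<rho>: "0 < \<rho>" "\<rho> \<le> r" using assms(5) c C m by (auto simp: \<rho>_def)
  have tilt: "(m * (2 * C * sqrt (2 * \<rho>)))\<^sup>2 \<le> 1 - c"
  proof -
    have "(m * (2 * C * sqrt (2 * \<rho>)))\<^sup>2 = 8 * m\<^sup>2 * C\<^sup>2 * \<rho>"
      using \<rho>(1) by (simp add: power_mult_distrib)
    also have "\<dots> \<le> 8 * m\<^sup>2 * C\<^sup>2 * ((1 - c) / (8 * m\<^sup>2 * C\<^sup>2))"
      by (intro mult_left_mono) (auto simp: \<rho>_def)
    also have "\<dots> = 1 - c" using C m by simp
    finally show ?thesis .
  qed
  define l where "l = min 1 ((R - \<rho>) / 2)"
  have "l \<le> (R - \<rho>) / 2" unfolding l_def by (rule min.cobounded2)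
  then have "\<rho> + 2 * l \<le> R" by (simp add: field_simps)
  moreover have "0 < l" "l \<le> 1" using \<rho> assms(6) by (auto simp: l_def)
  ultimately have l: "0 < l" "l \<le> 1" "\<rho> + 2 * l \<le> R" by simp_all

  have ev_narrow: "\<forall>\<^sub>F i in sequentially. \<forall>z. z \<in> X i \<longrightarrow> z \<in> slab (a - 7) (b + 7) R \<longrightarrow> norm (snd z) < \<rho>"
    by (rule eventually_narrow[OF net conv \<rho>(1)])
  have "(\<lambda>i. \<integral>z. mass_test a b R z \<partial>\<mu> i) \<longlonglongrightarrow> L"
    unfolding L_def \<mu>_def
    by (rule weak_conv_test[OF conv continuous_mass_test compact_slab mass_test_props(2)[OF ab]])
  then have ev_mass: "\<forall>\<^sub>F i in sequentially. (\<integral>z. mass_test a b R z \<partial>\<mu> i) < \<bar>L\<bar> + 1"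
    by (intro order_tendstoD(2)) auto
  have RR: "\<rho> < R" using \<rho> assms(6) by simp
  have "(\<integral>z. tube_test a b R \<rho> z \<partial>(axis_measure k :: (real \<times> (real ^ 'm)) measure)) = real k * K"
  proof -
    have "tube_test a b R \<rho> (t, 0 :: real ^ 'm) = trapezoid a b t" for t
      using RR \<rho> by (simp add: tube_test_def min_def max_def)
    then show ?thesis
      unfolding axis_measure_integral[OF continuous_tube_test] by (simp add: integral_trapezoid[OF ab] K_def)
  qed
  moreover have "(\<lambda>i. \<integral>z. tube_test a b R \<rho> z \<partial>\<mu> i) \<longlonglongrightarrow> (\<integral>z. tube_test a b R \<rho> z \<partial>(axis_measure k :: (real \<times> (real ^ 'm)) measure))"
    unfolding \<mu>_def
  proof (rule weak_conv_test[OF conv continuous_tube_test compact_slab[of "a - 1" "b + 1" R]])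
    fix z :: "real \<times> (real ^ 'm)" assume "z \<notin> slab (a - 1) (b + 1) R"
    then have "\<not> (fst z \<in> {a - 1..b + 1} \<and> norm (snd z) < R)" by (auto simp: mem_slab)
    then show "tube_test a b R \<rho> z = 0" using tube_test_support[OF ab RR] by blast
  qed
  ultimately have "(\<lambda>i. \<integral>z. tube_test a b R \<rho> z \<partial>\<mu> i) \<longlonglongrightarrow> real k * K" by simp
  \<comment> \<open>\<open>K\<close> is the integral of the trapezoid, so the quotient approximates
    the multiplicity per unit length, in the normalisation of \<open>cN\<close>.\<close>
  then have "(\<lambda>i. (\<integral>z. tube_test a b R \<rho> z \<partial>\<mu> i) / K) \<longlonglongrightarrow> real k * K / K"
    using K by (intro tendsto_divide tendsto_const) auto
  then have "(\<lambda>i. (\<integral>z. tube_test a b R \<rho> z \<partial>\<mu> i) / K) \<longlonglongrightarrow> real k" using K by simp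
  then have ev_test: "\<forall>\<^sub>F i in sequentially. \<bar>(\<integral>z. tube_test a b R \<rho> z \<partial>\<mu> i) / K - real k\<bar> < 1/4"
    using tendstoD[of _ "real k" sequentially "1/4"] by (simp add: dist_real_def)
  have "\<forall>\<^sub>F i in sequentially.
      X i \<inter> tube I R \<subseteq> tube I r
    \<and> (\<forall>x \<in> regular_points (X i) \<inter> tube I R. \<forall>v. tangent_vector (X i) x v \<longrightarrow> axis_angle v \<le> \<theta>)
    \<and> (\<forall>x \<in> singular_points (X i) \<inter> tube I R. left_mult (X i) (\<Theta> i) x = right_mult (X i) (\<Theta> i) x)
    \<and> (\<forall>t \<in> I. finite (X i \<inter> tube {t} R) \<and> card (X i \<inter> tube {t} R) \<le> k
         \<and> (\<Sum>x \<in> X i \<inter> tube {t} R. mult_ext (X i) (\<Theta> i) x) = real k)"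
    using ev_narrow ev_mass ev_test
  proof eventually_elim
    case (elim i)
    interpret flat_network "X i" "\<Theta> i" a b R \<rho> C l c
    proof unfold_locales
      show "ISGN (X i) (\<Theta> i)" by (rule net)
      show "(\<Sum>(p, q)\<in>active (X i) V (slab (a - 6) (b + 6) R). edge_weight (\<Theta> i) p q * norm (q - p)) \<le> C"
        if "vertex_set (X i) (slab (a - 8) (b + 8) (R + 2)) l V" for V
        using mass_bound[OF net ab l(2) that] elim(2) by (simp add: C_def \<mu>_def)
      show "(real CARD('m) * (2 * C * sqrt (2 * \<rho>)))\<^sup>2 \<le> 1 - c" using tilt by (simp add: m_def)
    qed (use ab \<rho> l c elim(1) in auto)
    have loc: "x \<in> X i \<Longrightarrow> fst x \<in> {a - 4..b + 4} \<and> norm (snd x) \<le> R \<and> x \<in> slab (a - 7) (b + 7) R"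
      if "x \<in> tube I R" for x
      using that assms(4) by (auto simp: tube_def mem_slab)
    have "X i \<inter> tube I R \<subseteq> tube I r"
    proof
      fix x assume x: "x \<in> X i \<inter> tube I R"
      then have "norm (snd x) < r" using no_leak[of x] loc[of x] \<rho>(2) by auto
      then show "x \<in> tube I r" using x by (auto simp: tube_def)
    qed
    moreover have "axis_angle v \<le> \<theta>"
      if x: "x \<in> regular_points (X i) \<inter> tube I R" and v: "tangent_vector (X i) x v" for x v
    proof -
      have xX: "x \<in> X i" using x regular_points_subset by blast
      have s: "sgn v \<in> directions (X i) x" using tangent_vector_pair(1)[OF v] by simp
      have "c \<le> \<bar>fst (sgn v)\<bar>" "\<bar>fst (sgn v)\<bar> \<le> 1"
        using direction_flat[OF xX _ _ s] loc[of x] x xX by auto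
      moreover have "\<bar>v \<bullet> E1\<bar> / norm v = \<bar>fst (sgn v)\<bar>"
        by (simp add: inner_E1 sgn_div_norm abs_mult divide_inverse_commute)
      ultimately have "axis_angle v \<le> arccos c"
        unfolding axis_angle_def using c by (intro arccos_le_arccos) auto
      then show ?thesis using c(4) by simp
    qed
    moreover have "left_mult (X i) (\<Theta> i) x = right_mult (X i) (\<Theta> i) x"
      if x: "x \<in> singular_points (X i) \<inter> tube I R" for x
    proof -
      have "x \<in> X i" using x by (simp add: singular_points_def)
      then show ?thesis using loc[of x] x by (intro left_mult_eq_right_mult) auto
    qed
    moreover have "finite (X i \<inter> tube {t} R) \<and> card (X i \<inter> tube {t} R) \<le> k
         \<and> (\<Sum>x \<in> X i \<inter> tube {t} R. mult_ext (X i) (\<Theta> i) x) = real k" if t: "t \<in> I" for t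
    proof -
      have t': "t \<in> {a - 4..b + 4}" "t \<in> {a..b}" using t assms(4) by auto
      have fin: "finite (X i \<inter> tube {t} R)" by (rule finite_slice[OF t'(1)])
      obtain n :: nat where n: "(\<Sum>x\<in>X i \<inter> tube {t} R. mult_ext (X i) (\<Theta> i) x) = real n"
        using slice_multiplicity_nat[OF t'(1)] by blast
      have "c * real n \<le> (\<integral>z. tube_test a b R \<rho> z \<partial>\<mu> i) / K" "c\<^sup>2 * ((\<integral>z. tube_test a b R \<rho> z \<partial>\<mu> i) / K) \<le> real n"
        using slice_multiplicity[OF t'(2)] K unfolding n \<mu>_def K_def[symmetric] by (simp_all add: field_simps)
      then have "real k - 1 < real n \<and> real n < real k + 1" using elim(3) by (rule cN)
      then have nk: "n = k" by linarith
      \<comment> \<open>Every point of the slice has multiplicity at least 1, so the count is at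
        most the total.\<close>
      have "real (card (X i \<inter> tube {t} R)) = (\<Sum>x\<in>X i \<inter> tube {t} R. 1)" by simp
      also have "\<dots> \<le> (\<Sum>x\<in>X i \<inter> tube {t} R. mult_ext (X i) (\<Theta> i) x)"
        using mult_ext_ge_1 by (intro sum_mono) auto
      finally have "card (X i \<inter> tube {t} R) \<le> k" unfolding n nk by simp
      then show ?thesis using fin n nk by simp
    qed
    ultimately show ?case by blast
  qed
  then show ?thesis unfolding eventually_sequentially .
qed

end
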